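(* Let $D\subset\mathbb{R}^n$ be a bounded open set. Let $\Phi$ be a Young function with $\phi=\Phi'$ such that, for some fixed numbers $p^\pm$, $1<p^-\le \frac{t\phi'(t)}{\phi(t)}\le p^+<\infty$ for all $t>0$, and such that $\phi$ is convex on $[0,\infty)$. Let $f\in L^{\Phi^*}(D)$ and let $\Omega_k$ ($k\in\mathbb{N}$) and $\Omega$ be open subsets of $D$. If $\Omega_k\to\Omega$ in the Hausdorff complementary topology and $\mathrm{cap}_\Phi(\Omega_k\setminus\Omega,D)\to0$ as $k\to\infty$, then, up to a subsequence, $u_{\Omega_k,f}\rightharpoonup u_{\Omega,f}$ weakly in $W^{1,\Phi}_0(D)$.
   Context: A Young function is $\Phi:[0,\infty)\to[0,\infty)$ of the form $\Phi(t)=\int_0^t\phi(\tau)\,d\tau$, where $\phi$ is right continuous and nondecreasing, $\phi(0)=0$, $\phi(t)>0$ for $t>0$, and $\phi(t)\to\infty$ as $t\to\infty$ (when $\phi'$ appears, $\phi$ is assumed differentiable on $(0,\infty)$). Its complementary function is $\Phi^*(t)=\sup\{tw-\Phi(w):w>0\}$. For open $\Omega\subset\mathbb{R}^n$, $L^\Phi(\Omega)$ is the set of measurable $u$ with $\int_\Omega\Phi(|u|)\,dx<\infty$, normed by $\|u\|_{L^\Phi(\Omega)}=\inf\{\lambda>0:\int_\Omega\Phi(|u|/\lambda)\,dx\le1\}$; $L^{\Phi^*}(\Omega)$ is defined likewise with $\Phi^*$. $W^{1,\Phi}(\Omega)=\{u\in L^\Phi(\Omega):|\nabla u|\in L^\Phi(\Omega)\}$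 (distributional derivatives) with norm $\|u\|_{L^\Phi(\Omega)}+\|\nabla u\|_{L^\Phi(\Omega)}$, and $W^{1,\Phi}_0(\Omega)$ is the closure of $C_c^\infty(\Omega)$ in this norm. For open $\Omega\subset D$ and $f\in L^{\Phi^*}(D)$, $u_{\Omega,f}\in W^{1,\Phi}_0(\Omega)$ denotes the weak solution of $-\Delta_\phi u=f$ in $\Omega$, $u=0$ on $\partial\Omega$, where $\Delta_\phi u=\mathrm{div}\big(\frac{\phi(|\nabla u|)}{|\nabla u|}\nabla u\big)$; that is, $\int_\Omega\frac{\phi(|\nabla u|)}{|\nabla u|}\nabla u\cdot\nabla v\,dx=\int_\Omega fv\,dx$ for all $v\in W^{1,\Phi}_0(\Omega)$ (with $\frac{\phi(|a|)}{|a|}a:=0$ for $a=0$). Functions in $W^{1,\Phi}_0(\Omega)$ are extended by zero and regarded as elements of $W^{1,\Phi}_0(D)$. Hausdorff complementary topology: for open $\Omega_1,\Omega_2\subset D$, $d_{H^c}(\Omega_1,\Omega_2)=d(\Omega_1^c,\Omega_2^c)$, where $d$ is the usual Hausdorff distance and $^c$ denotes complement in $\mathbb{R}^n$; $\Omega_k\to\Omega$ in this topology means $d_{H^c}(\Omega_k,\Omega)\to0$. Relative $\Phi$-capacity: for compact $K\subset D$ let $R_\Phi(K,D)=\{u\in W^{1,\Phi}(D)\cap C_0(D): u>1\text{ on }K,\ u\ge0\}$, where $C_0(D)$ is the set of continuous functions with compact support in $D$, and $\mathrm{cap}^*_\Phi(K,D)=\inf_{u\in R_\Phi(K,D)}\int_D\Phi(|\nabla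 u|)\,dx$. For open $U\subset D$, $\mathrm{cap}_\Phi(U,D)=\sup\{\mathrm{cap}^*_\Phi(K,D):K\subset U\text{ compact}\}$; for arbitrary $E\subset D$, $\mathrm{cap}_\Phi(E,D)=\inf\{\mathrm{cap}_\Phi(U,D):E\subset U\subset D,\ U\text{ open}\}$. *)

theory Defs
  imports "HOL-Analysis.Analysis"
begin

text \<open>
  The ambient space \<open>\<real>\<^sup>n\<close> is an arbitrary Euclidean space.  A function on an open set \<open>\<Omega>\<close> is
  represented by a total function whose values outside \<open>\<Omega>\<close> are irrelevant, and classes modulo
  equality almost everywhere are represented by their members; every norm, integral and weak
  derivative below only sees the class on \<open>\<Omega>\<close>.  Likewise Young functions are functions on
  \<open>real\<close> that are only looked at on \<open>{0..}\<close>.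
\<close>


section \<open>Young functions and Orlicz spaces\<close>

definition young_function :: "(real \<Rightarrow> real) \<Rightarrow> (real \<Rightarrow> real) \<Rightarrow> bool" where
  "young_function \<Phi> \<phi> \<longleftrightarrow>
     (\<forall>t\<ge>0. continuous (at_right t) \<phi>) \<and> mono_on {0..} \<phi> \<and>
     \<phi> 0 = 0 \<and> (\<forall>t>0. \<phi> t > 0) \<and> filterlim \<phi> at_top at_top \<and>
     (\<forall>t\<ge>0. \<Phi> t = integral {0..t} \<phi>)"

text \<open>The supremum is over a set of reals that is bounded above when \<open>\<Phi>\<close> is a Young function,
  since then \<open>\<Phi> w / w\<close> tends to infinity.\<close>

definition young_conj :: "(real \<Rightarrow> real) \<Rightarrow> real \<Rightarrow> real" where
  "young_conj \<Phi> t = (SUP w\<in>{0<..}. t * w - \<Phi> w)"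

definition orlicz_modular ::
    "(real \<Rightarrow> real) \<Rightarrow> 'a::euclidean_space set \<Rightarrow> ('a \<Rightarrow> real) \<Rightarrow> ennreal" where
  "orlicz_modular \<Phi> \<Omega> u = (\<integral>\<^sup>+x. ennreal (\<Phi> \<bar>u x\<bar>) \<partial>lebesgue_on \<Omega>)"

definition orlicz_space ::
    "(real \<Rightarrow> real) \<Rightarrow> 'a::euclidean_space set \<Rightarrow> ('a \<Rightarrow> real) set" where
  "orlicz_space \<Phi> \<Omega> = {u. u \<in> borel_measurable (lebesgue_on \<Omega>) \<and> orlicz_modular \<Phi> \<Omega> u < \<infinity>}"

definition orlicz_norm ::
    "(real \<Rightarrow> real) \<Rightarrow> 'a::euclidean_space set \<Rightarrow> ('a \<Rightarrow> real) \<Rightarrow> real" where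
  "orlicz_norm \<Phi> \<Omega> u = Inf {l. l > 0 \<and> orlicz_modular \<Phi> \<Omega> (\<lambda>x. u x / l) \<le> 1}"


section \<open>Test functions and weak gradients\<close>

fun C_k :: "nat \<Rightarrow> ('a::euclidean_space \<Rightarrow> real) \<Rightarrow> bool" where
  "C_k 0 f \<longleftrightarrow> continuous_on UNIV f"
| "C_k (Suc k) f \<longleftrightarrow>
     (\<forall>x. f differentiable (at x)) \<and> (\<forall>b\<in>Basis. C_k k (\<lambda>x. frechet_derivative f (at x) b))"

definition test_functions :: "'a::euclidean_space set \<Rightarrow> ('a \<Rightarrow> real) set" where
  "test_functions \<Omega> = {f. (\<forall>k. C_k k f) \<and>
     compact (closure (support_on UNIV f)) \<and> closure (support_on UNIV f) \<subseteq> \<Omega>}"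

definition locally_integrable_on ::
    "('a::euclidean_space \<Rightarrow> 'b::euclidean_space) \<Rightarrow> 'a set \<Rightarrow> bool" where
  "locally_integrable_on f \<Omega> \<longleftrightarrow> (\<forall>K. compact K \<and> K \<subseteq> \<Omega> \<longrightarrow> f absolutely_integrable_on K)"

definition has_weak_grad ::
    "'a::euclidean_space set \<Rightarrow> ('a \<Rightarrow> real) \<Rightarrow> ('a \<Rightarrow> 'a) \<Rightarrow> bool" where
  "has_weak_grad \<Omega> u g \<longleftrightarrow> locally_integrable_on u \<Omega> \<and> locally_integrable_on g \<Omega> \<and>
     (\<forall>\<psi>\<in>test_functions \<Omega>. \<forall>b\<in>Basis.
        (\<integral>x. u x * frechet_derivative \<psi> (at x) b \<partial>lebesgue_on \<Omega>)
          = - (\<integral>x. (g x \<bullet> b) * \<psi> x \<partial>lebesgue_on \<Omega>))"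

text \<open>The weak gradient is unique up to a null set of \<open>\<Omega>\<close>; \<open>weak_grad\<close> picks a representative.\<close>

definition weak_grad :: "'a::euclidean_space set \<Rightarrow> ('a \<Rightarrow> real) \<Rightarrow> 'a \<Rightarrow> 'a" where
  "weak_grad \<Omega> u = (SOME g. has_weak_grad \<Omega> u g)"


section \<open>Orlicz--Sobolev spaces\<close>

definition sobolev ::
    "(real \<Rightarrow> real) \<Rightarrow> 'a::euclidean_space set \<Rightarrow> ('a \<Rightarrow> real) set" where
  "sobolev \<Phi> \<Omega> = {u \<in> orlicz_space \<Phi> \<Omega>.
     (\<exists>g. has_weak_grad \<Omega> u g) \<and> (\<lambda>x. norm (weak_grad \<Omega> u x)) \<in> orlicz_space \<Phi> \<Omega>}"

definition sobolev_norm ::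
    "(real \<Rightarrow> real) \<Rightarrow> 'a::euclidean_space set \<Rightarrow> ('a \<Rightarrow> real) \<Rightarrow> real" where
  "sobolev_norm \<Phi> \<Omega> u = orlicz_norm \<Phi> \<Omega> u + orlicz_norm \<Phi> \<Omega> (\<lambda>x. norm (weak_grad \<Omega> u x))"

definition sobolev0 ::
    "(real \<Rightarrow> real) \<Rightarrow> 'a::euclidean_space set \<Rightarrow> ('a \<Rightarrow> real) set" where
  "sobolev0 \<Phi> \<Omega> = {u \<in> sobolev \<Phi> \<Omega>.
     \<forall>e>0. \<exists>\<psi>\<in>test_functions \<Omega>. sobolev_norm \<Phi> \<Omega> (\<lambda>x. u x - \<psi> x) < e}"

definition zero_ext :: "'a set \<Rightarrow> ('a \<Rightarrow> real) \<Rightarrow> 'a \<Rightarrow> real" where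
  "zero_ext \<Omega> u = (\<lambda>x. if x \<in> \<Omega> then u x else 0)"

text \<open>Boundedness and linearity make such a functional respect equality almost everywhere.\<close>

definition sobolev0_dual ::
    "(real \<Rightarrow> real) \<Rightarrow> 'a::euclidean_space set \<Rightarrow> (('a \<Rightarrow> real) \<Rightarrow> real) set" where
  "sobolev0_dual \<Phi> D = {L.
     (\<forall>u\<in>sobolev0 \<Phi> D. \<forall>v\<in>sobolev0 \<Phi> D. L (\<lambda>x. u x + v x) = L u + L v) \<and>
     (\<forall>c. \<forall>u\<in>sobolev0 \<Phi> D. L (\<lambda>x. c * u x) = c * L u) \<and>
     (\<exists>C. \<forall>u\<in>sobolev0 \<Phi> D. \<bar>L u\<bar> \<le> C * sobolev_norm \<Phi> D u)}"

definition weakly_converges_sobolev0 ::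
    "(real \<Rightarrow> real) \<Rightarrow> 'a::euclidean_space set \<Rightarrow> (nat \<Rightarrow> 'a \<Rightarrow> real) \<Rightarrow> ('a \<Rightarrow> real) \<Rightarrow> bool" where
  "weakly_converges_sobolev0 \<Phi> D v w \<longleftrightarrow>
     (\<forall>k. v k \<in> sobolev0 \<Phi> D) \<and> w \<in> sobolev0 \<Phi> D \<and>
     (\<forall>L\<in>sobolev0_dual \<Phi> D. (\<lambda>k. L (v k)) \<longlonglongrightarrow> L w)"


section \<open>Weak solutions\<close>

text \<open>Where the gradient vanishes the left integrand is \<open>0\<close>, as it should be.\<close>

definition weak_solution ::
    "(real \<Rightarrow> real) \<Rightarrow> (real \<Rightarrow> real) \<Rightarrow> 'a::euclidean_space set \<Rightarrow> ('a \<Rightarrow> real) \<Rightarrow>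
       ('a \<Rightarrow> real) \<Rightarrow> bool" where
  "weak_solution \<Phi> \<phi> \<Omega> f u \<longleftrightarrow> u \<in> sobolev0 \<Phi> \<Omega> \<and>
     (\<forall>v\<in>sobolev0 \<Phi> \<Omega>.
        (\<integral>x. \<phi> (norm (weak_grad \<Omega> u x)) / norm (weak_grad \<Omega> u x)
               * (weak_grad \<Omega> u x \<bullet> weak_grad \<Omega> v x) \<partial>lebesgue_on \<Omega>)
          = (\<integral>x. f x * v x \<partial>lebesgue_on \<Omega>))"


section \<open>Hausdorff complementary distance and capacity\<close>

text \<open>Used for nonempty sets only: the library sets \<open>infdist x {} = 0\<close>.\<close>

definition hausdorff_distance :: "'a::metric_space set \<Rightarrow> 'a set \<Rightarrow> ennreal" where
  "hausdorff_distance A B =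
     sup (SUP a\<in>A. ennreal (infdist a B)) (SUP b\<in>B. ennreal (infdist b A))"

definition hausdorff_compl_distance :: "'a::metric_space set \<Rightarrow> 'a set \<Rightarrow> ennreal" where
  "hausdorff_compl_distance \<Omega>1 \<Omega>2 = hausdorff_distance (- \<Omega>1) (- \<Omega>2)"

definition cap_admissible ::
    "(real \<Rightarrow> real) \<Rightarrow> 'a::euclidean_space set \<Rightarrow> 'a set \<Rightarrow> ('a \<Rightarrow> real) set" where
  "cap_admissible \<Phi> K D = {u \<in> sobolev \<Phi> D. continuous_on D u \<and>
     compact (closure (support_on D u)) \<and> closure (support_on D u) \<subseteq> D \<and>
     (\<forall>x\<in>K. u x > 1) \<and> (\<forall>x\<in>D. u x \<ge> 0)}"

definition cap_compact ::
    "(real \<Rightarrow> real) \<Rightarrow> 'a::euclidean_space set \<Rightarrow> 'a set \<Rightarrow> ennreal" where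
  "cap_compact \<Phi> K D =
     (INF u\<in>cap_admissible \<Phi> K D. orlicz_modular \<Phi> D (\<lambda>x. norm (weak_grad D u x)))"

definition cap_open ::
    "(real \<Rightarrow> real) \<Rightarrow> 'a::euclidean_space set \<Rightarrow> 'a set \<Rightarrow> ennreal" where
  "cap_open \<Phi> U D = (SUP K\<in>{K. compact K \<and> K \<subseteq> U}. cap_compact \<Phi> K D)"

definition capacity ::
    "(real \<Rightarrow> real) \<Rightarrow> 'a::euclidean_space set \<Rightarrow> 'a set \<Rightarrow> ennreal" where
  "capacity \<Phi> E D = (INF U\<in>{U. open U \<and> E \<subseteq> U \<and> U \<subseteq> D}. cap_open \<Phi> U D)"

end

theory Submission
  imports Defs
begin

text \<open>
  Weak solutions minimize \<open>J v = \<integral>\<Phi>(|\<nabla>v|) - \<integral>f v\<close>.  Convexity of \<open>\<phi>\<close> makes \<open>s \<mapsto> \<Phi>(\<surd>s)\<close> convex, so \<open>J\<close> is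
  uniformly convex in the sense of Clarkson: the modular of \<open>(\<nabla>v - \<nabla>u)/2\<close> is at most half of
  \<open>J v - J u\<close> for the minimizer \<open>u\<close>.  It therefore suffices to compare minima, and one even gets strong
  convergence of the whole sequence, without any weak compactness.

  A test function of \<open>\<Omega>\<close> close to the solution on \<open>\<Omega>\<close> is a test function of \<open>\<Omega>\<^sub>k\<close> for large \<open>k\<close>, by Hausdorff
  convergence; so the minimum on \<open>\<Omega>\<^sub>k\<close> is asymptotically at most the one on \<open>\<Omega>\<close>.  Conversely, let \<open>\<psi>\<close> be a
  test function of \<open>\<Omega>\<^sub>k\<close> close to the solution there.  Its support meets the complement of \<open>\<Omega>\<close> in a compact
  subset of \<open>\<Omega>\<^sub>k - \<Omega>\<close>, on a neighbourhood of which some mollified capacitary function \<open>\<eta>\<close> with small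
  gradient exceeds \<open>1\<close>.  Truncating \<open>\<psi>\<close> and multiplying by a function of \<open>\<eta>\<close> that vanishes where \<open>\<eta> \<ge> 1\<close>
  gives a test function of \<open>\<Omega>\<close> whose energy is hardly larger.
\<close>


section \<open>Smooth functions and test functions\<close>

text \<open>The obstacle is that the solutions live on varying sets, while \<open>weak_grad\<close>
  is only a chosen representative. So functions are handled as pairs on the whole space,
  \<open>Wpair\<close>: a function and a vector field that are limits of test functions and of their
  gradients. Zero extension then commutes with the gradient by construction. Limits are taken in
  modulars instead of norms. The bound p+ makes \<Phi> grow at most like a power (the Delta_2
  condition), so that small modular and small norm amount to the same. Convexity of \<phi> makes
  \<Phi> grow at least quadratically; hence the conjugate function is doubling too, and the
  contribution of large values of |f| to the pairing can be made small. The delicate point is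
  uniformity in k. They can depend only on an energy bound common to all solutions, which comes from
  comparing each of them with zero.\<close>

definition smooth :: "('a::euclidean_space \<Rightarrow> real) \<Rightarrow> bool" where
  "smooth f \<longleftrightarrow> (\<forall>k. C_k k f)"

definition grad :: "('a::euclidean_space \<Rightarrow> real) \<Rightarrow> 'a \<Rightarrow> 'a" where
  "grad f x = (\<Sum>b\<in>Basis. frechet_derivative f (at x) b *\<^sub>R b)"

section \<open>Closure properties of the classes \<open>C_k\<close>\<close>

lemma C_k_SucI:
  assumes "\<And>x. (f has_derivative f' x) (at x)" and "\<And>b. b \<in> Basis \<Longrightarrow> C_k k (\<lambda>x. f' x b)"
  shows "C_k (Suc k) f"
proof -
  have "frechet_derivative f (at x) = f' x" for x
    using frechet_derivative_at[OF assms(1)[of x]] by simp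
  then show ?thesis
    using assms by (auto simp: differentiable_def)
qed

lemma C_k_SucD:
  assumes "C_k (Suc k) f"
  shows "(f has_derivative frechet_derivative f (at x)) (at x)"
    and "b \<in> Basis \<Longrightarrow> C_k k (\<lambda>x. frechet_derivative f (at x) b)"
  using assms by (auto simp: frechet_derivative_works)

lemma C_k_continuous: "C_k k f \<Longrightarrow> continuous_on UNIV f"
  by (cases k) (auto intro!: differentiable_imp_continuous_on simp: differentiable_on_def
      intro: differentiable_at_withinI)

lemma C_k_decrease: "C_k (Suc k) f \<Longrightarrow> C_k k f"
proof (induction k arbitrary: f)
  case 0
  then show ?case using C_k_continuous by (metis C_k.simps(1))
next
  case (Suc k)
  then show ?case by (metis C_k.simps(2))
qed

lemma C_k_const [simp]: "C_k k (\<lambda>x. c)"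
proof (induction k arbitrary: c)
  case (Suc k)
  show ?case by (rule C_k_SucI[where f' = "\<lambda>_ _. 0"]) (auto simp: Suc)
qed simp

lemma C_k_inner_left: "C_k k (\<lambda>x. x \<bullet> a)"
proof (cases k)
  case (Suc m)
  show ?thesis unfolding Suc
    by (rule C_k_SucI[where f' = "\<lambda>_ h. h \<bullet> a"]) (auto intro!: derivative_eq_intros)
qed (auto intro!: continuous_intros)

lemma C_k_add: "C_k k f \<Longrightarrow> C_k k g \<Longrightarrow> C_k k (\<lambda>x. f x + g x)"
proof (induction k arbitrary: f g)
  case (Suc k)
  show ?case
    by (rule C_k_SucI[OF has_derivative_add[OF C_k_SucD(1) C_k_SucD(1)]])
      (use Suc C_k_SucD in blast)+
qed (auto intro: continuous_intros)

lemma C_k_mult: "C_k k f \<Longrightarrow> C_k k g \<Longrightarrow> C_k k (\<lambda>x. f x * g x)"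
proof (induction k arbitrary: f g)
  case (Suc k)
  show ?case
  proof (rule C_k_SucI[OF has_derivative_mult[OF C_k_SucD(1) C_k_SucD(1)]])
    show "C_k (Suc k) f" "C_k (Suc k) g" by fact+
    fix b :: 'a assume "b \<in> Basis"
    then show "C_k k (\<lambda>x. f x * frechet_derivative g (at x) b + frechet_derivative f (at x) b * g x)"
      using Suc C_k_SucD(2) C_k_decrease by (intro C_k_add Suc.IH) blast+
  qed
qed (auto intro: continuous_intros)

lemma C_k_inner_self: "C_k k (\<lambda>x. x \<bullet> x)"
proof (cases k)
  case (Suc m)
  have "C_k m (\<lambda>x. 2 * (x \<bullet> b))" for b :: 'a
    by (intro C_k_mult C_k_const C_k_inner_left)
  then show ?thesis unfolding Suc
    by (intro C_k_SucI[where f' = "\<lambda>x h. 2 * (x \<bullet> h)"])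
      (auto intro!: derivative_eq_intros simp: inner_commute)
qed (auto intro!: continuous_intros)

text \<open>The outer function comes with all its derivatives as a sequence \<open>hs\<close>,
  because the induction step passes from \<open>hs n\<close> to \<open>hs (Suc n)\<close>; hence n
  is generalized together with f.\<close>

lemma C_k_compose:
  assumes "\<And>n t. (hs n has_real_derivative hs (Suc n) t) (at t)"
  shows "C_k k f \<Longrightarrow> C_k k (\<lambda>x. hs n (f x))"
proof (induction k arbitrary: f n)
  case 0
  have "continuous_on UNIV (hs n)"
    using assms by (meson DERIV_isCont continuous_at_imp_continuous_on)
  then show ?case using 0 by (auto intro: continuous_on_compose2)
next
  case (Suc k)
  show ?case
  proof (rule C_k_SucI)
    show "((\<lambda>x. hs n (f x)) has_derivative (\<lambda>h. frechet_derivative f (at x) h * hs (Suc n) (f x))) (at x)" for x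
      using has_derivative_compose[OF C_k_SucD(1)[OF Suc.prems] assms[of n, unfolded has_field_derivative_def]]
      by (simp add: mult.commute)
    show "C_k k (\<lambda>x. frechet_derivative f (at x) b * hs (Suc n) (f x))" if "b \<in> Basis" for b
      using Suc that C_k_SucD(2) C_k_decrease by (intro C_k_mult) blast+
  qed
qed

lemma C_k_reflect: "C_k k f \<Longrightarrow> C_k k (\<lambda>y. f (x - y))"
proof (induction k arbitrary: f)
  case 0
  then show ?case by (auto intro!: continuous_on_compose2[of UNIV f] continuous_intros)
next
  case (Suc k)
  have d: "((\<lambda>y. f (x - y)) has_derivative (\<lambda>h. frechet_derivative f (at (x - y)) (- h))) (at y)" for y
    by (rule has_derivative_compose[of "\<lambda>y. x - y" "\<lambda>h. - h" y UNIV f, OF _ C_k_SucD(1)[OF Suc.prems]])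
      (auto intro!: derivative_eq_intros)
  \<comment> \<open>The sign is written as the factor \<open>- 1\<close>, so that the closure lemmas
    for constants and products apply.\<close>
  have lin: "frechet_derivative f (at z) (- b) = - 1 * frechet_derivative f (at z) b" for z b
    using linear_neg[OF has_derivative_linear[OF C_k_SucD(1)[OF Suc.prems]]] by simp
  show ?case
    by (rule C_k_SucI[OF d], unfold lin) (intro C_k_mult C_k_const Suc.IH C_k_SucD(2)[OF Suc.prems])
qed

lemma smooth_const [simp, intro]: "smooth (\<lambda>x. c)"
  and smooth_inner_self: "smooth (\<lambda>x. x \<bullet> x)"
  and smooth_inner_left: "smooth (\<lambda>x. x \<bullet> a)"
  by (auto simp: smooth_def C_k_inner_left C_k_inner_self)

lemma smooth_add: "smooth f \<Longrightarrow> smooth g \<Longrightarrow> smooth (\<lambda>x. f x + g x)"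
  and smooth_mult: "smooth f \<Longrightarrow> smooth g \<Longrightarrow> smooth (\<lambda>x. f x * g x)"
  and smooth_reflect: "smooth f \<Longrightarrow> smooth (\<lambda>y. f (z - y))"
  by (auto simp: smooth_def intro: C_k_add C_k_mult C_k_reflect)

lemma smooth_diff: "smooth f \<Longrightarrow> smooth g \<Longrightarrow> smooth (\<lambda>x. f x - g x)"
  using smooth_add[of f "\<lambda>x. - 1 * g x"] smooth_mult[of "\<lambda>x. - 1" g] by simp

lemma smooth_sum: "(\<And>i. i \<in> I \<Longrightarrow> smooth (f i)) \<Longrightarrow> smooth (\<lambda>x. \<Sum>i\<in>I. f i x)"
  by (induction I rule: infinite_finite_induct) (auto intro: smooth_add)

lemma smooth_compose:
  assumes "\<And>n t. (hs n has_real_derivative hs (Suc n) t) (at t)" and "smooth f"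
  shows "smooth (\<lambda>x. hs n (f x))"
  using C_k_compose[of hs, OF assms(1)] assms(2) unfolding smooth_def by blast

lemma smooth_continuous: "smooth f \<Longrightarrow> continuous_on S f"
  by (meson C_k_continuous continuous_on_subset smooth_def subset_UNIV)

lemma smooth_partial: "smooth f \<Longrightarrow> b \<in> Basis \<Longrightarrow> smooth (\<lambda>x. frechet_derivative f (at x) b)"
  unfolding smooth_def by (metis C_k_SucD(2))

section \<open>The gradient as a vector field\<close>

lemma linear_eq_inner_Basis:
  fixes F :: "'a::euclidean_space \<Rightarrow> real"
  assumes "linear F"
  shows "F h = (\<Sum>b\<in>Basis. F b *\<^sub>R b) \<bullet> h"
proof -
  have "F h = F (\<Sum>b\<in>Basis. (h \<bullet> b) *\<^sub>R b)" by (simp add: euclidean_representation)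
  also have "\<dots> = (\<Sum>b\<in>Basis. (h \<bullet> b) * F b)"
    using assms by (simp add: linear_sum linear_cmul)
  finally show ?thesis by (simp add: inner_sum_left mult.commute inner_commute[of h])
qed

lemma has_derivative_grad:
  assumes "f differentiable (at x)"
  shows "(f has_derivative (\<lambda>h. grad f x \<bullet> h)) (at x)"
proof -
  have "(f has_derivative frechet_derivative f (at x)) (at x)"
    using assms frechet_derivative_works by blast
  moreover have "frechet_derivative f (at x) = (\<lambda>h. grad f x \<bullet> h)"
    using linear_eq_inner_Basis[OF has_derivative_linear[OF calculation]]
    unfolding grad_def by blast
  ultimately show ?thesis by simp
qed

lemma grad_eqI:
  assumes "(f has_derivative (\<lambda>h. v \<bullet> h)) (at x)"
  shows "grad f x = v"
proof -
  have "frechet_derivative f (at x) = (\<lambda>h. v \<bullet> h)"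
    using assms frechet_derivative_at by metis
  then show ?thesis by (simp add: grad_def euclidean_representation)
qed

lemma smooth_differentiable: "smooth f \<Longrightarrow> f differentiable (at x)"
  by (meson C_k.simps(2) smooth_def)

lemma smooth_has_derivative:
  "smooth f \<Longrightarrow> (f has_derivative (\<lambda>h. grad f x \<bullet> h)) (at x)"
  by (simp add: smooth_differentiable has_derivative_grad)

lemma frechet_eq_grad:
  "smooth f \<Longrightarrow> frechet_derivative f (at x) b = grad f x \<bullet> b"
  using frechet_derivative_at[OF smooth_has_derivative] by metis

lemma smooth_continuous_grad: "smooth f \<Longrightarrow> continuous_on S (grad f)"
  unfolding grad_def by (intro continuous_intros smooth_continuous smooth_partial)

lemma grad_add: "smooth f \<Longrightarrow> smooth g \<Longrightarrow> grad (\<lambda>x. f x + g x) x = grad f x + grad g x"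
  by (rule grad_eqI) (auto intro!: derivative_eq_intros smooth_has_derivative simp: inner_add_left)

lemma grad_mult:
  "smooth f \<Longrightarrow> smooth g \<Longrightarrow> grad (\<lambda>x. f x * g x) x = f x *\<^sub>R grad g x + g x *\<^sub>R grad f x"
  by (rule grad_eqI)
    (auto intro!: derivative_eq_intros smooth_has_derivative simp: inner_add_left algebra_simps)

lemma grad_compose:
  assumes "(h has_real_derivative h') (at (f x))" and "smooth f"
  shows "grad (\<lambda>x. h (f x)) x = h' *\<^sub>R grad f x"
  using has_derivative_compose[OF smooth_has_derivative[OF assms(2)] assms(1)[unfolded has_field_derivative_def]]
  by (intro grad_eqI) (simp add: algebra_simps)

lemma grad_const [simp]: "grad (\<lambda>x. c) = (\<lambda>x. 0)"
  by (rule ext, rule grad_eqI) simp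

lemma grad_cmult: "smooth f \<Longrightarrow> grad (\<lambda>x. c * f x) x = c *\<^sub>R grad f x"
  by (simp add: grad_mult)

lemma grad_reflect:
  assumes "smooth f"
  shows "grad (\<lambda>y. f (x - y)) y = - grad f (x - y)"
proof (rule grad_eqI)
  have "((\<lambda>y. f (x - y)) has_derivative (\<lambda>h. grad f (x - y) \<bullet> (- h))) (at y)"
    by (rule has_derivative_compose[of "\<lambda>y. x - y" "\<lambda>h. - h" y UNIV f, OF _ smooth_has_derivative[OF assms]])
      (auto intro!: derivative_eq_intros)
  then show "((\<lambda>y. f (x - y)) has_derivative (\<bullet>) (- grad f (x - y))) (at y)"
    by (simp add: inner_minus_left[abs_def])
qed

subsection \<open>Test functions\<close>

lemma test_functionI:
  assumes "smooth f" "compact C" "C \<subseteq> \<Omega>" "\<And>x. x \<notin> C \<Longrightarrow> f x = 0"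
  shows "f \<in> test_functions \<Omega>"
proof -
  have "closure (support_on UNIV f) \<subseteq> C"
    using assms by (intro closure_minimal) (auto simp: support_on_def compact_imp_closed)
  then show ?thesis
    using assms by (auto simp: test_functions_def smooth_def
        intro: bounded_subset[OF compact_imp_bounded] closed_subset simp: compact_eq_bounded_closed)
qed

text \<open>The gradient vanishes off \<open>C\<close> as well, since the complement of the closed
  support is open and f is constant on it.\<close>

lemma test_functionE:
  assumes "f \<in> test_functions \<Omega>"
  obtains C where "smooth f" "compact C" "C \<subseteq> \<Omega>" "\<And>x. x \<notin> C \<Longrightarrow> f x = 0" "\<And>x. x \<notin> C \<Longrightarrow> grad f x = 0"
proof
  let ?C = "closure (support_on UNIV f)"
  show "smooth f" "compact ?C" "?C \<subseteq> \<Omega>"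
    using assms by (auto simp: test_functions_def smooth_def)
  show *: "f x = 0" if "x \<notin> ?C" for x
    using that closure_subset by (force simp: support_on_def)
  show "grad f x = 0" if "x \<notin> ?C" for x
  proof (rule grad_eqI)
    have "open (- ?C)" "x \<in> - ?C" using that by auto
    then show "(f has_derivative (\<bullet>) 0) (at x)"
      using has_derivative_transform_within_open[of "\<lambda>x. 0" "\<lambda>x. 0" x UNIV "- ?C" f] *
      by (auto simp: inner_zero_left[abs_def])
  qed
qed

lemma test_function_smooth: "f \<in> test_functions \<Omega> \<Longrightarrow> smooth f"
  by (auto simp: test_functions_def smooth_def)

lemma test_functions_mono: "\<Omega> \<subseteq> D \<Longrightarrow> test_functions \<Omega> \<subseteq> test_functions D"
  by (auto simp: test_functions_def)

lemma test_function_zero [simp]: "(\<lambda>x. 0) \<in> test_functions \<Omega>"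
  by (rule test_functionI[where C = "{}"]) auto

lemma test_function_add:
  assumes "f \<in> test_functions \<Omega>" "g \<in> test_functions \<Omega>"
  shows "(\<lambda>x. f x + c * g x) \<in> test_functions \<Omega>"
proof -
  obtain A where A: "smooth f" "compact A" "A \<subseteq> \<Omega>" "\<And>x. x \<notin> A \<Longrightarrow> f x = 0"
    using test_functionE[OF assms(1)] by metis
  obtain B where B: "smooth g" "compact B" "B \<subseteq> \<Omega>" "\<And>x. x \<notin> B \<Longrightarrow> g x = 0"
    using test_functionE[OF assms(2)] by metis
  show ?thesis
    by (rule test_functionI[where C = "A \<union> B"])
      (use A B in \<open>auto intro!: smooth_add smooth_mult\<close>)
qed

lemma test_function_bounded:
  assumes "f \<in> test_functions \<Omega>"
  obtains B where "B > 0" "\<And>x. norm (f x) \<le> B" "\<And>x. norm (grad f x) \<le> B"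
proof -
  obtain C where C: "smooth f" "compact C" "\<And>x. x \<notin> C \<Longrightarrow> f x = 0" "\<And>x. x \<notin> C \<Longrightarrow> grad f x = 0"
    using test_functionE[OF assms] by metis
  have "bounded (f ` C)" "bounded (grad f ` C)"
    using C by (auto intro!: compact_imp_bounded compact_continuous_image smooth_continuous smooth_continuous_grad)
  then obtain a b where "a > 0" "b > 0" "\<forall>x\<in>C. norm (f x) \<le> a" "\<forall>x\<in>C. norm (grad f x) \<le> b"
    unfolding bounded_pos by auto
  then show ?thesis
    using C by (intro that[of "a + b"]) (auto, (smt (verit) norm_zero real_norm_def)+)
qed

subsection \<open>A flat function\<close>

text \<open>The functions p(1/t) exp(-1/t), extended by 0 to t \<le> 0. Admitting polynomials in 1/t
  makes the family closed under differentiation, which gives smoothness of exp(-1/t) at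
  once.\<close>

definition flat :: "real poly \<Rightarrow> real \<Rightarrow> real" where
  "flat p t = (if t > 0 then poly p (1 / t) * exp (- (1 / t)) else 0)"

lemma tendsto_poly_exp_0: "((\<lambda>x::real. poly p x * exp (- x)) \<longlongrightarrow> 0) at_top"
proof -
  have "((\<lambda>x::real. \<Sum>i\<le>degree p. coeff p i * (x ^ i / exp x)) \<longlongrightarrow> (\<Sum>i\<le>degree p. coeff p i * 0)) at_top"
    by (intro tendsto_sum tendsto_mult tendsto_const tendsto_power_div_exp_0)
  then show ?thesis
    by (simp add: poly_altdef exp_minus field_simps sum_distrib_right sum_divide_distrib)
qed

lemma has_real_derivative_flat:
  "(flat p has_real_derivative flat (monom 1 2 * (p - pderiv p)) t) (at t)"
proof -
  consider "t > 0" | "t < 0" | "t = 0" by linarith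
  then show ?thesis
  proof cases
    case 1
    have "((\<lambda>t. poly p (1 / t) * exp (- (1 / t))) has_real_derivative
        flat (monom 1 2 * (p - pderiv p)) t) (at t)"
      using 1 by (auto intro!: derivative_eq_intros DERIV_chain'[OF _ poly_DERIV]
          simp: flat_def poly_monom field_simps power2_eq_square)
    then show ?thesis
      by (rule has_field_derivative_transform_within_open[where S = "{0<..}"])
        (use 1 in \<open>auto simp: flat_def\<close>)
  next
    case 2
    have "((\<lambda>t. 0) has_real_derivative 0) (at t)" by simp
    then have "(flat p has_real_derivative 0) (at t)"
      by (rule has_field_derivative_transform_within_open[where S = "{..<0}"])
        (use 2 in \<open>auto simp: flat_def\<close>)
    then show ?thesis using 2 by (simp add: flat_def)
  next
    case 3
    have "((\<lambda>h. flat p h / h) \<longlongrightarrow> 0) (at_right 0)"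
    proof -
      \<comment> \<open>\<open>pCons 0 p\<close> is X * p: the factor 1/h of the difference quotient
        at 0 goes into the polynomial.\<close>
      have "((\<lambda>h::real. poly (pCons 0 p) (inverse h) * exp (- inverse h)) \<longlongrightarrow> 0) (at_right 0)"
        using tendsto_poly_exp_0 filterlim_inverse_at_top_right by (rule filterlim_compose)
      then show ?thesis
        by (rule Lim_transform_eventually)
          (auto simp: eventually_at_right_field flat_def field_simps intro!: exI[of _ 1])
    qed
    moreover have "((\<lambda>h. flat p h / h) \<longlongrightarrow> 0) (at_left 0)"
      by (rule Lim_transform_eventually[OF tendsto_const])
        (auto simp: eventually_at_left_field flat_def intro!: exI[of _ "-1"])
    ultimately have "((\<lambda>h. flat p h / h) \<longlongrightarrow> 0) (at 0)"
      by (simp add: filterlim_split_at)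
    then show ?thesis using 3 by (simp add: DERIV_def flat_def)
  qed
qed

lemma smooth_flat: "smooth f \<Longrightarrow> smooth (\<lambda>x. flat p (f x))"
  using smooth_compose[of "\<lambda>n. flat (((\<lambda>p. monom 1 2 * (p - pderiv p)) ^^ n) p)" f 0]
  by (simp add: has_real_derivative_flat)

definition bump :: "'a::euclidean_space \<Rightarrow> real \<Rightarrow> 'a \<Rightarrow> real" where
  "bump c r x = flat 1 (r\<^sup>2 - (x - c) \<bullet> (x - c))"

lemma smooth_bump: "smooth (bump c r)"
proof -
  have "bump c r = (\<lambda>x. flat 1 ((r\<^sup>2 - c \<bullet> c) - (x \<bullet> x - 2 * (x \<bullet> c))))"
    by (auto simp: bump_def algebra_simps inner_commute intro!: ext)
  then show ?thesis
    by (auto intro!: smooth_flat smooth_diff smooth_mult smooth_inner_self smooth_inner_left)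
qed

lemma bump_pos_iff: "r > 0 \<Longrightarrow> bump c r x > 0 \<longleftrightarrow> x \<in> ball c r"
proof -
  assume "r > 0"
  have "r\<^sup>2 - (x - c) \<bullet> (x - c) > 0 \<longleftrightarrow> norm (x - c) < r"
    using \<open>r > 0\<close> by (auto simp: dot_square_norm power_strict_mono dest: power2_less_imp_less)
  then show ?thesis
    by (auto simp: bump_def flat_def dist_norm norm_minus_commute)
qed

lemma bump_nonneg: "bump c r x \<ge> 0"
  by (simp add: bump_def flat_def)

lemma bump_eq_0: "r > 0 \<Longrightarrow> x \<notin> ball c r \<Longrightarrow> bump c r x = 0"
  using bump_pos_iff[of r c x] bump_nonneg[of c r x] by linarith

lemma test_function_bump: "r > 0 \<Longrightarrow> cball c r \<subseteq> \<Omega> \<Longrightarrow> bump c r \<in> test_functions \<Omega>"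
  by (rule test_functionI[where C = "cball c r"]) (auto simp: smooth_bump bump_eq_0)

text \<open>For t < 1 this is exp(1 - 1/(1 - t)); the factor \<open>exp 1\<close> gives it the value
  1 at 0. It has no plateau at 0, and the loss is controlled linearly by
  \<open>one_minus_cutoff_le\<close>.\<close>

definition cutoff :: "real \<Rightarrow> real" where
  "cutoff t = exp 1 * flat 1 (1 - t)"

definition cutoff' :: "real \<Rightarrow> real" where
  "cutoff' t = - exp 1 * flat (monom 1 2) (1 - t)"

lemma has_real_derivative_cutoff: "(cutoff has_real_derivative cutoff' t) (at t)"
proof -
  have "((\<lambda>t. flat 1 (1 - t)) has_real_derivative flat (monom 1 2) (1 - t) * (- 1)) (at t)"
    using has_real_derivative_flat[of 1 "1 - t"]
    by (intro DERIV_chain2[where f = "flat 1"]) (auto intro!: derivative_eq_intros)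
  from DERIV_cmult[OF this, of "exp 1"] show ?thesis
    by (simp add: cutoff_def[abs_def] cutoff'_def)
qed

text \<open>The constant is 3 * 2: exp 1 \<le> 3, and x^2 exp(-x) \<le> 2 for x = 1/s because exp x
  \<ge> x^2/2.\<close>

lemma abs_cutoff'_le: "\<bar>cutoff' t\<bar> \<le> 6"
proof -
  have "flat (monom 1 2) s \<le> 2" for s
  proof (cases "s > 0")
    case True
    have "(1 / s)\<^sup>2 / 2 \<le> exp (1 / s)"
      using exp_lower_Taylor_quadratic[of "1 / s"] True by (smt (verit) divide_pos_pos)
    then show ?thesis
      using True by (simp add: flat_def poly_monom exp_minus field_simps)
  qed (simp add: flat_def)
  moreover have "flat (monom 1 2) s \<ge> 0" for s
    by (simp add: flat_def poly_monom)
  ultimately have "\<bar>flat (monom 1 2) (1 - t)\<bar> \<le> 2" by (simp add: abs_le_iff)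
  then have "exp 1 * \<bar>flat (monom 1 2) (1 - t)\<bar> \<le> 3 * 2"
    using exp_le by (intro mult_mono) auto
  then show ?thesis by (simp add: cutoff'_def abs_mult)
qed

lemma cutoff_nonneg: "cutoff t \<ge> 0"
  by (simp add: cutoff_def flat_def)

lemma cutoff_le_1: "t \<ge> 0 \<Longrightarrow> cutoff t \<le> 1"
  by (auto simp: cutoff_def flat_def exp_minus field_simps)

lemma cutoff_eq_0: "t \<ge> 1 \<Longrightarrow> cutoff t = 0"
  by (simp add: cutoff_def flat_def)

text \<open>Mean value theorem with the bound 6 on the slope. What the factor cutoff(\<eta>) removes
  is thus bounded by a multiple of \<eta> itself, which is small by the Poincare inequality.\<close>

lemma one_minus_cutoff_le:
  assumes "t \<ge> 0" shows "1 - cutoff t \<le> 6 * t"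
proof (cases "t = 0")
  case True
  then show ?thesis by (simp add: cutoff_def flat_def exp_minus)
next
  case False
  then have "t > 0" using assms by simp
  then obtain z where "cutoff t - cutoff 0 = (t - 0) * cutoff' z"
    using MVT2[of 0 t cutoff cutoff'] has_real_derivative_cutoff by blast
  moreover have "t * cutoff' z \<ge> t * (- 6)"
    using abs_cutoff'_le[of z] \<open>t > 0\<close> by (intro mult_left_mono) auto
  moreover have "cutoff 0 = 1" by (simp add: cutoff_def flat_def exp_minus)
  ultimately show ?thesis by simp
qed

lemma smooth_cutoff: "smooth f \<Longrightarrow> smooth (\<lambda>x. cutoff (f x))"
  unfolding cutoff_def by (intro smooth_mult smooth_flat smooth_diff) auto

lemma smooth_sin: "smooth f \<Longrightarrow> smooth (\<lambda>x. sin (f x))"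
proof -
  assume "smooth f"
  \<comment> \<open>All derivatives of sin in one formula, as phase shifts by multiples of
    pi/2.\<close>
  define hs :: "nat \<Rightarrow> real \<Rightarrow> real" where "hs n t = sin (t + of_nat n * pi / 2)" for n t
  have "(hs n has_real_derivative hs (Suc n) t) (at t)" for n t
    unfolding hs_def
    by (auto intro!: derivative_eq_intros simp: sin_add cos_add add_divide_distrib algebra_simps)
  from smooth_compose[of hs, OF this \<open>smooth f\<close>, of 0] show ?thesis
    by (simp add: hs_def)
qed


section \<open>Young functions\<close>

locale young =
  fixes \<Phi> \<phi> :: "real \<Rightarrow> real" and pp :: real
  assumes young_function: "young_function \<Phi> \<phi>"
    and phi_differentiable: "t > 0 \<Longrightarrow> \<phi> differentiable (at t)"
    and phi_upper: "t > 0 \<Longrightarrow> t * deriv \<phi> t / \<phi> t \<le> pp"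
    and pp_ge_1: "1 \<le> pp"
    and convex_phi: "convex_on {0..} \<phi>"
begin

lemma phi_0 [simp]: "\<phi> 0 = 0"
  and phi_pos: "t > 0 \<Longrightarrow> \<phi> t > 0"
  and phi_mono: "0 \<le> s \<Longrightarrow> s \<le> t \<Longrightarrow> \<phi> s \<le> \<phi> t"
  and Phi_integral: "t \<ge> 0 \<Longrightarrow> \<Phi> t = integral {0..t} \<phi>"
  and phi_at_top: "filterlim \<phi> at_top at_top"
  using young_function by (auto simp: young_function_def mono_on_def)

lemma phi_nonneg: "t \<ge> 0 \<Longrightarrow> \<phi> t \<ge> 0"
  using phi_mono[of 0 t] by simp

lemma phi_deriv: "t > 0 \<Longrightarrow> (\<phi> has_real_derivative deriv \<phi> t) (at t)"
  using phi_differentiable DERIV_deriv_iff_real_differentiable by blast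

text \<open>At 0 this is the right continuity in the definition of a Young function, elsewhere
  differentiability.\<close>

lemma continuous_phi: "continuous_on {0..} \<phi>"
proof -
  have "continuous (at t within {0..}) \<phi>" if "t \<ge> 0" for t
  proof (cases "t = 0")
    case True
    have "continuous (at_right 0) \<phi>"
      using young_function by (auto simp: young_function_def)
    moreover have "at 0 within {0..} = at_right (0::real)"
      by (metis at_within_Icc_at_right at_within_Ici_at_right)
    ultimately show ?thesis using True by simp
  next
    case False
    then show ?thesis using that phi_deriv[of t]
      by (auto intro!: continuous_at_imp_continuous_within DERIV_isCont)
  qed
  then show ?thesis by (simp add: continuous_on_eq_continuous_within)
qed

lemma Phi_has_derivative_within:
  assumes "t \<in> {0..b}"
  shows "(\<Phi> has_real_derivative \<phi> t) (at t within {0..b})"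
proof -
  have "((\<lambda>x. integral {0..x} \<phi>) has_real_derivative \<phi> t) (at t within {0..b})"
    using assms continuous_on_subset[OF continuous_phi]
    by (intro integral_has_real_derivative) auto
  then show ?thesis
    by (rule has_field_derivative_transform_within[where d = 1]) (use assms Phi_integral in auto)
qed

lemma Phi_deriv:
  assumes "t > 0"
  shows "(\<Phi> has_real_derivative \<phi> t) (at t)"
proof -
  have "(\<Phi> has_real_derivative \<phi> t) (at t within {0..t + 1})"
    using assms by (intro Phi_has_derivative_within) auto
  moreover have "at t within {0..t + 1} = at t"
    using assms by (intro at_within_interior) auto
  ultimately show ?thesis by simp
qed

lemma continuous_Phi: "continuous_on {0..b} \<Phi>"
  using Phi_has_derivative_within by (intro DERIV_continuous_on)

lemma Phi_0 [simp]: "\<Phi> 0 = 0"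
  using Phi_integral[of 0] by simp

lemma Phi_compare:
  assumes "0 \<le> s" "s \<le> t"
    and "continuous_on {s..t} h" "\<And>x. s < x \<Longrightarrow> x < t \<Longrightarrow> (h has_real_derivative h' x) (at x)"
    and "\<And>x. s < x \<Longrightarrow> x < t \<Longrightarrow> \<phi> x \<le> h' x"
  shows "\<Phi> t - \<Phi> s \<le> h t - h s"
proof -
  have "\<Phi> t - h t \<le> \<Phi> s - h s"
  proof (rule DERIV_nonpos_imp_decreasing_open[OF \<open>s \<le> t\<close>])
    show "\<exists>y. ((\<lambda>a. \<Phi> a - h a) has_real_derivative y) (at x) \<and> y \<le> 0" if "s < x" "x < t" for x
      using that assms by (intro exI[of _ "\<phi> x - h' x"]) (auto intro!: derivative_intros Phi_deriv)
    show "continuous_on {s..t} (\<lambda>a. \<Phi> a - h a)"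
      using assms continuous_on_subset[OF continuous_Phi[of t], of "{s..t}"]
      by (intro continuous_intros) auto
  qed
  then show ?thesis by simp
qed

lemma Phi_compare':
  assumes "0 \<le> s" "s \<le> t"
    and "continuous_on {s..t} h" "\<And>x. s < x \<Longrightarrow> x < t \<Longrightarrow> (h has_real_derivative h' x) (at x)"
    and "\<And>x. s < x \<Longrightarrow> x < t \<Longrightarrow> h' x \<le> \<phi> x"
  shows "h t - h s \<le> \<Phi> t - \<Phi> s"
proof -
  have "h t - \<Phi> t \<le> h s - \<Phi> s"
  proof (rule DERIV_nonpos_imp_decreasing_open[OF \<open>s \<le> t\<close>])
    show "\<exists>y. ((\<lambda>a. h a - \<Phi> a) has_real_derivative y) (at x) \<and> y \<le> 0" if "s < x" "x < t" for x
      using that assms by (intro exI[of _ "h' x - \<phi> x"]) (auto intro!: derivative_intros Phi_deriv)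
    show "continuous_on {s..t} (\<lambda>a. h a - \<Phi> a)"
      using assms continuous_on_subset[OF continuous_Phi[of t], of "{s..t}"]
      by (intro continuous_intros) auto
  qed
  then show ?thesis by simp
qed

text \<open>Convexity of \<Phi> in tangent form. As \<phi> is nondecreasing, it lies below its value
  at t to the left of t and above it to the right; integrate both comparisons.\<close>

lemma Phi_subgradient:
  assumes "s \<ge> 0" "t \<ge> 0"
  shows "\<Phi> s \<ge> \<Phi> t + \<phi> t * (s - t)"
proof (cases "s \<le> t")
  case True
  have "\<Phi> t - \<Phi> s \<le> \<phi> t * t - \<phi> t * s"
    by (rule Phi_compare[where h' = "\<lambda>_. \<phi> t"])
      (use assms True phi_mono in \<open>auto intro!: derivative_eq_intros continuous_intros\<close>)
  then show ?thesis by (simp add: algebra_simps)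
next
  case False
  have "\<phi> t * s - \<phi> t * t \<le> \<Phi> s - \<Phi> t"
    by (rule Phi_compare'[where h' = "\<lambda>_. \<phi> t"])
      (use assms False phi_mono in \<open>auto intro!: derivative_eq_intros continuous_intros\<close>)
  then show ?thesis by (simp add: algebra_simps)
qed

lemma Phi_mono: "0 \<le> s \<Longrightarrow> s \<le> t \<Longrightarrow> \<Phi> s \<le> \<Phi> t"
  using Phi_subgradient[of t s] phi_nonneg[of s] by (smt (verit) mult_nonneg_nonneg)

lemma Phi_nonneg: "t \<ge> 0 \<Longrightarrow> \<Phi> t \<ge> 0"
  using Phi_mono[of 0 t] by simp

lemma Phi_pos: "t > 0 \<Longrightarrow> \<Phi> t > 0"
  using Phi_subgradient[of t "t/2"] Phi_nonneg[of "t/2"] phi_pos[of "t/2"]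
  by (smt (verit) field_sum_of_halves mult_pos_pos)

text \<open>The tangent at c * t, evaluated at t with weight c and at 0 with weight 1 - c: the slope
  terms cancel, and \<Phi> vanishes at 0.\<close>

lemma Phi_scale_le:
  assumes "0 \<le> c" "c \<le> 1" "t \<ge> 0"
  shows "\<Phi> (c * t) \<le> c * \<Phi> t"
proof -
  have "\<Phi> t \<ge> \<Phi> (c * t) + \<phi> (c * t) * (t - c * t)"
    "\<Phi> 0 \<ge> \<Phi> (c * t) + \<phi> (c * t) * (0 - c * t)"
    by (rule Phi_subgradient; use assms in simp)+
  then have "c * \<Phi> t + (1 - c) * \<Phi> 0 \<ge> c * (\<Phi> (c * t) + \<phi> (c * t) * (t - c * t))
      + (1 - c) * (\<Phi> (c * t) + \<phi> (c * t) * (0 - c * t))"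
    using assms by (intro add_mono mult_left_mono) auto
  also have "c * (\<Phi> (c * t) + \<phi> (c * t) * (t - c * t))
      + (1 - c) * (\<Phi> (c * t) + \<phi> (c * t) * (0 - c * t)) = \<Phi> (c * t)"
    by (simp add: algebra_simps)
  finally show ?thesis by simp
qed

lemma Phi_divide_mono:
  assumes "0 < s" "s \<le> t"
  shows "\<Phi> s / s \<le> \<Phi> t / t"
  using Phi_scale_le[of "s / t" t] assms by (simp add: field_simps)

text \<open>Slopes of chords from the origin. This is the form in which the convexity of \<phi>
  enters the proof.\<close>

lemma phi_divide_mono:
  assumes "0 < s" "s \<le> t"
  shows "\<phi> s / s \<le> \<phi> t / t"
proof -
  have "\<phi> ((1 - s / t) *\<^sub>R 0 + (s / t) *\<^sub>R t) \<le> (1 - s / t) * \<phi> 0 + (s / t) * \<phi> t"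
    using assms by (intro convex_onD[OF convex_phi]) auto
  then show ?thesis using assms by (simp add: field_simps)
qed

text \<open>Convexity of \<open>s \<mapsto> \<Phi> (sqrt s)\<close>, written without square roots.\<close>

lemma Phi_square_subgradient:
  assumes "x > 0" "y \<ge> 0"
  shows "\<Phi> y \<ge> \<Phi> x + \<phi> x / (2 * x) * (y\<^sup>2 - x\<^sup>2)"
proof (cases "y \<le> x")
  case True
  have "\<Phi> x - \<Phi> y \<le> \<phi> x / (2 * x) * x\<^sup>2 - \<phi> x / (2 * x) * y\<^sup>2"
  proof (rule Phi_compare[where h' = "\<lambda>z. \<phi> x / x * z"])
    show "\<phi> z \<le> \<phi> x / x * z" if "y < z" "z < x" for z
      using phi_divide_mono[of z x] that assms by (simp add: field_simps)
  qed (use assms True in \<open>auto intro!: derivative_eq_intros continuous_intros simp: field_simps\<close>)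
  then show ?thesis by (simp add: algebra_simps)
next
  case False
  have "\<phi> x / (2 * x) * y\<^sup>2 - \<phi> x / (2 * x) * x\<^sup>2 \<le> \<Phi> y - \<Phi> x"
  proof (rule Phi_compare'[where h' = "\<lambda>z. \<phi> x / x * z"])
    show "\<phi> x / x * z \<le> \<phi> z" if "x < z" "z < y" for z
      using phi_divide_mono[of x z] that assms by (simp add: field_simps)
  qed (use assms False in \<open>auto intro!: derivative_eq_intros continuous_intros simp: field_simps\<close>)
  then show ?thesis by (simp add: algebra_simps)
qed

text \<open>Two values of the tangent parabola at t: at 0 it yields
  \<open>\<Phi> t \<le> \<phi> t * t / 2\<close>, and inserting this into its value at c * t yields
  the factor c^2. So \<Phi> grows at least quadratically.\<close>

lemma Phi_scale_ge:
  assumes "c \<ge> 1" "t \<ge> 0"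
  shows "\<Phi> (c * t) \<ge> c\<^sup>2 * \<Phi> t"
proof (cases "t = 0")
  case False
  then have t: "t > 0" using assms by simp
  have "\<Phi> 0 \<ge> \<Phi> t + \<phi> t / (2 * t) * (0\<^sup>2 - t\<^sup>2)"
    using t by (intro Phi_square_subgradient) auto
  then have "\<Phi> t \<le> \<phi> t / (2 * t) * t\<^sup>2" by simp
  then have "(c\<^sup>2 - 1) * \<Phi> t \<le> (c\<^sup>2 - 1) * (\<phi> t / (2 * t) * t\<^sup>2)"
    using assms by (intro mult_left_mono) auto
  also have "\<dots> = \<phi> t / (2 * t) * ((c * t)\<^sup>2 - t\<^sup>2)"
    by (simp add: algebra_simps power_mult_distrib diff_divide_distrib)
  also have "\<Phi> t + \<dots> \<le> \<Phi> (c * t)"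
    using t assms by (intro Phi_square_subgradient) auto
  finally show ?thesis by (simp add: algebra_simps)
qed simp

text \<open>Let m and d be the two norms on the left and x^2 = m^2 + d^2. The function s \<mapsto>
  \<Phi>(sqrt s) is convex and 0 at 0, hence superadditive, so \<Phi> m + \<Phi> d \<le> \<Phi> x.
  By the parallelogram law x^2 is the mean of the squares of |a| and |b|, and convexity bounds
  \<Phi> x by the right-hand side.\<close>

lemma Phi_clarkson:
  fixes a b :: "'b::real_inner"
  shows "\<Phi> (norm ((1/2) *\<^sub>R (a + b))) + \<Phi> (norm ((1/2) *\<^sub>R (a - b))) \<le> (\<Phi> (norm a) + \<Phi> (norm b)) / 2"
proof -
  define m d x where "m = norm ((1/2) *\<^sub>R (a + b))" and "d = norm ((1/2) *\<^sub>R (a - b))"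
    and "x = sqrt (m\<^sup>2 + d\<^sup>2)"
  have par: "m\<^sup>2 + d\<^sup>2 = ((norm a)\<^sup>2 + (norm b)\<^sup>2) / 2"
    unfolding m_def d_def power2_norm_eq_inner by (simp add: algebra_simps inner_commute)
  have x2: "x\<^sup>2 = m\<^sup>2 + d\<^sup>2" by (simp add: x_def)
  show ?thesis
  proof (cases "x = 0")
    case True
    then have "m = 0" "d = 0" using x2 by (auto simp: sum_power2_eq_zero_iff)
    then show ?thesis
      unfolding m_def[symmetric] d_def[symmetric] by (simp add: Phi_nonneg)
  next
    case False
    then have x: "x > 0" by (simp add: x_def less_le)
    have super: "\<Phi> y \<le> y\<^sup>2 / x\<^sup>2 * \<Phi> x" if "0 \<le> y" "y \<le> x" for y
    proof (cases "y = 0")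
      case False
      have "(x / y)\<^sup>2 * \<Phi> y \<le> \<Phi> (x / y * y)"
        using that False by (intro Phi_scale_ge) (auto simp: field_simps)
      then show ?thesis using False x that by (simp add: field_simps)
    qed simp
    have "m \<ge> 0" "d \<ge> 0" by (auto simp: m_def d_def)
    then have "m \<le> x" "d \<le> x" by (auto simp: x_def real_le_rsqrt)
    then have "\<Phi> m + \<Phi> d \<le> m\<^sup>2 / x\<^sup>2 * \<Phi> x + d\<^sup>2 / x\<^sup>2 * \<Phi> x"
      using super \<open>m \<ge> 0\<close> \<open>d \<ge> 0\<close> by (intro add_mono) auto
    also have "\<dots> = (m\<^sup>2 + d\<^sup>2) / x\<^sup>2 * \<Phi> x"
      by (simp add: add_divide_distrib distrib_right)
    also have "\<dots> = \<Phi> x" using x by (simp add: x2[symmetric])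
    also have "\<Phi> x \<le> (\<Phi> (norm a) + \<Phi> (norm b)) / 2"
    proof -
      \<comment> \<open>The tangent parabolas at x, taken at |a| and |b|: since x^2 is the mean of
        the squares, the two deviations cancel.\<close>
      let ?g = "\<phi> x / (2 * x)"
      have "\<Phi> (norm a) + \<Phi> (norm b) \<ge> (\<Phi> x + ?g * ((norm a)\<^sup>2 - x\<^sup>2)) + (\<Phi> x + ?g * ((norm b)\<^sup>2 - x\<^sup>2))"
        using x by (intro add_mono Phi_square_subgradient) auto
      also have "(\<Phi> x + ?g * ((norm a)\<^sup>2 - x\<^sup>2)) + (\<Phi> x + ?g * ((norm b)\<^sup>2 - x\<^sup>2))
          = 2 * \<Phi> x + ?g * ((norm a)\<^sup>2 + (norm b)\<^sup>2 - 2 * x\<^sup>2)"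
        by (simp add: algebra_simps)
      also have "(norm a)\<^sup>2 + (norm b)\<^sup>2 - 2 * x\<^sup>2 = 0" using par x2 by simp
      finally show ?thesis by simp
    qed
    finally show ?thesis unfolding m_def d_def .
  qed
qed

text \<open>The gradient of a \<mapsto> \<Phi>(|a|), the vector field inside the divergence of the
  operator. Division by zero yields 0 at a = 0, which is the intended value.\<close>

definition flux :: "'b::real_inner \<Rightarrow> 'b" where
  "flux a = (\<phi> (norm a) / norm a) *\<^sub>R a"

lemma norm_flux: "norm (flux a) = \<phi> (norm a)"
  using phi_nonneg[of "norm a"] by (cases "a = 0") (auto simp: flux_def)

text \<open>The plain tangent inequality is applied at the midpoint of a and b and inserted into
  \<open>Phi_clarkson\<close>. The midpoint halves the linear term, so doubling restores it and puts
  the factor 2 in front of the remainder.\<close>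

lemma Phi_uniformly_convex:
  fixes a b :: "'b::real_inner"
  shows "\<Phi> (norm b) \<ge> \<Phi> (norm a) + flux a \<bullet> (b - a) + 2 * \<Phi> (norm ((1/2) *\<^sub>R (a - b)))"
proof -
  have sub: "\<Phi> (norm c) \<ge> \<Phi> (norm a) + flux a \<bullet> (c - a)" for c :: 'b
  proof -
    have "flux a \<bullet> (c - a) = flux a \<bullet> c - \<phi> (norm a) * norm a"
      by (auto simp: flux_def inner_diff_right dot_square_norm power2_eq_square)
    also have "flux a \<bullet> c \<le> \<phi> (norm a) * norm c"
      using Cauchy_Schwarz_ineq2[of "flux a" c] norm_flux[of a] by simp
    finally show ?thesis
      using Phi_subgradient[of "norm c" "norm a"] by (simp add: algebra_simps)
  qed
  have "flux a \<bullet> ((1/2) *\<^sub>R (a + b) - a) = (flux a \<bullet> (b - a)) / 2"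
    by (simp add: inner_diff_right inner_add_right)
  then show ?thesis
    using Phi_clarkson[of a b] sub[of "(1/2) *\<^sub>R (a + b)"] by simp
qed

section \<open>Growth at most like a power: the Delta_2 condition\<close>

lemma phi_scale_le:
  assumes "c \<ge> 1" "t > 0"
  shows "\<phi> (c * t) \<le> c powr pp * \<phi> t"
proof -
  \<comment> \<open>The function ln \<phi> - p+ ln has derivative \<phi>'/\<phi> - p+/x, which is at
    most 0 by the growth hypothesis.\<close>
  have "ln (\<phi> (c * t)) - pp * ln (c * t) \<le> ln (\<phi> t) - pp * ln t"
  proof (rule DERIV_nonpos_imp_nonincreasing[where f = "\<lambda>x. ln (\<phi> x) - pp * ln x"])
    show "t \<le> c * t" using assms by simp
    fix x assume "t \<le> x" "x \<le> c * t"
    then have x: "x > 0" using assms by simp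
    have "((\<lambda>x. ln (\<phi> x) - pp * ln x) has_real_derivative (1 / \<phi> x * deriv \<phi> x - pp * (1 / x))) (at x)"
      using x phi_pos[OF x] phi_deriv[OF x] by (auto intro!: derivative_eq_intros simp: field_simps)
    moreover have "1 / \<phi> x * deriv \<phi> x - pp * (1 / x) \<le> 0"
      using phi_upper[OF x] x phi_pos[OF x] by (simp add: field_simps)
    ultimately show "\<exists>y. ((\<lambda>x. ln (\<phi> x) - pp * ln x) has_real_derivative y) (at x) \<and> y \<le> 0"
      by blast
  qed
  then have "ln (\<phi> (c * t)) \<le> pp * ln c + ln (\<phi> t)"
    using assms by (simp add: ln_mult algebra_simps)
  also have "\<dots> = ln (c powr pp * \<phi> t)"
    using assms phi_pos[of t] by (simp add: ln_mult ln_powr)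
  finally show ?thesis
    using assms phi_pos[of t] phi_pos[of "c * t"] by (subst (asm) ln_le_cancel_iff) auto
qed

text \<open>Integrated form of \<open>phi_scale_le\<close>; the inner derivative contributes one
  more factor c, whence the exponent pp + 1.\<close>

lemma Phi_delta2:
  assumes "c \<ge> 1" "t \<ge> 0"
  shows "\<Phi> (c * t) \<le> c powr (pp + 1) * \<Phi> t"
proof -
  let ?K = "c powr (pp + 1)"
  have K: "?K = c powr pp * c" using assms by (simp add: powr_add)
  have "\<Phi> (c * t) - ?K * \<Phi> t \<le> \<Phi> (c * 0) - ?K * \<Phi> 0"
  proof (rule DERIV_nonpos_imp_decreasing_open[OF \<open>t \<ge> 0\<close>])
    fix x assume x: "0 < x" "x < t"
    have "((\<lambda>x. \<Phi> (c * x) - ?K * \<Phi> x) has_real_derivative (\<phi> (c * x) * c - ?K * \<phi> x)) (at x)"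
      using x assms by (auto intro!: derivative_eq_intros DERIV_chain2[OF Phi_deriv] Phi_deriv)
    moreover have "\<phi> (c * x) * c \<le> c powr pp * \<phi> x * c"
      using phi_scale_le[of c x] x assms by (intro mult_right_mono) auto
    hence "\<phi> (c * x) * c - ?K * \<phi> x \<le> 0"
      unfolding K by (simp add: mult_ac)
    ultimately show "\<exists>y. ((\<lambda>x. \<Phi> (c * x) - ?K * \<Phi> x) has_real_derivative y) (at x) \<and> y \<le> 0"
      by blast
  next
    show "continuous_on {0..t} (\<lambda>x. \<Phi> (c * x) - ?K * \<Phi> x)"
      using assms
      by (intro continuous_intros continuous_Phi continuous_on_compose2[OF continuous_Phi[of "c * t"]]) auto
  qed
  then show ?thesis by simp
qed

text \<open>The base 1 + |c| is at least 1, so that \<open>Phi_delta2\<close> covers every real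
  factor c.\<close>

definition scalec :: "real \<Rightarrow> real" where
  "scalec c = (1 + \<bar>c\<bar>) powr (pp + 1)"

lemma scalec_pos: "scalec c > 0"
  by (simp add: scalec_def)

lemma Phi_scale_bound:
  assumes "t \<ge> 0"
  shows "\<Phi> (\<bar>c\<bar> * t) \<le> scalec c * \<Phi> t"
proof -
  have "\<Phi> (\<bar>c\<bar> * t) \<le> \<Phi> ((1 + \<bar>c\<bar>) * t)"
    using assms by (intro Phi_mono) (auto simp: algebra_simps)
  also have "\<dots> \<le> scalec c * \<Phi> t" unfolding scalec_def using assms by (intro Phi_delta2) auto
  finally show ?thesis .
qed

definition addc :: "real \<Rightarrow> real" where
  "addc \<epsilon> = scalec (1 / ((1 + \<epsilon>) powr (1 / (pp + 1)) - 1) + 1)"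

lemma addc_pos: "addc \<epsilon> > 0"
  unfolding addc_def by (rule scalec_pos)

text \<open>The coefficient \<open>1 + \<epsilon>\<close>: either \<open>t \<le> \<theta> s\<close> with \<open>(1 + \<theta>)\<^bsup>p\<^sup>+ + 1\<^esup> = 1 + \<epsilon>\<close>, or \<open>s + t \<le> (1 / \<theta> + 1) t\<close>.\<close>

lemma Phi_add_le:
  assumes "\<epsilon> > 0" and st: "s \<ge> 0" "t \<ge> 0"
  shows "\<Phi> (s + t) \<le> (1 + \<epsilon>) * \<Phi> s + addc \<epsilon> * \<Phi> t"
proof -
  define \<theta> where "\<theta> = (1 + \<epsilon>) powr (1 / (pp + 1)) - 1"
  have "(1 + \<epsilon>) powr (1 / (pp + 1)) > (1 + \<epsilon>) powr 0"
    using assms pp_ge_1 by (intro powr_less_mono) auto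
  then have \<theta>: "\<theta> > 0" using assms by (simp add: \<theta>_def)
  have e: "(1 + \<theta>) powr (pp + 1) = 1 + \<epsilon>"
    using assms pp_ge_1 by (simp add: \<theta>_def powr_powr)
  show ?thesis
  proof (cases "t \<le> \<theta> * s")
    case True
    have "\<Phi> (s + t) \<le> \<Phi> ((1 + \<theta>) * s)"
      using st True by (intro Phi_mono) (auto simp: algebra_simps)
    also have "\<dots> \<le> (1 + \<epsilon>) * \<Phi> s"
      using Phi_delta2[of "1 + \<theta>" s] \<theta> st e by simp
    finally show ?thesis using addc_pos[of \<epsilon>] Phi_nonneg[of t] st by (smt (verit) mult_nonneg_nonneg)
  next
    case False
    then have "s + t \<le> \<bar>1 / \<theta> + 1\<bar> * t" using \<theta> st by (simp add: field_simps)
    then have "\<Phi> (s + t) \<le> \<Phi> (\<bar>1 / \<theta> + 1\<bar> * t)"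
      using st by (intro Phi_mono) auto
    also have "\<dots> \<le> addc \<epsilon> * \<Phi> t"
      unfolding addc_def \<theta>_def[symmetric] using st(2) by (rule Phi_scale_bound)
    finally show ?thesis using assms Phi_nonneg[of s] st by (smt (verit) mult_nonneg_nonneg)
  qed
qed

text \<open>With m the larger of s and t, the tangent at m gives
  \<open>\<phi> m * m \<le> \<Phi> (2 * m)\<close>, and doubling removes the 2. This makes the flux
  of one field integrable against another.\<close>

lemma phi_mult_le:
  assumes "s \<ge> 0" "t \<ge> 0"
  shows "\<phi> s * t \<le> scalec 2 * (\<Phi> s + \<Phi> t)"
proof -
  have "\<phi> s * t \<le> \<phi> (max s t) * max s t"
    using assms by (intro mult_mono phi_mono phi_nonneg) auto
  also have "\<dots> \<le> \<Phi> (\<bar>2\<bar> * max s t)"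
  proof -
    have m: "0 \<le> max s t" using assms by simp
    have "\<Phi> (2 * max s t) \<ge> \<Phi> (max s t) + \<phi> (max s t) * (2 * max s t - max s t)"
      using m by (intro Phi_subgradient mult_nonneg_nonneg) auto
    then show ?thesis using Phi_nonneg[OF m] by simp
  qed
  also have "\<dots> \<le> scalec 2 * \<Phi> (max s t)" using assms by (intro Phi_scale_bound) auto
  also have "\<dots> \<le> scalec 2 * (\<Phi> s + \<Phi> t)"
    using scalec_pos[of 2] assms Phi_nonneg[of s] Phi_nonneg[of t] by (intro mult_left_mono) (auto simp: max_def)
  finally show ?thesis .
qed

text \<open>Below \<theta> the first summand is enough; above it, \<Phi> t / t is at least its value
  at \<theta>. A small \<theta> turns small modulars into small integrals on sets of finite
  measure.\<close>

lemma linear_le_Phi: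
  assumes "\<theta> > 0" "t \<ge> 0"
  shows "t \<le> \<theta> + \<theta> / \<Phi> \<theta> * \<Phi> t"
proof (cases "t \<le> \<theta>")
  case True
  then show ?thesis
    using assms Phi_pos[of \<theta>] Phi_nonneg[of t] by (smt (verit) divide_nonneg_pos mult_nonneg_nonneg)
next
  case False
  then have "\<Phi> \<theta> / \<theta> \<le> \<Phi> t / t" using assms by (intro Phi_divide_mono) auto
  then have "t \<le> \<theta> / \<Phi> \<theta> * \<Phi> t"
    using assms False Phi_pos[of \<theta>] by (simp add: field_simps)
  then show ?thesis using assms by simp
qed

text \<open>Quadratic growth measured from t = 1. It will absorb the quadratic error of replacing t
  by M sin(t/M).\<close>

lemma square_le_Phi:
  assumes "t \<ge> 0"
  shows "t\<^sup>2 \<le> 1 + \<Phi> t / \<Phi> 1"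
proof (cases "t \<le> 1")
  case True
  then show ?thesis
    using assms Phi_pos[of 1] Phi_nonneg[of t] by (smt (verit) power_le_one divide_nonneg_pos)
next
  case False
  then have "t\<^sup>2 * \<Phi> 1 \<le> \<Phi> (t * 1)" by (intro Phi_scale_ge) auto
  then show ?thesis using Phi_pos[of 1] by (simp add: field_simps)
qed

subsection \<open>The complementary function\<close>

text \<open>From some w0 on, \<phi> exceeds t, so \<Phi> then grows at least as fast as t * w.
  Boundedness is what gives the real supremum in \<open>young_conj\<close> a meaning.\<close>

lemma conj_bdd_above: "bdd_above ((\<lambda>w. t * w - \<Phi> w) ` {0<..})"
proof -
  obtain w0 where w0: "w0 \<ge> 0" "\<phi> w0 \<ge> t"
  proof -
    obtain N where "\<And>w. w \<ge> N \<Longrightarrow> \<phi> w \<ge> t"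
      using phi_at_top unfolding filterlim_at_top eventually_at_top_linorder by blast
    then show ?thesis using that[of "max 0 N"] by simp
  qed
  have "t * w - \<Phi> w \<le> \<bar>t\<bar> * w0 + \<phi> w0 * w0" if "w > 0" for w
  proof (cases "w \<le> w0")
    case True
    then have "t * w \<le> \<bar>t\<bar> * w0" using that by (intro mult_mono) auto
    moreover have "\<phi> w0 * w0 \<ge> 0" using w0 phi_nonneg by simp
    ultimately show ?thesis using Phi_nonneg[of w] that by linarith
  next
    case False
    have "\<Phi> w \<ge> \<Phi> w0 + \<phi> w0 * (w - w0)" using that w0 by (intro Phi_subgradient) auto
    moreover have "\<phi> w0 * (w - w0) \<ge> t * (w - w0)" using w0 False by (intro mult_right_mono) auto
    moreover have "t * w0 \<le> \<bar>t\<bar> * w0" using w0 by (intro mult_right_mono) auto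
    moreover have "\<phi> w0 * w0 \<ge> 0" using w0 phi_nonneg by simp
    ultimately show ?thesis using Phi_nonneg[of w0] w0(1) by (simp add: algebra_simps)
  qed
  then show ?thesis by (intro bdd_aboveI2) auto
qed

abbreviation "\<Phi>c \<equiv> young_conj \<Phi>"

lemma young_ineq: "w > 0 \<Longrightarrow> t * w \<le> \<Phi>c t + \<Phi> w"
proof -
  assume "w > 0"
  then have "t * w - \<Phi> w \<le> \<Phi>c t"
    unfolding young_conj_def by (intro cSUP_upper conj_bdd_above) auto
  then show ?thesis by simp
qed

lemma conj_leI: "(\<And>w. w > 0 \<Longrightarrow> t * w - \<Phi> w \<le> c) \<Longrightarrow> \<Phi>c t \<le> c"
  unfolding young_conj_def by (rule cSUP_least) auto

text \<open>The supremum runs over w > 0 only, so the value 0 at w = 0 has to be approached.\<close>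

lemma conj_nonneg: "t \<ge> 0 \<Longrightarrow> \<Phi>c t \<ge> 0"
proof (rule field_le_epsilon)
  fix e :: real assume "e > 0" and t: "t \<ge> 0"
  \<comment> \<open>Convexity bounds \<Phi> w by w * \<Phi> 1 for w \<le> 1, and this choice makes
    the bound at most e.\<close>
  define w where "w = min 1 (e / (1 + \<Phi> 1))"
  have "0 < 1 + \<Phi> 1" using Phi_pos[of 1] by simp
  then have w: "0 < w" "w \<le> 1" "w * (1 + \<Phi> 1) \<le> e"
    using \<open>e > 0\<close> by (auto simp: w_def pos_le_divide_eq[symmetric])
  have "\<Phi> w \<le> w * \<Phi> 1" using Phi_scale_le[of w 1] w by simp
  also have "\<dots> \<le> e" using w by (simp add: algebra_simps)
  finally show "0 \<le> \<Phi>c t + e" using young_ineq[OF w(1), of t] t w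
    by (smt (verit) mult_nonneg_nonneg)
qed

lemma conj_0 [simp]: "\<Phi>c 0 = 0"
  using conj_leI[of 0 0] conj_nonneg[of 0] Phi_nonneg by force

lemma young_ineq': "w \<ge> 0 \<Longrightarrow> t \<ge> 0 \<Longrightarrow> t * w \<le> \<Phi>c t + \<Phi> w"
  using young_ineq[of w t] conj_nonneg[of t] by (cases "w = 0") auto

lemma conj_mono: "s \<le> t \<Longrightarrow> \<Phi>c s \<le> \<Phi>c t"
proof (rule conj_leI)
  fix w :: real assume "s \<le> t" "w > 0"
  then have "s * w \<le> t * w" by (intro mult_right_mono) auto
  then show "s * w - \<Phi> w \<le> \<Phi>c t" using young_ineq[OF \<open>w > 0\<close>, of t] by simp
qed

lemma conj_scale_le:
  assumes "0 \<le> c" "c \<le> 1"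
  shows "\<Phi>c (c * t) \<le> c * \<Phi>c t"
proof (rule conj_leI)
  fix w :: real assume "w > 0"
  have "c * (t * w) \<le> c * (\<Phi>c t + \<Phi> w)"
    using young_ineq[OF \<open>w > 0\<close>] assms by (intro mult_left_mono) auto
  moreover have "c * \<Phi> w \<le> 1 * \<Phi> w"
    using assms Phi_nonneg[of w] \<open>w > 0\<close> by (intro mult_right_mono) auto
  ultimately show "c * t * w - \<Phi> w \<le> c * \<Phi>c t" by (simp add: algebra_simps)
qed

text \<open>Dual to \<open>Phi_scale_ge\<close> through the substitution w \<mapsto> w/c: growth of
  \<Phi> at least quadratic makes its conjugate grow at most quadratically.\<close>

lemma conj_delta2:
  assumes "c \<ge> 1"
  shows "\<Phi>c (c * t) \<le> c\<^sup>2 * \<Phi>c t"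
proof (rule conj_leI)
  fix w :: real assume "w > 0"
  have "c\<^sup>2 * (t * (w / c)) \<le> c\<^sup>2 * (\<Phi>c t + \<Phi> (w / c))"
    using young_ineq[of "w / c" t] assms \<open>w > 0\<close> by (intro mult_left_mono) auto
  moreover have "c\<^sup>2 * \<Phi> (w / c) \<le> \<Phi> w"
    using Phi_scale_ge[of c "w / c"] assms \<open>w > 0\<close> by simp
  ultimately show "c * t * w - \<Phi> w \<le> c\<^sup>2 * \<Phi>c t"
    using assms by (simp add: algebra_simps power2_eq_square)
qed

lemma borel_measurable_conj [measurable]: "\<Phi>c \<in> borel_measurable borel"
  by (intro borel_measurable_mono monoI conj_mono)

lemma borel_measurable_Phi_norm [measurable]:
  "(\<lambda>x::'b::real_normed_vector. \<Phi> (norm x)) \<in> borel_measurable borel"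
proof -
  \<comment> \<open>\<Phi> is known to be monotone only on the half line; composing with the maximum
    extends this to all reals.\<close>
  have "(\<lambda>t. \<Phi> (max 0 t)) \<in> borel_measurable borel"
    by (intro borel_measurable_mono monoI Phi_mono) auto
  then have "(\<lambda>x::'b. \<Phi> (max 0 (norm x))) \<in> borel_measurable borel" by measurable
  then show ?thesis by simp
qed

end


section \<open>Weak gradients\<close>

lemma continuous_imp_measurable_lebesgue:
  fixes f :: "'a::euclidean_space \<Rightarrow> 'b::topological_space"
  assumes "continuous_on UNIV f"
  shows "f \<in> borel_measurable lebesgue"
  using borel_measurable_continuous_onI[OF assms]
  by (intro measurable_completion) simp

lemma measurable_lebesgueI:
  fixes f :: "'a::euclidean_space \<Rightarrow> 'b::topological_space"
  shows "f \<in> borel_measurable borel \<Longrightarrow> f \<in> borel_measurable lebesgue"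
  by (intro measurable_completion) simp

lemma integral_lebesgue_on:
  fixes f :: "'a::euclidean_space \<Rightarrow> 'b::euclidean_space"
  assumes "open \<Omega>"
  shows "integral\<^sup>L (lebesgue_on \<Omega>) f = integral\<^sup>L lebesgue (\<lambda>x. indicator \<Omega> x *\<^sub>R f x)"
  using assms by (intro integral_restrict_space) auto

lemma integral_lebesgue_on_support:
  fixes f :: "'a::euclidean_space \<Rightarrow> 'b::euclidean_space"
  assumes "open \<Omega>" "\<And>x. x \<notin> \<Omega> \<Longrightarrow> f x = 0"
  shows "integral\<^sup>L (lebesgue_on \<Omega>) f = integral\<^sup>L lebesgue f"
  unfolding integral_lebesgue_on[OF assms(1)]
  by (intro Bochner_Integration.integral_cong) (use assms(2) in \<open>auto simp: indicator_def\<close>)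

lemma locally_integrable_mult:
  fixes h :: "'a::euclidean_space \<Rightarrow> 'b::euclidean_space" and q :: "'a \<Rightarrow> real"
  assumes h: "locally_integrable_on h \<Omega>" and C: "compact C" "C \<subseteq> \<Omega>"
    and q: "q \<in> borel_measurable borel" "\<And>x. \<bar>q x\<bar> \<le> B" "\<And>x. x \<notin> C \<Longrightarrow> q x = 0"
  shows "integrable lebesgue (\<lambda>x. q x *\<^sub>R h x)"
proof -
  have "integrable lebesgue (\<lambda>x. indicator C x *\<^sub>R h x)"
    using h C by (auto simp: locally_integrable_on_def set_integrable_def)
  then have "integrable lebesgue (\<lambda>x. B *\<^sub>R (indicator C x *\<^sub>R h x))"
    by (rule integrable_scaleR_right)
  moreover have "(\<lambda>x. q x *\<^sub>R (indicator C x *\<^sub>R h x)) \<in> borel_measurable lebesgue"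
    using measurable_lebesgueI[OF q(1)] borel_measurable_integrable[OF \<open>integrable lebesgue (\<lambda>x. indicator C x *\<^sub>R h x)\<close>]
    by (rule borel_measurable_scaleR)
  ultimately have "integrable lebesgue (\<lambda>x. q x *\<^sub>R (indicator C x *\<^sub>R h x))"
  proof (rule Bochner_Integration.integrable_bound, intro always_eventually allI)
    fix x
    have "\<bar>q x\<bar> \<le> \<bar>B\<bar>" using q(2)[of x] by simp
    then show "norm (q x *\<^sub>R (indicator C x *\<^sub>R h x)) \<le> norm (B *\<^sub>R (indicator C x *\<^sub>R h x))"
      unfolding norm_scaleR by (intro mult_right_mono) auto
  qed
  moreover have "(\<lambda>x. q x *\<^sub>R (indicator C x *\<^sub>R h x)) = (\<lambda>x. q x *\<^sub>R h x)"
  proof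
    show "q x *\<^sub>R (indicator C x *\<^sub>R h x) = q x *\<^sub>R h x" for x
      using q(3)[of x] by (cases "x \<in> C") simp_all
  qed
  ultimately show ?thesis by (simp only:)
qed

lemma locally_integrable_inner:
  "locally_integrable_on h \<Omega> \<Longrightarrow> locally_integrable_on (\<lambda>x. h x \<bullet> b) \<Omega>"
  unfolding locally_integrable_on_def
proof safe
  fix K assume "\<forall>K. compact K \<and> K \<subseteq> \<Omega> \<longrightarrow> h absolutely_integrable_on K" "compact K" "K \<subseteq> \<Omega>"
  then have "integrable lebesgue (\<lambda>x. (indicator K x *\<^sub>R h x) \<bullet> b)"
    by (intro integrable_inner_left) (auto simp: set_integrable_def)
  then show "(\<lambda>x. h x \<bullet> b) absolutely_integrable_on K"
    by (simp add: set_integrable_def)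
qed

lemma locally_integrable_add:
  "locally_integrable_on g \<Omega> \<Longrightarrow> locally_integrable_on h \<Omega> \<Longrightarrow> locally_integrable_on (\<lambda>x. g x + c *\<^sub>R h x) \<Omega>"
  unfolding locally_integrable_on_def
  by (intro allI impI set_integral_add(1) set_integrable_scaleR_right) auto

lemma continuous_locally_integrable:
  "continuous_on UNIV h \<Longrightarrow> locally_integrable_on h \<Omega>"
  unfolding locally_integrable_on_def set_integrable_def
proof (intro allI impI)
  fix K :: "'a set" assume "continuous_on UNIV h" "compact K \<and> K \<subseteq> \<Omega>"
  then have "compact K" and c: "continuous_on K h" by (auto intro: continuous_on_subset)
  then have i: "integrable lborel (\<lambda>x. indicator K x *\<^sub>R h x)"
    by (rule borel_integrable_compact)
  show "integrable lebesgue (\<lambda>x. indicator K x *\<^sub>R h x)"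
    by (rule integrable_completion[THEN iffD2, OF borel_measurable_integrable[OF i] i])
qed

text \<open>Local integrability speaks only of compact subsets; an exhaustion of \<Omega> by compact
  sets gives the restriction to \<Omega> as a pointwise limit.\<close>

lemma locally_integrable_measurable:
  fixes h :: "'a::euclidean_space \<Rightarrow> 'b::euclidean_space"
  assumes h: "locally_integrable_on h \<Omega>" and "open \<Omega>"
  shows "(\<lambda>x. indicator \<Omega> x *\<^sub>R h x) \<in> borel_measurable lebesgue"
proof -
  obtain K :: "nat \<Rightarrow> 'a set" where K': "\<forall>n. compact (K n) \<and> K n \<subseteq> \<Omega>"
    "\<forall>C. compact C \<longrightarrow> C \<subseteq> \<Omega> \<longrightarrow> (\<exists>N. \<forall>n\<ge>N. C \<subseteq> K n)"
  proof (rule open_Union_compact_subsets[OF \<open>open \<Omega>\<close>])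
    fix C :: "nat \<Rightarrow> 'a set"
    assume "\<And>n. compact (C n)" "\<And>n. C n \<subseteq> \<Omega>"
      and "\<And>K. compact K \<Longrightarrow> K \<subseteq> \<Omega> \<Longrightarrow> \<exists>N. \<forall>n\<ge>N. K \<subseteq> C n"
    then show thesis by (intro that[of C]) simp_all
  qed
  have K: "compact (K n)" "K n \<subseteq> \<Omega>" for n using K'(1) by blast+
  have K3: "\<exists>N. \<forall>n\<ge>N. x \<in> K n" if "x \<in> \<Omega>" for x
    using K'(2)[rule_format, of "{x}"] that by simp
  show ?thesis
  proof (rule borel_measurable_LIMSEQ_metric)
    show "(\<lambda>x. indicator (K n) x *\<^sub>R h x) \<in> borel_measurable lebesgue" for n
      using h K(1,2)[of n] by (intro borel_measurable_integrable) (simp add: locally_integrable_on_def set_integrable_def)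
    show "(\<lambda>n. indicator (K n) x *\<^sub>R h x) \<longlonglongrightarrow> indicator \<Omega> x *\<^sub>R h x" for x
    proof (cases "x \<in> \<Omega>")
      case True
      then obtain N where "\<forall>n\<ge>N. x \<in> K n" using K3 by blast
      then have "\<forall>\<^sub>F n in sequentially. indicator (K n) x *\<^sub>R h x = indicator \<Omega> x *\<^sub>R h x"
        using True by (intro eventually_sequentiallyI[of N]) simp
      then show ?thesis by (rule tendsto_eventually)
    next
      case False
      then have "x \<notin> K n" for n using K(2) by blast
      then show ?thesis using False by simp
    qed
  qed
qed

subsection \<open>The fundamental lemma of the calculus of variations\<close>

text \<open>By Lindelof, U is a countable union of balls. The sum of the first n bumps is positive
  at any given point of U once n is large, and multiplying it by n pushes it beyond 1, where
  \<open>cutoff\<close> vanishes; off U it is always 0.\<close>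

lemma open_smooth_approx:
  fixes U :: "'a::euclidean_space set"
  assumes "open U"
  shows "\<exists>\<psi>::nat \<Rightarrow> 'a \<Rightarrow> real. (\<forall>n. smooth (\<psi> n)) \<and> (\<forall>n x. \<psi> n x \<in> {0..1}) \<and>
    (\<forall>n x. x \<notin> U \<longrightarrow> \<psi> n x = 0) \<and> (\<forall>x. (\<lambda>n. \<psi> n x) \<longlonglongrightarrow> indicator U x)"
proof -
  define F where "F = {B. \<exists>c r. r > 0 \<and> B = ball c r \<and> B \<subseteq> U}"
  have "\<And>S. S \<in> F \<Longrightarrow> open S" by (auto simp: F_def)
  then obtain F' where F': "F' \<subseteq> F" "countable F'" "\<Union>F' = \<Union>F"
    by (rule Lindelof)
  have UF: "\<Union>F = U"
  proof
    show "U \<subseteq> \<Union>F"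
    proof
      fix x assume "x \<in> U"
      then obtain r where "r > 0" "ball x r \<subseteq> U" using \<open>open U\<close> openE by blast
      then have "ball x r \<in> F" "x \<in> ball x r" by (auto simp: F_def)
      then show "x \<in> \<Union>F" by blast
    qed
  qed (auto simp: F_def)
  show ?thesis
  proof (cases "F' = {}")
    case True
    then have "U = {}" using F'(3) UF by simp
    then show ?thesis by (intro exI[of _ "\<lambda>_ _. 0"]) auto
  next
    case False
    define B where "B = from_nat_into F'"
    have B: "range B = F'" using False F' by (simp add: B_def range_from_nat_into)
    have "\<forall>n. \<exists>c r. r > 0 \<and> B n = ball c r \<and> B n \<subseteq> U"
    proof
      fix n
      have "B n \<in> F" using B F'(1) by blast
      then show "\<exists>c r. r > 0 \<and> B n = ball c r \<and> B n \<subseteq> U" by (simp add: F_def)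
    qed
    then obtain c r where cr: "\<And>n. r n > 0 \<and> B n = ball (c n) (r n) \<and> B n \<subseteq> U" by metis
    have r: "r n > 0" for n using cr by blast
    have U: "U = (\<Union>n. ball (c n) (r n))"
    proof -
      have "(\<Union>n. ball (c n) (r n)) = \<Union>(range B)" using cr by simp
      then show ?thesis using B F'(3) UF by simp
    qed
    define s where "s n x = (\<Sum>i<n. bump (c i) (r i) x)" for n x
    have s0: "s n x \<ge> 0" for n x by (auto simp: s_def intro!: sum_nonneg bump_nonneg)
    show ?thesis
    proof (intro exI[of _ "\<lambda>n x. 1 - cutoff (real n * s n x)"] conjI allI impI)
      show "smooth (\<lambda>x. 1 - cutoff (real n * s n x))" for n
        unfolding s_def by (intro smooth_diff smooth_cutoff smooth_mult smooth_sum smooth_bump) auto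
      show "1 - cutoff (real n * s n x) \<in> {0..1}" for n x
        using cutoff_le_1[of "real n * s n x"] cutoff_nonneg[of "real n * s n x"] s0[of n x] by simp
      have c0: "cutoff 0 = 1" using cutoff_le_1[of 0] one_minus_cutoff_le[of 0] by simp
      show zero: "1 - cutoff (real n * s n x) = 0" if "x \<notin> U" for n x
      proof -
        have "s n x = 0" unfolding s_def 
          using that U r by (intro sum.neutral ballI bump_eq_0) blast+
        then show ?thesis using c0 by simp
      qed
      show "(\<lambda>n. 1 - cutoff (real n * s n x)) \<longlonglongrightarrow> indicator U x" for x
      proof (cases "x \<in> U")
        case True
        then obtain m where "x \<in> ball (c m) (r m)" using U by blast
        then have pos: "bump (c m) (r m) x > 0" using r bump_pos_iff by blast
        obtain N where N: "real N * bump (c m) (r m) x \<ge> 1"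
          using reals_Archimedean3[OF pos] by (meson less_imp_le)
        have "1 - cutoff (real n * s n x) = 1" if "n \<ge> max N (Suc m)" for n
        proof -
          have "bump (c m) (r m) x \<le> s n x"
            unfolding s_def using that by (intro member_le_sum) (auto intro: bump_nonneg)
          then have "real N * bump (c m) (r m) x \<le> real n * s n x"
            using that pos by (intro mult_mono) auto
          then show ?thesis using N cutoff_eq_0[of "real n * s n x"] by simp
        qed
        then show ?thesis using True
          by (intro tendsto_eventually eventually_sequentiallyI[of "max N (Suc m)"]) auto
      next
        case False
        then show ?thesis using zero by simp
      qed
    qed
  qed
qed

text \<open>Test functions approximate indicators of open sets, so h has integral 0 over open and
  then over compact sets inside \<Omega>. Hence h vanishes almost everywhere on each compact subset
  of {h > 0}, that is, such a subset is null.\<close>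

lemma fundamental_lemma_pos:
  fixes h :: "'a::euclidean_space \<Rightarrow> real"
  assumes "open \<Omega>" and h: "locally_integrable_on h \<Omega>"
    and zero: "\<And>\<psi>. \<psi> \<in> test_functions \<Omega> \<Longrightarrow> (\<integral>x. h x * \<psi> x \<partial>lebesgue_on \<Omega>) = 0"
  shows "AE x in lebesgue. x \<in> \<Omega> \<longrightarrow> h x \<le> 0"
proof -
  have int_open: "(\<integral>x. indicator U x *\<^sub>R h x \<partial>lebesgue) = 0" if U: "open U" "U \<subseteq> C" and C: "compact C" "C \<subseteq> \<Omega>" for U C
  proof -
    obtain \<psi> :: "nat \<Rightarrow> 'a \<Rightarrow> real" where "(\<forall>n. smooth (\<psi> n)) \<and> (\<forall>n x. \<psi> n x \<in> {0..1}) \<and>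
      (\<forall>n x. x \<notin> U \<longrightarrow> \<psi> n x = 0) \<and> (\<forall>x. (\<lambda>n. \<psi> n x) \<longlonglongrightarrow> indicator U x)"
      using open_smooth_approx[OF \<open>open U\<close>] by (elim exE)
    then have \<psi>: "smooth (\<psi> n)" "\<psi> n x \<in> {0..1}" "x \<notin> U \<Longrightarrow> \<psi> n x = 0"
      "(\<lambda>n. \<psi> n x) \<longlonglongrightarrow> indicator U x" for n x by blast+
    have mb: "\<psi> n \<in> borel_measurable borel" for n
      using smooth_continuous[OF \<psi>(1)] by (intro borel_measurable_continuous_onI)
    have iC: "integrable lebesgue (\<lambda>x. indicator C x *\<^sub>R h x)"
      using h C by (auto simp: locally_integrable_on_def set_integrable_def)
    have int: "integrable lebesgue (\<lambda>x. \<psi> n x *\<^sub>R h x)" for n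
    proof (rule locally_integrable_mult[OF h C mb])
      show "\<bar>\<psi> n x\<bar> \<le> 1" for x using \<psi>(2)[of n x] by simp
      show "\<psi> n x = 0" if "x \<notin> C" for x using \<psi>(3) U that by blast
    qed
    have "\<psi> n \<in> test_functions \<Omega>" for n
      by (rule test_functionI[OF \<psi>(1) C]) (use \<psi>(3) U in blast)
    then have "(\<integral>x. h x * \<psi> n x \<partial>lebesgue_on \<Omega>) = 0" for n using zero by blast
    then have z: "(\<integral>x. \<psi> n x *\<^sub>R h x \<partial>lebesgue) = 0" for n
    proof -
      have "x \<notin> U" if "x \<notin> \<Omega>" for x using that U C by blast
      then have "h x * \<psi> n x = 0" if "x \<notin> \<Omega>" for x using \<psi>(3)[of x n] that by simp
      from integral_lebesgue_on_support[OF \<open>open \<Omega>\<close> this] show ?thesis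
        using \<open>(\<integral>x. h x * \<psi> n x \<partial>lebesgue_on \<Omega>) = 0\<close> by (simp add: mult.commute)
    qed
    have "(\<lambda>n. \<integral>x. \<psi> n x *\<^sub>R h x \<partial>lebesgue) \<longlonglongrightarrow> (\<integral>x. indicator U x *\<^sub>R h x \<partial>lebesgue)"
    proof (rule integral_dominated_convergence)
      show "integrable lebesgue (\<lambda>x. norm (indicator C x *\<^sub>R h x))" using iC by (rule integrable_norm)
      show "(\<lambda>x. \<psi> n x *\<^sub>R h x) \<in> borel_measurable lebesgue" for n using int by auto
      have "(\<lambda>x. indicator U x *\<^sub>R (indicator C x *\<^sub>R h x)) \<in> borel_measurable lebesgue"
        using U by (intro borel_measurable_scaleR[OF _ borel_measurable_integrable[OF iC]] borel_measurable_indicator) auto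
      moreover have "(\<lambda>x. indicator U x *\<^sub>R (indicator C x *\<^sub>R h x)) = (\<lambda>x. indicator U x *\<^sub>R h x)"
        using U by (auto simp: indicator_def intro!: ext)
      ultimately show "(\<lambda>x. indicator U x *\<^sub>R h x) \<in> borel_measurable lebesgue" by simp
      show "AE x in lebesgue. (\<lambda>n. \<psi> n x *\<^sub>R h x) \<longlonglongrightarrow> indicator U x *\<^sub>R h x"
        by (intro always_eventually allI tendsto_scaleR \<psi>(4) tendsto_const)
      show "AE x in lebesgue. norm (\<psi> n x *\<^sub>R h x) \<le> norm (indicator C x *\<^sub>R h x)" for n
      proof (intro always_eventually allI)
        fix x
        have "\<bar>\<psi> n x\<bar> \<le> indicator C x"
          using \<psi>(2)[of n x] \<psi>(3)[of x n] U(2) by (cases "x \<in> C") (simp_all add: subset_iff, metis)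
        then show "norm (\<psi> n x *\<^sub>R h x) \<le> norm (indicator C x *\<^sub>R h x)"
          unfolding norm_scaleR by (intro mult_right_mono) auto
      qed
    qed
    then show ?thesis by (simp only: z LIMSEQ_const_iff)
  qed
  \<comment> \<open>A compact K is the difference of the open sets U and U - K, where U has compact
    closure inside \<Omega>.\<close>
  have int_compact: "(\<integral>x. indicator K x *\<^sub>R h x \<partial>lebesgue) = 0" if K: "compact K" "K \<subseteq> \<Omega>" for K
  proof -
    obtain U where U: "open U" "K \<subseteq> U" "compact (closure U)" "closure U \<subseteq> \<Omega>"
    proof -
      show ?thesis
      proof (cases "K = {}")
        case True then show ?thesis by (intro that[of "{}"]) auto
      next
        case False
        obtain \<delta> where \<delta>: "\<delta> > 0" "{x. infdist x K \<le> \<delta>} \<subseteq> \<Omega>"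
          by (rule compact_in_open_separated[OF False K(1) \<open>open \<Omega>\<close> K(2)])
        have cp: "compact {x. infdist x K \<le> \<delta>}"
          by (rule compact_infdist_le[OF False K(1) \<delta>(1)])
        have cl: "closure {x. infdist x K < \<delta>} \<subseteq> {x. infdist x K \<le> \<delta>}"
          by (intro closure_minimal closed_Collect_le continuous_intros) auto
        show ?thesis
        proof (rule that)
          show "open {x. infdist x K < \<delta>}"
            by (intro open_Collect_less continuous_intros)
          show "K \<subseteq> {x. infdist x K < \<delta>}" using \<delta> by auto
          show "compact (closure {x. infdist x K < \<delta>})"
            unfolding compact_closure by (rule bounded_subset[OF compact_imp_bounded[OF cp]]) auto
          show "closure {x. infdist x K < \<delta>} \<subseteq> \<Omega>" using cl \<delta> by simp
        qed
      qed
    qed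
    let ?C = "closure U"
    have i: "integrable lebesgue (\<lambda>x. indicator V x *\<^sub>R h x)" if V: "V \<in> sets borel" "V \<subseteq> ?C" for V
    proof (rule locally_integrable_mult[OF h U(3,4)])
      show "indicat_real V \<in> borel_measurable borel" using V by (intro borel_measurable_indicator)
      show "\<bar>indicat_real V x\<bar> \<le> 1" for x by (simp add: indicator_def)
      show "indicat_real V x = 0" if "x \<notin> ?C" for x using V(2) that by (auto simp: indicator_def)
    qed
    have "(\<integral>x. indicator U x *\<^sub>R h x \<partial>lebesgue)
        = (\<integral>x. indicator (U - K) x *\<^sub>R h x + indicator K x *\<^sub>R h x \<partial>lebesgue)"
      using U(2) by (intro Bochner_Integration.integral_cong refl) (auto simp: indicator_def)
    also have "\<dots> = (\<integral>x. indicator (U - K) x *\<^sub>R h x \<partial>lebesgue) + (\<integral>x. indicator K x *\<^sub>R h x \<partial>lebesgue)"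
    proof (intro Bochner_Integration.integral_add i)
      show "U - K \<in> sets borel" "K \<in> sets borel"
        using U(1) K(1) by (auto intro: sets.Diff borel_compact)
      show "U - K \<subseteq> ?C" "K \<subseteq> ?C" using U(2) closure_subset[of U] by blast+
    qed
    finally show ?thesis
      using int_open[OF \<open>open U\<close> closure_subset U(3,4)]
        int_open[OF open_Diff[OF U(1) compact_imp_closed[OF K(1)]] order_trans[OF Diff_subset closure_subset] U(3,4)]
      by simp
  qed
  \<comment> \<open>Up to a null set, P is a countable union of closed sets; intersecting them with
    balls gives countably many compact sets.\<close>
  define P where "P = {x \<in> \<Omega>. h x > 0}"
  have "P = {x. indicator \<Omega> x *\<^sub>R h x > 0}" by (auto simp: P_def indicator_def)
  then have "P \<in> sets lebesgue"
    using borel_measurable_less[OF borel_measurable_const locally_integrable_measurable[OF h \<open>open \<Omega>\<close>], of 0]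
    by simp
  then obtain C T where CT: "fsigma C" "T \<in> null_sets lebesgue" "C \<union> T = P"
    by (rule lebesgue_set_almost_fsigma)
  then obtain F :: "nat \<Rightarrow> 'a set" where F: "\<And>n. closed (F n)" "C = (\<Union>n. F n)"
    by (cases rule: fsigma.cases) auto
  have null: "F n \<inter> cball 0 (real m) \<in> null_sets lebesgue" for n m
  proof -
    let ?K = "F n \<inter> cball 0 (real m)"
    have K: "compact ?K" "?K \<subseteq> P" using F CT by (auto simp: closed_Int_compact)
    then have K\<Omega>: "?K \<subseteq> \<Omega>" by (auto simp: P_def)
    have "integrable lebesgue (\<lambda>x. indicator ?K x *\<^sub>R h x)"
      using h K(1) K\<Omega> by (auto simp: locally_integrable_on_def set_integrable_def)
    moreover have "AE x in lebesgue. indicator ?K x *\<^sub>R h x \<ge> 0"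
      using K(2) by (intro always_eventually allI) (auto simp: indicator_def P_def intro: less_imp_le)
    ultimately have "AE x in lebesgue. indicator ?K x *\<^sub>R h x = 0"
      using int_compact[OF K(1) K\<Omega>] integral_nonneg_eq_0_iff_AE by blast
    then have "AE x in lebesgue. x \<notin> ?K"
      by (rule AE_mp) (use K(2) in \<open>auto simp: P_def indicator_def intro!: always_eventually\<close>)
    then show ?thesis
      using K(1) by (subst AE_iff_null_sets) (auto simp: borel_compact)
  qed
  have "P = (\<Union>n. \<Union>m. F n \<inter> cball 0 (real m)) \<union> T"
  proof -
    have "\<exists>m. x \<in> cball 0 (real m)" for x :: 'a using real_arch_simple[of "norm x"] by auto
    then have "(\<Union>m. F n \<inter> cball 0 (real m)) = F n" for n by auto
    then show ?thesis using CT(3) F(2) by simp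
  qed
  moreover have "(\<Union>n. \<Union>m. F n \<inter> cball 0 (real m)) \<in> null_sets lebesgue"
    by (intro null_sets_UN null)
  ultimately have "P \<in> null_sets lebesgue" using CT(2) by (simp add: null_sets.Un)
  then show ?thesis
    by (rule AE_I') (auto simp: P_def)
qed

lemma fundamental_lemma:
  fixes h :: "'a::euclidean_space \<Rightarrow> real"
  assumes "open \<Omega>" and h: "locally_integrable_on h \<Omega>"
    and zero: "\<And>\<psi>. \<psi> \<in> test_functions \<Omega> \<Longrightarrow> (\<integral>x. h x * \<psi> x \<partial>lebesgue_on \<Omega>) = 0"
  shows "AE x in lebesgue. x \<in> \<Omega> \<longrightarrow> h x = 0"
proof -
  have "locally_integrable_on (\<lambda>x. 0 + (-1) *\<^sub>R h x) \<Omega>"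
    by (intro locally_integrable_add h continuous_locally_integrable) auto
  then have "AE x in lebesgue. x \<in> \<Omega> \<longrightarrow> - h x \<le> 0"
    using fundamental_lemma_pos[OF \<open>open \<Omega>\<close>, of "\<lambda>x. - h x"] zero by simp
  moreover have "AE x in lebesgue. x \<in> \<Omega> \<longrightarrow> h x \<le> 0"
    using assms by (rule fundamental_lemma_pos)
  ultimately show ?thesis
    by eventually_elim auto
qed


section \<open>Calculus of weak gradients\<close>

lemma test_function_borel:
  assumes "\<psi> \<in> test_functions \<Omega>"
  shows "\<psi> \<in> borel_measurable borel" "grad \<psi> \<in> borel_measurable borel"
  using assms test_function_smooth smooth_continuous smooth_continuous_grad
  by (blast intro: borel_measurable_continuous_onI)+

lemma locally_integrable_mult_test:
  fixes h :: "'a::euclidean_space \<Rightarrow> 'b::euclidean_space"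
  assumes h: "locally_integrable_on h \<Omega>" and \<psi>: "\<psi> \<in> test_functions \<Omega>"
  shows "integrable lebesgue (\<lambda>x. \<psi> x *\<^sub>R h x)"
    and "integrable lebesgue (\<lambda>x. (grad \<psi> x \<bullet> b) *\<^sub>R h x)"
proof -
  obtain C where C: "smooth \<psi>" "compact C" "C \<subseteq> \<Omega>" "\<And>x. x \<notin> C \<Longrightarrow> \<psi> x = 0" "\<And>x. x \<notin> C \<Longrightarrow> grad \<psi> x = 0"
    using test_functionE[OF \<psi>] by metis
  obtain B where B: "\<And>x. norm (\<psi> x) \<le> B" "\<And>x. norm (grad \<psi> x) \<le> B"
    using test_function_bounded[OF \<psi>] by metis
  note [measurable] = test_function_borel[OF \<psi>]
  show "integrable lebesgue (\<lambda>x. \<psi> x *\<^sub>R h x)"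
    using B(1) by (intro locally_integrable_mult[OF h C(2,3) _ _ C(4)]) auto
  have "\<bar>grad \<psi> x \<bullet> b\<bar> \<le> B * norm b" for x
    using Cauchy_Schwarz_ineq2[of "grad \<psi> x" b] mult_right_mono[OF B(2) norm_ge_zero[of b], of x] by linarith
  then show "integrable lebesgue (\<lambda>x. (grad \<psi> x \<bullet> b) *\<^sub>R h x)"
    by (intro locally_integrable_mult[OF h C(2,3)]) (simp_all add: C(5))
qed

lemma locally_integrable_mult_test_real:
  fixes h :: "'a::euclidean_space \<Rightarrow> real"
  assumes "locally_integrable_on h \<Omega>" "\<psi> \<in> test_functions \<Omega>"
  shows "integrable lebesgue (\<lambda>x. \<psi> x * h x)" "integrable lebesgue (\<lambda>x. grad \<psi> x \<bullet> b * h x)"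
  using locally_integrable_mult_test[OF assms] by simp_all

text \<open>Test functions vanish off \<Omega>, so both integrals can be taken over the whole space,
  where they no longer depend on a restricted measure.\<close>

lemma has_weak_grad_iff:
  assumes "open \<Omega>"
  shows "has_weak_grad \<Omega> u g \<longleftrightarrow> locally_integrable_on u \<Omega> \<and> locally_integrable_on g \<Omega> \<and>
     (\<forall>\<psi>\<in>test_functions \<Omega>. \<forall>b\<in>Basis.
        (\<integral>x. (grad \<psi> x \<bullet> b) *\<^sub>R u x \<partial>lebesgue) = - (\<integral>x. \<psi> x *\<^sub>R (g x \<bullet> b) \<partial>lebesgue))"
proof -
  have "(\<integral>x. u x * frechet_derivative \<psi> (at x) b \<partial>lebesgue_on \<Omega>) = (\<integral>x. (grad \<psi> x \<bullet> b) *\<^sub>R u x \<partial>lebesgue)"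
    "(\<integral>x. (g x \<bullet> b) * \<psi> x \<partial>lebesgue_on \<Omega>) = (\<integral>x. \<psi> x *\<^sub>R (g x \<bullet> b) \<partial>lebesgue)"
    if \<psi>: "\<psi> \<in> test_functions \<Omega>" for \<psi> b
  proof -
    obtain C where C: "smooth \<psi>" "C \<subseteq> \<Omega>" "\<And>x. x \<notin> C \<Longrightarrow> \<psi> x = 0" "\<And>x. x \<notin> C \<Longrightarrow> grad \<psi> x = 0"
      using test_functionE[OF \<psi>] by metis
    have z: "\<psi> x = 0" "grad \<psi> x = 0" if "x \<notin> \<Omega>" for x using C(2-4) that by blast+
    show "(\<integral>x. u x * frechet_derivative \<psi> (at x) b \<partial>lebesgue_on \<Omega>) = (\<integral>x. (grad \<psi> x \<bullet> b) *\<^sub>R u x \<partial>lebesgue)"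
      unfolding frechet_eq_grad[OF C(1)]
      by (subst integral_lebesgue_on_support[OF assms]) (simp_all add: z mult.commute)
    show "(\<integral>x. (g x \<bullet> b) * \<psi> x \<partial>lebesgue_on \<Omega>) = (\<integral>x. \<psi> x *\<^sub>R (g x \<bullet> b) \<partial>lebesgue)"
      by (subst integral_lebesgue_on_support[OF assms]) (simp_all add: z mult.commute)
  qed
  then show ?thesis unfolding has_weak_grad_def by simp
qed

lemma has_weak_grad_add:
  assumes "open \<Omega>" "has_weak_grad \<Omega> u g" "has_weak_grad \<Omega> v h"
  shows "has_weak_grad \<Omega> (\<lambda>x. u x + c * v x) (\<lambda>x. g x + c *\<^sub>R h x)"
proof -
  note H = assms(2,3)[unfolded has_weak_grad_iff[OF assms(1)]]
  have li: "locally_integrable_on u \<Omega>" "locally_integrable_on g \<Omega>" "locally_integrable_on v \<Omega>" "locally_integrable_on h \<Omega>"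
    using H by blast+
  have "(\<integral>x. (grad \<psi> x \<bullet> b) *\<^sub>R (u x + c * v x) \<partial>lebesgue) = - (\<integral>x. \<psi> x *\<^sub>R ((g x + c *\<^sub>R h x) \<bullet> b) \<partial>lebesgue)"
    if \<psi>: "\<psi> \<in> test_functions \<Omega>" and b: "b \<in> Basis" for \<psi> b
  proof -
    note i = locally_integrable_mult_test_real[OF _ \<psi>]
    have e: "(\<integral>x. (grad \<psi> x \<bullet> b) *\<^sub>R u x \<partial>lebesgue) = - (\<integral>x. \<psi> x *\<^sub>R (g x \<bullet> b) \<partial>lebesgue)"
      "(\<integral>x. (grad \<psi> x \<bullet> b) *\<^sub>R v x \<partial>lebesgue) = - (\<integral>x. \<psi> x *\<^sub>R (h x \<bullet> b) \<partial>lebesgue)"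
      using H \<psi> b by blast+
    have "(\<integral>x. (grad \<psi> x \<bullet> b) *\<^sub>R (u x + c * v x) \<partial>lebesgue)
        = (\<integral>x. (grad \<psi> x \<bullet> b) *\<^sub>R u x + c * ((grad \<psi> x \<bullet> b) *\<^sub>R v x) \<partial>lebesgue)"
      by (simp add: algebra_simps)
    also have "\<dots> = (\<integral>x. (grad \<psi> x \<bullet> b) *\<^sub>R u x \<partial>lebesgue) + c * (\<integral>x. (grad \<psi> x \<bullet> b) *\<^sub>R v x \<partial>lebesgue)"
      by (subst Bochner_Integration.integral_add) (use i(2)[OF li(1)] i(2)[OF li(3)] in simp_all)
    also have "\<dots> = - ((\<integral>x. \<psi> x *\<^sub>R (g x \<bullet> b) \<partial>lebesgue) + c * (\<integral>x. \<psi> x *\<^sub>R (h x \<bullet> b) \<partial>lebesgue))"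
      unfolding e by (simp add: algebra_simps)
    also have "(\<integral>x. \<psi> x *\<^sub>R (g x \<bullet> b) \<partial>lebesgue) + c * (\<integral>x. \<psi> x *\<^sub>R (h x \<bullet> b) \<partial>lebesgue)
        = (\<integral>x. \<psi> x *\<^sub>R (g x \<bullet> b) + c * (\<psi> x *\<^sub>R (h x \<bullet> b)) \<partial>lebesgue)"
      by (subst Bochner_Integration.integral_add) (use i(1)[OF locally_integrable_inner[OF li(2)]] i(1)[OF locally_integrable_inner[OF li(4)]] in simp_all)
    also have "\<dots> = (\<integral>x. \<psi> x *\<^sub>R ((g x + c *\<^sub>R h x) \<bullet> b) \<partial>lebesgue)"
      by (simp add: inner_add_left algebra_simps)
    finally show ?thesis .
  qed
  then show ?thesis
    unfolding has_weak_grad_iff[OF assms(1)]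
    using locally_integrable_add[OF li(1,3), of c] locally_integrable_add[OF li(2,4), of c] by simp
qed

lemma has_weak_grad_unique:
  fixes g h :: "'a::euclidean_space \<Rightarrow> 'a"
  assumes "open \<Omega>" "has_weak_grad \<Omega> u g" "has_weak_grad \<Omega> u h"
  shows "AE x in lebesgue. x \<in> \<Omega> \<longrightarrow> g x = h x"
proof -
  have z: "has_weak_grad \<Omega> (\<lambda>x. u x + (-1) * u x) (\<lambda>x. g x + (-1) *\<^sub>R h x)"
    by (rule has_weak_grad_add[OF assms])
  have "AE x in lebesgue. x \<in> \<Omega> \<longrightarrow> (g x + (-1) *\<^sub>R h x) \<bullet> b = 0" if b: "b \<in> Basis" for b
  proof (rule fundamental_lemma[OF \<open>open \<Omega>\<close>])
    show "locally_integrable_on (\<lambda>x. (g x + (-1) *\<^sub>R h x) \<bullet> b) \<Omega>"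
      using z by (intro locally_integrable_inner) (simp add: has_weak_grad_def)
    show "(\<integral>x. (g x + (-1) *\<^sub>R h x) \<bullet> b * \<psi> x \<partial>lebesgue_on \<Omega>) = 0" if "\<psi> \<in> test_functions \<Omega>" for \<psi>
      using z[unfolded has_weak_grad_def] that b by simp
  qed
  then have "AE x in lebesgue. \<forall>b\<in>Basis. x \<in> \<Omega> \<longrightarrow> (g x + (-1) *\<^sub>R h x) \<bullet> b = 0"
    by (subst AE_finite_all[OF finite_Basis]) blast
  then show ?thesis
  proof eventually_elim
    case (elim x)
    show ?case
    proof
      assume "x \<in> \<Omega>"
      show "g x = h x"
      proof (rule euclidean_eqI)
        fix b :: 'a assume "b \<in> Basis"
        then have "(g x + (-1) *\<^sub>R h x) \<bullet> b = 0" using elim \<open>x \<in> \<Omega>\<close> by blast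
        then show "g x \<bullet> b = h x \<bullet> b" by (simp add: inner_diff_left)
      qed
    qed
  qed
qed

lemma weak_grad_unique:
  assumes "open \<Omega>" "has_weak_grad \<Omega> u g"
  shows "AE x in lebesgue. x \<in> \<Omega> \<longrightarrow> weak_grad \<Omega> u x = g x"
  using has_weak_grad_unique[OF assms(1) _ assms(2)] someI[of "has_weak_grad \<Omega> u", OF assms(2)]
  unfolding weak_grad_def by blast

subsection \<open>Integration by parts\<close>

lemma integral_lborel_translate:
  fixes f :: "'a::euclidean_space \<Rightarrow> real"
  assumes "f \<in> borel_measurable borel"
  shows "(\<integral>x. f (a + x) \<partial>lborel) = (\<integral>x. f x \<partial>lborel)"
proof -
  have "(\<integral>x. f x \<partial>lborel) = (\<integral>x. f x \<partial>distr lborel borel ((+) a))" by (simp add: lborel_distr_plus)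
  also have "\<dots> = (\<integral>x. f (a + x) \<partial>lborel)"
    using assms by (intro integral_distr) auto
  finally show ?thesis by simp
qed

lemma test_function_lipschitz:
  assumes "smooth w" "\<And>x. norm (grad w x) \<le> B"
  shows "\<bar>w x - w y\<bar> \<le> B * norm (x - y)"
proof -
  have "norm (w x - w y) \<le> B * norm (x - y)"
  proof (rule differentiable_bound[of UNIV])
    show "(w has_derivative (\<lambda>h. grad w z \<bullet> h)) (at z within UNIV)" for z
      using smooth_has_derivative[OF assms(1)] by simp
    show "onorm (\<lambda>h. grad w z \<bullet> h) \<le> B" for z
    proof (rule onorm_le)
      show "norm (grad w z \<bullet> h) \<le> B * norm h" for h
        using Cauchy_Schwarz_ineq2[of "grad w z" h] mult_right_mono[OF assms(2) norm_ge_zero[of h], of z]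
        by simp
    qed
  qed auto
  then show ?thesis by simp
qed

text \<open>Translation invariance makes the integral of every difference quotient in direction a
  vanish, and dominated convergence passes to the derivative.\<close>

lemma integral_grad_eq_0:
  fixes w :: "'a::euclidean_space \<Rightarrow> real"
  assumes w: "w \<in> test_functions UNIV"
  shows "(\<integral>x. grad w x \<bullet> a \<partial>lebesgue) = 0"
proof -
  obtain C where C: "smooth w" "compact C" "\<And>x. x \<notin> C \<Longrightarrow> w x = 0" "\<And>x. x \<notin> C \<Longrightarrow> grad w x = 0"
    using test_functionE[OF w] by metis
  obtain B where B: "B > 0" "\<And>x. norm (w x) \<le> B" "\<And>x. norm (grad w x) \<le> B"
    using test_function_bounded[OF w] by metis
  obtain R where "\<forall>x\<in>C. norm x \<le> R"
    using compact_imp_bounded[OF C(2)] unfolding bounded_iff by (elim exE)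
  then have R: "C \<subseteq> cball 0 R" by auto
  \<comment> \<open>The steps \<open>s n\<close> are at most 1, so the enlarged radius captures the
    supports of all quotients and the dominating function is integrable.\<close>
  let ?S = "cball (0::'a) (R + norm a)"
  note [measurable] = test_function_borel[OF w]
  define s where "s n = 1 / (real n + 1)" for n
  have s: "s n > 0" "s n \<le> 1" for n by (auto simp: s_def)
  have s0: "s \<longlonglongrightarrow> 0" unfolding s_def using LIMSEQ_inverse_real_of_nat by (simp add: inverse_eq_divide add.commute)
  define q where "q n x = (w (s n *\<^sub>R a + x) - w x) / s n" for n x
  have iw: "integrable lborel w"
  proof -
    have "integrable lborel (\<lambda>x. indicator C x *\<^sub>R w x)"
      by (intro borel_integrable_compact C(2) smooth_continuous[OF C(1)])
    moreover have "(\<lambda>x. indicator C x *\<^sub>R w x) = w" using C(3) by (auto simp: indicator_def fun_eq_iff)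
    ultimately show ?thesis by simp
  qed
  have iwt: "integrable lborel (\<lambda>x. w (t + x))" for t
  proof -
    have "integrable (distr lborel borel ((+) t)) w" using iw by (simp add: lborel_distr_plus)
    then show ?thesis by (subst (asm) integrable_distr_eq) auto
  qed
  have q0: "(\<integral>x. q n x \<partial>lborel) = 0" for n
    unfolding q_def using iw iwt by (simp add: integral_lborel_translate)
  have "(\<lambda>n. \<integral>x. q n x \<partial>lborel) \<longlonglongrightarrow> (\<integral>x. grad w x \<bullet> a \<partial>lborel)"
  proof (rule integral_dominated_convergence)
    have "integrable lborel (\<lambda>x. indicator ?S x *\<^sub>R (B * norm a))"
      by (intro borel_integrable_compact) auto
    then show "integrable lborel (\<lambda>x. B * norm a * indicator ?S x)" by (simp add: mult.commute)
    show "(\<lambda>x. grad w x \<bullet> a) \<in> borel_measurable lborel" by simp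
    show "q n \<in> borel_measurable lborel" for n unfolding q_def by measurable
    show "AE x in lborel. (\<lambda>n. q n x) \<longlonglongrightarrow> grad w x \<bullet> a"
    proof (intro always_eventually allI)
      fix x
      have "((\<lambda>t. w (x + t *\<^sub>R a)) has_derivative (\<lambda>t. grad w x \<bullet> (t *\<^sub>R a))) (at 0)"
        by (rule has_derivative_compose[of "\<lambda>t. x + t *\<^sub>R a" "\<lambda>t. t *\<^sub>R a" 0 UNIV w "\<lambda>h. grad w x \<bullet> h"])
          (use smooth_has_derivative[OF C(1), of x] in \<open>auto intro!: derivative_eq_intros\<close>)
      then have "((\<lambda>t. w (x + t *\<^sub>R a)) has_real_derivative (grad w x \<bullet> a)) (at 0)"
        unfolding has_field_derivative_def
        by (rule has_derivative_eq_rhs) (simp add: fun_eq_iff)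
      then have "((\<lambda>t. (w (x + t *\<^sub>R a) - w x) / t) \<longlongrightarrow> grad w x \<bullet> a) (at 0)"
        by (simp add: DERIV_def)
      moreover have "filterlim s (at 0) sequentially"
        using s0 s(1) by (simp add: filterlim_at less_imp_neq[symmetric])
      ultimately have "(\<lambda>n. (w (x + s n *\<^sub>R a) - w x) / s n) \<longlonglongrightarrow> grad w x \<bullet> a"
        by (rule filterlim_compose)
      then show "(\<lambda>n. q n x) \<longlonglongrightarrow> grad w x \<bullet> a"
        unfolding q_def by (simp add: add.commute)
    qed
    show "AE x in lborel. norm (q n x) \<le> B * norm a * indicator ?S x" for n
    proof (intro always_eventually allI)
      fix x
      show "norm (q n x) \<le> B * norm a * indicator ?S x"
      proof (cases "x \<in> ?S")
        case True
        have "\<bar>w (s n *\<^sub>R a + x) - w x\<bar> \<le> B * (s n * norm a)"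
          using test_function_lipschitz[OF C(1) B(3), of "s n *\<^sub>R a + x" x] s(1)[of n] by simp
        then show ?thesis using True s(1)[of n] by (simp add: q_def field_simps)
      next
        case False
        have "norm x \<le> norm (s n *\<^sub>R a + x) + norm (s n *\<^sub>R a)" using norm_triangle_ineq4[of "s n *\<^sub>R a + x" "s n *\<^sub>R a"] by simp
        moreover have "norm (s n *\<^sub>R a) \<le> 1 * norm a"
          using s[of n] mult_right_mono[of "s n" 1 "norm a"] by simp
        moreover have "norm x > R + norm a" using False by simp
        ultimately have "norm (s n *\<^sub>R a + x) > R" "norm x > R"
          using norm_ge_zero[of a] by linarith+
        then have "s n *\<^sub>R a + x \<notin> C" "x \<notin> C" using R by auto
        then show ?thesis using C(3) B(1) by (simp add: q_def)
      qed
    qed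
  qed
  then have "(\<integral>x. grad w x \<bullet> a \<partial>lborel) = 0" by (simp only: q0 LIMSEQ_const_iff)
  then show ?thesis by (simp add: integral_completion)
qed

text \<open>The product of w with a test function has compact support even if w has not; its
  gradient has integral 0, and the product rule splits this into the two sides.\<close>

lemma has_weak_grad_test:
  fixes w :: "'a::euclidean_space \<Rightarrow> real"
  assumes "open \<Omega>" and w: "smooth w"
  shows "has_weak_grad \<Omega> w (grad w)"
  unfolding has_weak_grad_iff[OF assms(1)]
proof (intro conjI ballI)
  show li: "locally_integrable_on w \<Omega>" "locally_integrable_on (grad w) \<Omega>"
    using w by (auto intro!: continuous_locally_integrable smooth_continuous smooth_continuous_grad)
  fix \<psi> :: "'a \<Rightarrow> real" and b :: 'a assume \<psi>: "\<psi> \<in> test_functions \<Omega>" and b: "b \<in> Basis"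
  obtain C where C: "smooth \<psi>" "compact C" "\<And>x. x \<notin> C \<Longrightarrow> \<psi> x = 0"
    using test_functionE[OF \<psi>] by metis
  have "(\<lambda>x. \<psi> x * w x) \<in> test_functions UNIV"
    by (rule test_functionI[OF smooth_mult[OF C(1) w] C(2)]) (auto simp: C(3))
  from integral_grad_eq_0[OF this, of b]
  have "(\<integral>x. \<psi> x *\<^sub>R (grad w x \<bullet> b) + (grad \<psi> x \<bullet> b) *\<^sub>R w x \<partial>lebesgue) = 0"
    by (simp add: grad_mult C(1) w inner_add_left mult.commute)
  then show "(\<integral>x. (grad \<psi> x \<bullet> b) *\<^sub>R w x \<partial>lebesgue) = - (\<integral>x. \<psi> x *\<^sub>R (grad w x \<bullet> b) \<partial>lebesgue)"
    by (subst (asm) Bochner_Integration.integral_add)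
      (use locally_integrable_mult_test_real(2)[OF li(1) \<psi>] locally_integrable_mult_test_real(1)[OF locally_integrable_inner[OF li(2)] \<psi>] in simp_all)
qed


section \<open>The modular and the Poincare inequality\<close>

lemma nn_integral_lborel_translate:
  fixes f :: "'a::euclidean_space \<Rightarrow> ennreal"
  assumes "f \<in> borel_measurable borel"
  shows "(\<integral>\<^sup>+x. f (a + x) \<partial>lborel) = (\<integral>\<^sup>+x. f x \<partial>lborel)"
proof -
  have "(\<integral>\<^sup>+x. f x \<partial>lborel) = (\<integral>\<^sup>+x. f x \<partial>distr lborel borel ((+) a))" by (simp add: lborel_distr_plus)
  also have "\<dots> = (\<integral>\<^sup>+x. f (a + x) \<partial>lborel)"
    using assms by (intro nn_integral_distr) auto
  finally show ?thesis by simp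
qed

context young
begin

text \<open>Taken over the whole space and for vector fields as well: functions on an open set enter
  through their zero extension, to which the complement contributes nothing because \<Phi> vanishes
  at 0.\<close>

definition md :: "('a::euclidean_space \<Rightarrow> 'b::euclidean_space) \<Rightarrow> ennreal" where
  "md g = (\<integral>\<^sup>+x. ennreal (\<Phi> (norm (g x))) \<partial>lebesgue)"

lemma measurable_Phi_norm:
  fixes g :: "'a \<Rightarrow> 'b::euclidean_space"
  assumes "g \<in> borel_measurable M"
  shows "(\<lambda>x. \<Phi> (norm (g x))) \<in> borel_measurable M"
  using assms by measurable

lemma md_mono: "(\<And>x. norm (g x) \<le> norm (h x)) \<Longrightarrow> md g \<le> md h"
  unfolding md_def by (intro nn_integral_mono ennreal_leI Phi_mono) auto

lemma md_mono_AE: "AE x in lebesgue. norm (g x) \<le> norm (h x) \<Longrightarrow> md g \<le> md h"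
  unfolding md_def
  by (intro nn_integral_mono_AE) (auto intro!: ennreal_leI Phi_mono elim!: eventually_mono)

lemma md_cong_AE: "AE x in lebesgue. g x = h x \<Longrightarrow> md g = md h"
  unfolding md_def by (intro nn_integral_cong_AE) (auto elim!: eventually_mono)

lemma md_zero [simp]: "md (\<lambda>x. 0) = 0"
  by (simp add: md_def)

text \<open>The coefficient of g is as close to 1 as desired, at the price of a large coefficient of
  h. This is what comparing energies requires when h is a small perturbation.\<close>

lemma md_add:
  fixes g h :: "'a::euclidean_space \<Rightarrow> 'b::euclidean_space"
  assumes "\<epsilon> > 0" and m: "g \<in> borel_measurable lebesgue" "h \<in> borel_measurable lebesgue"
  shows "md (\<lambda>x. g x + h x) \<le> ennreal (1 + \<epsilon>) * md g + ennreal (addc \<epsilon>) * md h"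
proof -
  note [measurable] = measurable_Phi_norm[OF m(1)] measurable_Phi_norm[OF m(2)]
  have "md (\<lambda>x. g x + h x)
      \<le> (\<integral>\<^sup>+x. ennreal (1 + \<epsilon>) * ennreal (\<Phi> (norm (g x))) + ennreal (addc \<epsilon>) * ennreal (\<Phi> (norm (h x))) \<partial>lebesgue)"
    unfolding md_def
  proof (rule nn_integral_mono)
    fix x
    have "\<Phi> (norm (g x + h x)) \<le> \<Phi> (norm (g x) + norm (h x))"
      by (intro Phi_mono norm_triangle_ineq) auto
    also have "\<dots> \<le> (1 + \<epsilon>) * \<Phi> (norm (g x)) + addc \<epsilon> * \<Phi> (norm (h x))" by (intro Phi_add_le assms(1)) auto
    finally show "ennreal (\<Phi> (norm (g x + h x)))
        \<le> ennreal (1 + \<epsilon>) * ennreal (\<Phi> (norm (g x))) + ennreal (addc \<epsilon>) * ennreal (\<Phi> (norm (h x)))"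
      using assms(1) addc_pos[of \<epsilon>] Phi_nonneg
      by (simp add: ennreal_mult[symmetric] ennreal_plus[symmetric] del: ennreal_plus)
  qed
  also have "\<dots> = ennreal (1 + \<epsilon>) * md g + ennreal (addc \<epsilon>) * md h"
    unfolding md_def by (simp add: nn_integral_add nn_integral_cmult)
  finally show ?thesis .
qed

lemma md_scale:
  fixes g :: "'a::euclidean_space \<Rightarrow> 'b::euclidean_space"
  assumes m: "g \<in> borel_measurable lebesgue"
  shows "md (\<lambda>x. c *\<^sub>R g x) \<le> ennreal (scalec c) * md g"
proof -
  note [measurable] = measurable_Phi_norm[OF m]
  have "md (\<lambda>x. c *\<^sub>R g x) \<le> (\<integral>\<^sup>+x. ennreal (scalec c) * ennreal (\<Phi> (norm (g x))) \<partial>lebesgue)"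
    unfolding md_def using Phi_scale_bound Phi_nonneg scalec_pos[of c]
    by (intro nn_integral_mono) (simp add: ennreal_mult[symmetric] ennreal_leI)
  then show ?thesis by (simp add: md_def nn_integral_cmult)
qed

lemma md_lincomb:
  fixes g h :: "'a::euclidean_space \<Rightarrow> 'b::euclidean_space"
  assumes m: "g \<in> borel_measurable lebesgue" "h \<in> borel_measurable lebesgue"
  shows "md (\<lambda>x. g x + c *\<^sub>R h x) \<le> ennreal (2 + addc 1 * scalec c) * (md g + md h)"
proof -
  have "md (\<lambda>x. g x + c *\<^sub>R h x) \<le> ennreal (1 + 1) * md g + ennreal (addc 1) * md (\<lambda>x. c *\<^sub>R h x)"
    using m(2) by (intro md_add m) auto
  also have "\<dots> \<le> ennreal 2 * md g + ennreal (addc 1) * (ennreal (scalec c) * md h)"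
    by (intro add_mono mult_left_mono md_scale m) auto
  also have "\<dots> = ennreal 2 * md g + ennreal (addc 1 * scalec c) * md h"
    using addc_pos[of 1] scalec_pos[of c] by (simp add: ennreal_mult mult.assoc)
  also have "\<dots> \<le> ennreal (2 + addc 1 * scalec c) * md g + ennreal (2 + addc 1 * scalec c) * md h"
    using addc_pos[of 1] scalec_pos[of c] by (intro add_mono mult_right_mono ennreal_leI) auto
  finally show ?thesis by (simp add: distrib_left)
qed

lemma md_lincomb_finite:
  fixes g h :: "'a::euclidean_space \<Rightarrow> 'b::euclidean_space"
  assumes "g \<in> borel_measurable lebesgue" "h \<in> borel_measurable lebesgue" "md g < \<infinity>" "md h < \<infinity>"
  shows "md (\<lambda>x. g x + c *\<^sub>R h x) < \<infinity>"
  using md_lincomb[OF assms(1,2)] by (rule le_less_trans) (use assms(3,4) in \<open>simp add: ennreal_mult_less_top\<close>)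

lemma md_divide_le:
  fixes g :: "'a::euclidean_space \<Rightarrow> 'b::euclidean_space"
  assumes "g \<in> borel_measurable lebesgue" "l \<ge> 1"
  shows "md (\<lambda>x. g x /\<^sub>R l) \<le> ennreal (1 / l) * md g"
proof -
  note [measurable] = measurable_Phi_norm[OF assms(1)]
  have "md (\<lambda>x. g x /\<^sub>R l) \<le> (\<integral>\<^sup>+x. ennreal (1 / l) * ennreal (\<Phi> (norm (g x))) \<partial>lebesgue)"
    unfolding md_def using Phi_scale_le[of "1 / l"] assms(2) Phi_nonneg inverse_le_1_iff[of l]
    by (intro nn_integral_mono) (simp add: ennreal_mult[symmetric] divide_inverse)
  then show ?thesis by (simp add: md_def nn_integral_cmult)
qed

lemma md_test_finite:
  fixes \<psi> :: "'a::euclidean_space \<Rightarrow> real"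
  assumes "\<psi> \<in> test_functions \<Omega>"
  shows "md \<psi> < \<infinity>" "md (grad \<psi>) < \<infinity>"
proof -
  obtain C where C: "compact C" "\<And>x. x \<notin> C \<Longrightarrow> \<psi> x = 0" "\<And>x. x \<notin> C \<Longrightarrow> grad \<psi> x = 0"
    using test_functionE[OF assms] by metis
  obtain B where B: "B > 0" "\<And>x. norm (\<psi> x) \<le> B" "\<And>x. norm (grad \<psi> x) \<le> B"
    using test_function_bounded[OF assms] by metis
  have "C \<in> sets lebesgue" "emeasure lebesgue C < \<infinity>"
    using C(1) emeasure_bounded_finite[OF compact_imp_bounded[OF C(1)]] by (auto simp: borel_compact)
  then have fin: "(\<integral>\<^sup>+x. ennreal (\<Phi> B) * indicator C x \<partial>lebesgue) < \<infinity>"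
    by (simp add: nn_integral_cmult_indicator ennreal_mult_less_top)
  have "md \<psi> \<le> (\<integral>\<^sup>+x. ennreal (\<Phi> B) * indicator C x \<partial>lebesgue)"
    unfolding md_def using B(2) C(2) by (intro nn_integral_mono) (auto simp: indicator_def intro!: ennreal_leI Phi_mono)
  then show "md \<psi> < \<infinity>" using fin by (rule le_less_trans)
  have "md (grad \<psi>) \<le> (\<integral>\<^sup>+x. ennreal (\<Phi> B) * indicator C x \<partial>lebesgue)"
    unfolding md_def using B(3) C(3) by (intro nn_integral_mono) (auto simp: indicator_def intro!: ennreal_leI Phi_mono)
  then show "md (grad \<psi>) < \<infinity>" using fin by (rule le_less_trans)
qed

lemma nn_integral_norm_le_md:
  fixes g :: "'a::euclidean_space \<Rightarrow> 'b::euclidean_space"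
  assumes g: "g \<in> borel_measurable lebesgue" and D: "D \<in> sets lebesgue" and \<theta>: "\<theta> > 0"
  shows "(\<integral>\<^sup>+x. ennreal (norm (g x)) * indicator D x \<partial>lebesgue)
    \<le> ennreal \<theta> * emeasure lebesgue D + ennreal (\<theta> / \<Phi> \<theta>) * md g"
proof -
  note [measurable] = measurable_Phi_norm[OF g] D
  have "(\<integral>\<^sup>+x. ennreal (norm (g x)) * indicator D x \<partial>lebesgue)
      \<le> (\<integral>\<^sup>+x. ennreal \<theta> * indicator D x + ennreal (\<theta> / \<Phi> \<theta>) * ennreal (\<Phi> (norm (g x))) \<partial>lebesgue)"
  proof (rule nn_integral_mono)
    fix x
    have "norm (g x) \<le> \<theta> + \<theta> / \<Phi> \<theta> * \<Phi> (norm (g x))" by (rule linear_le_Phi[OF \<theta>]) simp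
    then have "ennreal (norm (g x)) \<le> ennreal \<theta> + ennreal (\<theta> / \<Phi> \<theta>) * ennreal (\<Phi> (norm (g x)))"
      using \<theta> Phi_pos[OF \<theta>] Phi_nonneg
      by (simp add: ennreal_mult[symmetric] ennreal_plus[symmetric] del: ennreal_plus)
    then show "ennreal (norm (g x)) * indicator D x
        \<le> ennreal \<theta> * indicator D x + ennreal (\<theta> / \<Phi> \<theta>) * ennreal (\<Phi> (norm (g x)))"
      by (auto simp: indicator_def)
  qed
  also have "\<dots> = ennreal \<theta> * emeasure lebesgue D + ennreal (\<theta> / \<Phi> \<theta>) * md g"
    unfolding md_def by (subst nn_integral_add) (auto simp: nn_integral_cmult nn_integral_cmult_indicator)
  finally show ?thesis .
qed

lemma md_finite_integrable:
  fixes g :: "'a::euclidean_space \<Rightarrow> 'b::euclidean_space"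
  assumes g: "g \<in> borel_measurable lebesgue" and "md g < \<infinity>" and D: "D \<in> lmeasurable"
  shows "integrable lebesgue (\<lambda>x. indicator D x *\<^sub>R g x)"
proof (rule integrableI_bounded)
  have D': "D \<in> sets lebesgue" using D by auto
  then show "(\<lambda>x. indicator D x *\<^sub>R g x) \<in> borel_measurable lebesgue"
    using g by (intro borel_measurable_scaleR borel_measurable_indicator)
  have "(\<integral>\<^sup>+x. ennreal (norm (indicator D x *\<^sub>R g x)) \<partial>lebesgue) = (\<integral>\<^sup>+x. ennreal (norm (g x)) * indicator D x \<partial>lebesgue)"
    by (intro nn_integral_cong) (auto simp: indicator_def)
  also have "\<dots> \<le> ennreal 1 * emeasure lebesgue D + ennreal (1 / \<Phi> 1) * md g"
    by (rule nn_integral_norm_le_md[OF g D']) simp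
  also have "\<dots> < \<infinity>"
    using assms(2) D by (auto simp: ennreal_mult_less_top fmeasurable_def)
  finally show "(\<integral>\<^sup>+x. ennreal (norm (indicator D x *\<^sub>R g x)) \<partial>lebesgue) < \<infinity>" .
qed

text \<open>First \<theta> is chosen such that \<theta> times the measure of D is at most e/2, then
  \<delta> such that the modular term of \<open>nn_integral_norm_le_md\<close> equals e/2.\<close>

lemma md_small_L1:
  assumes D: "D \<in> lmeasurable" and "e > 0"
  shows "\<exists>\<delta>>0. \<forall>g :: 'a::euclidean_space \<Rightarrow> 'b::euclidean_space. g \<in> borel_measurable lebesgue \<longrightarrow>
    md g \<le> ennreal \<delta> \<longrightarrow> (\<integral>\<^sup>+x. ennreal (norm (g x)) * indicator D x \<partial>lebesgue) \<le> ennreal e"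
proof -
  define m where "m = measure lebesgue D"
  have m: "m \<ge> 0" "emeasure lebesgue D = ennreal m"
    unfolding m_def using emeasure_eq_measure2[OF D] by simp_all
  \<comment> \<open>The summand 1 prevents division by zero when D is a null set.\<close>
  define \<theta> where "\<theta> = e / (2 * (m + 1))"
  have \<theta>: "\<theta> > 0" using m(1) \<open>e > 0\<close> by (simp add: \<theta>_def)
  have \<theta>m: "\<theta> * m \<le> e / 2"
  proof -
    have "m / (m + 1) \<le> 1" using m(1) by simp
    then have "e / 2 * (m / (m + 1)) \<le> e / 2 * 1" using \<open>e > 0\<close> by (intro mult_left_mono) auto
    then show ?thesis by (simp add: \<theta>_def)
  qed
  define \<delta> where "\<delta> = e / 2 * \<Phi> \<theta> / \<theta>"
  have \<delta>: "\<delta> > 0" "\<theta> / \<Phi> \<theta> * \<delta> = e / 2"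
    using Phi_pos[OF \<theta>] \<theta> \<open>e > 0\<close> by (auto simp: \<delta>_def)
  show ?thesis
  proof (intro exI[of _ \<delta>] conjI \<delta> allI impI)
    fix g :: "'a \<Rightarrow> 'b" assume g: "g \<in> borel_measurable lebesgue" and "md g \<le> ennreal \<delta>"
    have "(\<integral>\<^sup>+x. ennreal (norm (g x)) * indicator D x \<partial>lebesgue)
        \<le> ennreal \<theta> * emeasure lebesgue D + ennreal (\<theta> / \<Phi> \<theta>) * md g"
      using D by (intro nn_integral_norm_le_md[OF g _ \<theta>]) auto
    also have "\<dots> \<le> ennreal \<theta> * ennreal m + ennreal (\<theta> / \<Phi> \<theta>) * ennreal \<delta>"
      using \<open>md g \<le> ennreal \<delta>\<close> m by (intro add_mono mult_left_mono) auto
    also have "\<dots> = ennreal (\<theta> * m + \<theta> / \<Phi> \<theta> * \<delta>)"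
      using \<theta> m(1) \<delta>(1) Phi_pos[OF \<theta>] by (simp add: ennreal_mult[symmetric] ennreal_plus[symmetric] del: ennreal_plus)
    also have "\<dots> \<le> ennreal e" using add_mono[OF \<theta>m eq_refl[OF \<delta>(2)]] by (intro ennreal_leI) (simp only: field_sum_of_halves)
    finally show "(\<integral>\<^sup>+x. ennreal (norm (g x)) * indicator D x \<partial>lebesgue) \<le> ennreal e" .
  qed
qed

lemma continuous_Phi_compose:
  assumes "continuous_on S g" "\<And>x. x \<in> S \<Longrightarrow> g x \<ge> 0"
  shows "continuous_on S (\<lambda>x. \<Phi> (g x))"
proof -
  have "continuous_on {0..} \<Phi>"
    unfolding continuous_on_eq_continuous_within
  proof
    fix t :: real assume "t \<in> {0..}"
    then have "continuous (at t within {0..t + 1}) \<Phi>"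
      using continuous_Phi[of "t + 1"] by (simp add: continuous_on_eq_continuous_within)
    moreover have "at t within {0..} = at t within {0..t + 1}"
      by (rule at_within_nhd[of t "{..<t + 1}"]) auto
    ultimately show "continuous (at t within {0..}) \<Phi>" by simp
  qed
  then show ?thesis
    by (rule continuous_on_compose2[OF _ assms(1)]) (use assms(2) in auto)
qed

text \<open>The tangent of \<Phi> at the mean a / L, integrated over the interval. The number a may
  lie below the integral of g, because the slope there is nonnegative.\<close>

lemma Phi_jensen:
  fixes g :: "real \<Rightarrow> real"
  assumes "L > 0" "continuous_on {0..L} g" "\<And>t. t \<in> {0..L} \<Longrightarrow> g t \<ge> 0" "0 \<le> a" "a \<le> integral {0..L} g"
  shows "L * \<Phi> (a / L) \<le> integral {0..L} (\<lambda>t. \<Phi> (g t))"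
proof -
  let ?a = "a / L"
  have cPhi: "continuous_on {0..L} (\<lambda>t. \<Phi> (g t))"
    using assms by (intro continuous_Phi_compose) auto
  have "L * \<Phi> ?a \<le> L * \<Phi> ?a + \<phi> ?a * (integral {0..L} g - a)"
    using assms phi_nonneg[of ?a] by simp
  also have "\<dots> = integral {0..L} (\<lambda>t. (\<Phi> ?a - \<phi> ?a * ?a) + \<phi> ?a * g t)"
  proof -
    have "(g has_integral integral {0..L} g) {0..L}"
      using integrable_continuous_interval[OF assms(2)] by (rule integrable_integral)
    from has_integral_add[OF has_integral_const_real[of "\<Phi> ?a - \<phi> ?a * ?a" 0 L] has_integral_mult_right[OF this, of "\<phi> ?a"]]
    have "integral {0..L} (\<lambda>t. (\<Phi> ?a - \<phi> ?a * ?a) + \<phi> ?a * g t)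
        = L *\<^sub>R (\<Phi> ?a - \<phi> ?a * ?a) + \<phi> ?a * integral {0..L} g"
      using assms(1) by (intro integral_unique) simp
    then show ?thesis using assms(1) by (simp add: algebra_simps)
  qed
  also have "\<dots> \<le> integral {0..L} (\<lambda>t. \<Phi> (g t))"
  proof (rule integral_le)
    show "(\<Phi> ?a - \<phi> ?a * ?a) + \<phi> ?a * g t \<le> \<Phi> (g t)" if "t \<in> {0..L}" for t
      using Phi_subgradient[of "g t" ?a] assms(1,4) assms(3)[OF that] by (simp add: algebra_simps)
  qed (use cPhi assms(2) in \<open>auto intro!: integrable_continuous_interval continuous_intros\<close>)
  finally show ?thesis .
qed

text \<open>Starting at x in a coordinate direction, one leaves the ball within length L = 2 R + 1.
  So \<psi> x is minus the integral of a directional derivative over a segment of length L. Jensen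
  on the segment, Fubini and translation invariance give the inequality; the factor L from the
  segment appears on both sides and cancels.\<close>

lemma poincare_test:
  fixes \<psi> :: "'a::euclidean_space \<Rightarrow> real"
  assumes \<psi>: "\<psi> \<in> test_functions D" and D: "D \<subseteq> cball 0 R" and R: "R \<ge> 0"
  shows "md (\<lambda>x. \<psi> x /\<^sub>R (2 * R + 1)) \<le> md (grad \<psi>)"
proof -
  define L where "L = 2 * R + 1"
  have L: "L > 0" using R by (simp add: L_def)
  obtain b :: 'a where b: "b \<in> Basis" using nonempty_Basis by blast
  obtain C where C: "smooth \<psi>" "C \<subseteq> D" "\<And>x. x \<notin> C \<Longrightarrow> \<psi> x = 0"
    using test_functionE[OF \<psi>] by metis
  have zero: "\<psi> x = 0" if "norm x > R" for x
    using C(3)[of x] C(2) D that by force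
  note [measurable] = test_function_borel[OF \<psi>] measurable_Phi_norm[OF test_function_borel(2)[OF \<psi>]]
  have cg: "continuous_on UNIV (\<lambda>t. grad \<psi> (x + t *\<^sub>R b))" for x
    by (intro continuous_on_compose2[OF smooth_continuous_grad[OF C(1), of UNIV]] continuous_intros) auto
  have pointwise: "ennreal (L * \<Phi> (\<bar>\<psi> x\<bar> / L))
      \<le> (\<integral>\<^sup>+t. ennreal (\<Phi> (norm (grad \<psi> (t *\<^sub>R b + x)))) * indicator {0..L} t \<partial>lborel)" for x
  proof (cases "\<psi> x = 0")
    case False
    then have "norm x \<le> R" using zero by (meson not_le)
    \<comment> \<open>The norm is at least L - |x|, hence at least R + 1.\<close>
    then have "norm (x + L *\<^sub>R b) > R"
      using norm_triangle_ineq4[of "x + L *\<^sub>R b" x] b L by (simp add: L_def)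
    then have end0: "\<psi> (x + L *\<^sub>R b) = 0" by (rule zero)
    let ?g = "\<lambda>t. norm (grad \<psi> (x + t *\<^sub>R b))"
    have c: "continuous_on {0..L} ?g" "continuous_on {0..L} (\<lambda>t. grad \<psi> (x + t *\<^sub>R b) \<bullet> b)"
      using continuous_on_subset[OF cg, of "{0..L}" x] by (auto intro!: continuous_intros)
    have "((\<lambda>t. grad \<psi> (x + t *\<^sub>R b) \<bullet> b) has_integral (\<psi> (x + L *\<^sub>R b) - \<psi> (x + 0 *\<^sub>R b))) {0..L}"
    proof (rule fundamental_theorem_of_calculus)
      fix t
      have "((\<lambda>t. \<psi> (x + t *\<^sub>R b)) has_derivative (\<lambda>s. grad \<psi> (x + t *\<^sub>R b) \<bullet> (s *\<^sub>R b))) (at t within {0..L})"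
        by (rule has_derivative_compose[of "\<lambda>t. x + t *\<^sub>R b" "\<lambda>t. t *\<^sub>R b" _ _ \<psi> "\<lambda>h. grad \<psi> (x + t *\<^sub>R b) \<bullet> h"])
          (use smooth_has_derivative[OF C(1)] in \<open>auto intro!: derivative_eq_intros\<close>)
      then show "((\<lambda>t. \<psi> (x + t *\<^sub>R b)) has_vector_derivative grad \<psi> (x + t *\<^sub>R b) \<bullet> b) (at t within {0..L})"
        by (simp add: has_vector_derivative_def)
    qed (use L in auto)
    then have "integral {0..L} (\<lambda>t. grad \<psi> (x + t *\<^sub>R b) \<bullet> b) = - \<psi> x"
      using end0 by (simp add: integral_unique)
    moreover have "norm (integral {0..L} (\<lambda>t. grad \<psi> (x + t *\<^sub>R b) \<bullet> b)) \<le> integral {0..L} ?g"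
    proof (rule integral_norm_bound_integral)
      show "norm (grad \<psi> (x + t *\<^sub>R b) \<bullet> b) \<le> ?g t" for t
        using Cauchy_Schwarz_ineq2[of "grad \<psi> (x + t *\<^sub>R b)" b] b by simp
    qed (use c in \<open>auto intro!: integrable_continuous_interval\<close>)
    ultimately have "\<bar>\<psi> x\<bar> \<le> integral {0..L} ?g" by simp
    then have "L * \<Phi> (\<bar>\<psi> x\<bar> / L) \<le> integral {0..L} (\<lambda>t. \<Phi> (?g t))"
      using L c by (intro Phi_jensen) auto
    moreover have "(\<integral>\<^sup>+t. ennreal (indicator {0..L} t * \<Phi> (?g t)) \<partial>lborel) = ennreal (integral {0..L} (\<lambda>t. \<Phi> (?g t)))"
    proof (rule nn_integral_has_integral_lebesgue)
      show "((\<lambda>t. \<Phi> (?g t)) has_integral integral {0..L} (\<lambda>t. \<Phi> (?g t))) {0..L}"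
        using c(1) by (intro integrable_integral integrable_continuous_interval continuous_Phi_compose) auto
    qed (simp add: Phi_nonneg)
    moreover have "(\<integral>\<^sup>+t. ennreal (\<Phi> (norm (grad \<psi> (t *\<^sub>R b + x)))) * indicator {0..L} t \<partial>lborel)
        = (\<integral>\<^sup>+t. ennreal (indicator {0..L} t * \<Phi> (?g t)) \<partial>lborel)"
      by (intro nn_integral_cong) (auto simp: indicator_def add.commute)
    ultimately show ?thesis by (simp add: ennreal_leI)
  qed simp
  have "ennreal L * md (\<lambda>x. \<psi> x /\<^sub>R L) = (\<integral>\<^sup>+x. ennreal (L * \<Phi> (\<bar>\<psi> x\<bar> / L)) \<partial>lborel)"
  proof -
    have [measurable]: "(\<lambda>x. \<Phi> (norm (\<psi> x /\<^sub>R L))) \<in> borel_measurable lborel"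
      by (intro measurable_Phi_norm) auto
    have "ennreal L * md (\<lambda>x. \<psi> x /\<^sub>R L) = (\<integral>\<^sup>+x. ennreal L * ennreal (\<Phi> (norm (\<psi> x /\<^sub>R L))) \<partial>lborel)"
      unfolding md_def nn_integral_completion by (rule nn_integral_cmult[symmetric]) measurable
    also have "\<dots> = (\<integral>\<^sup>+x. ennreal (L * \<Phi> (\<bar>\<psi> x\<bar> / L)) \<partial>lborel)"
    proof (rule nn_integral_cong)
      fix x
      have "norm (\<psi> x /\<^sub>R L) = \<bar>\<psi> x\<bar> / L" using L by (simp add: divide_inverse mult.commute abs_mult)
      then show "ennreal L * ennreal (\<Phi> (norm (\<psi> x /\<^sub>R L))) = ennreal (L * \<Phi> (\<bar>\<psi> x\<bar> / L))"
        using L Phi_nonneg[of "\<bar>\<psi> x\<bar> / L"] by (simp add: ennreal_mult)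
    qed
    finally show ?thesis .
  qed
  also have "\<dots> \<le> (\<integral>\<^sup>+x. \<integral>\<^sup>+t. ennreal (\<Phi> (norm (grad \<psi> (t *\<^sub>R b + x)))) * indicator {0..L} t \<partial>lborel \<partial>lborel)"
    by (intro nn_integral_mono pointwise)
  also have "\<dots> = (\<integral>\<^sup>+t. \<integral>\<^sup>+x. ennreal (\<Phi> (norm (grad \<psi> (t *\<^sub>R b + x)))) * indicator {0..L} t \<partial>lborel \<partial>lborel)"
    by (rule lborel_pair.Fubini') measurable
  also have "\<dots> = (\<integral>\<^sup>+t. md (grad \<psi>) * indicator {0..L} t \<partial>lborel)"
  proof (rule nn_integral_cong)
    fix t :: real
    have "(\<integral>\<^sup>+x. ennreal (\<Phi> (norm (grad \<psi> (t *\<^sub>R b + x)))) * indicator {0..L} t \<partial>lborel)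
        = (\<integral>\<^sup>+x. ennreal (\<Phi> (norm (grad \<psi> (t *\<^sub>R b + x)))) \<partial>lborel) * indicator {0..L} t"
      by (rule nn_integral_multc) measurable
    also have "(\<integral>\<^sup>+x. ennreal (\<Phi> (norm (grad \<psi> (t *\<^sub>R b + x)))) \<partial>lborel) = md (grad \<psi>)"
      unfolding md_def nn_integral_completion
      by (rule nn_integral_lborel_translate) measurable
    finally show "(\<integral>\<^sup>+x. ennreal (\<Phi> (norm (grad \<psi> (t *\<^sub>R b + x)))) * indicator {0..L} t \<partial>lborel)
        = md (grad \<psi>) * indicator {0..L} t" .
  qed
  also have "\<dots> = ennreal L * md (grad \<psi>)"
    using L by (simp add: nn_integral_cmult_indicator mult.commute)
  finally have "ennreal L * md (\<lambda>x. \<psi> x /\<^sub>R L) \<le> ennreal L * md (grad \<psi>)" .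
  then show ?thesis
    using L unfolding L_def[symmetric] by (subst (asm) ennreal_mult_le_mult_iff) auto
qed

end


section \<open>Orlicz--Sobolev functions as modular limits of test functions\<close>

lemma bounded_pairing:
  fixes q v :: "'a::euclidean_space \<Rightarrow> real"
  assumes v: "v \<in> borel_measurable lebesgue" and q: "q \<in> borel_measurable lebesgue"
    and B: "\<And>x. \<bar>q x\<bar> \<le> B * indicator D x" "B \<ge> 0" and D: "D \<in> sets lebesgue"
    and e: "(\<integral>\<^sup>+x. ennreal (norm (v x)) * indicator D x \<partial>lebesgue) \<le> ennreal e" "e \<ge> 0"
  shows "integrable lebesgue (\<lambda>x. q x * v x)" "\<bar>\<integral>x. q x * v x \<partial>lebesgue\<bar> \<le> B * e"
proof -
  have "(\<integral>\<^sup>+x. ennreal (norm (q x * v x)) \<partial>lebesgue)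
      \<le> (\<integral>\<^sup>+x. ennreal B * (ennreal (norm (v x)) * indicator D x) \<partial>lebesgue)"
  proof (rule nn_integral_mono)
    fix x
    have "norm (q x * v x) \<le> (B * indicator D x) * norm (v x)"
      using B(1)[of x] by (simp add: abs_mult mult_right_mono)
    then show "ennreal (norm (q x * v x)) \<le> ennreal B * (ennreal (norm (v x)) * indicator D x)"
      using B(2) by (auto simp: indicator_def ennreal_mult[symmetric] intro!: ennreal_leI split: if_splits)
  qed
  also have "\<dots> = ennreal B * (\<integral>\<^sup>+x. ennreal (norm (v x)) * indicator D x \<partial>lebesgue)"
    using v borel_measurable_indicator[OF D] by (intro nn_integral_cmult) measurable
  also have "\<dots> \<le> ennreal B * ennreal e" by (intro mult_left_mono e) auto
  also have "\<dots> = ennreal (B * e)" using B(2) e(2) by (simp add: ennreal_mult)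
  finally have le: "(\<integral>\<^sup>+x. ennreal (norm (q x * v x)) \<partial>lebesgue) \<le> ennreal (B * e)" .
  show i: "integrable lebesgue (\<lambda>x. q x * v x)"
  proof (rule integrableI_bounded)
    show "(\<lambda>x. q x * v x) \<in> borel_measurable lebesgue" using v q by (rule borel_measurable_times[rotated])
    show "(\<integral>\<^sup>+x. ennreal (norm (q x * v x)) \<partial>lebesgue) < \<infinity>" using le by (rule le_less_trans) simp
  qed
  have "ennreal (norm (\<integral>x. q x * v x \<partial>lebesgue)) \<le> ennreal (B * e)"
    using integral_norm_bound_ennreal[OF i] le by (rule order_trans)
  then show "\<bar>\<integral>x. q x * v x \<partial>lebesgue\<bar> \<le> B * e" using B(2) e(2) by (simp add: ennreal_le_iff)
qed

context young
begin

text \<open>The closure of the pairs (\<psi>, \<nabla>\<psi>) under modular convergence. Carrying g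
  along avoids any choice of a weak gradient, and the pair lives on the whole space, so that
  enlarging \<Omega> does not change it.\<close>

definition Wpair :: "'a::euclidean_space set \<Rightarrow> ('a \<Rightarrow> real) \<Rightarrow> ('a \<Rightarrow> 'a) \<Rightarrow> bool" where
  "Wpair \<Omega> u g \<longleftrightarrow> u \<in> borel_measurable lebesgue \<and> g \<in> borel_measurable lebesgue \<and>
    (\<forall>e>0. \<exists>\<psi>\<in>test_functions \<Omega>. md (\<lambda>x. u x - \<psi> x) \<le> ennreal e \<and> md (\<lambda>x. g x - grad \<psi> x) \<le> ennreal e)"

lemma Wpair_measurable:
  "Wpair \<Omega> u g \<Longrightarrow> u \<in> borel_measurable lebesgue" "Wpair \<Omega> u g \<Longrightarrow> g \<in> borel_measurable lebesgue"
  by (auto simp: Wpair_def)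

lemma Wpair_approx:
  assumes "Wpair \<Omega> u g" "e > 0"
  obtains \<psi> where "\<psi> \<in> test_functions \<Omega>" "md (\<lambda>x. u x - \<psi> x) \<le> ennreal e" "md (\<lambda>x. g x - grad \<psi> x) \<le> ennreal e"
  using assms unfolding Wpair_def by blast

lemma test_function_lebesgue:
  assumes "\<psi> \<in> test_functions \<Omega>"
  shows "\<psi> \<in> borel_measurable lebesgue" "grad \<psi> \<in> borel_measurable lebesgue"
  using test_function_borel[OF assms] by (blast intro: measurable_lebesgueI)+

lemma Wpair_test:
  assumes "\<psi> \<in> test_functions \<Omega>"
  shows "Wpair \<Omega> \<psi> (grad \<psi>)"
  using assms test_function_lebesgue[OF assms] unfolding Wpair_def
  by (auto intro!: bexI[of _ \<psi>])

lemma Wpair_mono: "Wpair \<Omega> u g \<Longrightarrow> \<Omega> \<subseteq> D \<Longrightarrow> Wpair D u g"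
  unfolding Wpair_def using test_functions_mono[of \<Omega> D] by (meson subsetD)

lemma md_minus_commute: "md (\<lambda>x. g x - h x) = md (\<lambda>x. h x - g x)"
  by (simp add: md_def norm_minus_commute)

lemma Wpair_add:
  fixes u v :: "'a::euclidean_space \<Rightarrow> real"
  assumes u: "Wpair \<Omega> u g" and v: "Wpair \<Omega> v h"
  shows "Wpair \<Omega> (\<lambda>x. u x + c * v x) (\<lambda>x. g x + c *\<^sub>R h x)"
  unfolding Wpair_def
proof (intro conjI allI impI)
  note m = Wpair_measurable[OF u] Wpair_measurable[OF v]
  note [measurable] = m
  show "(\<lambda>x. u x + c * v x) \<in> borel_measurable lebesgue" "(\<lambda>x. g x + c *\<^sub>R h x) \<in> borel_measurable lebesgue"
    by measurable
  fix e :: real assume "e > 0"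
  define K where "K = 2 + addc 1 * scalec c"
  define d where "d = e / (2 * K)"
  have "K > 0" using addc_pos[of 1] scalec_pos[of c] by (simp add: K_def add_pos_pos)
  then have d: "d > 0" "K * (d + d) = e" using \<open>e > 0\<close> by (auto simp: d_def)
  have small: "ennreal K * (a + b) \<le> ennreal e" if "a \<le> ennreal d" "b \<le> ennreal d" for a b
  proof -
    have "ennreal K * (a + b) \<le> ennreal K * (ennreal d + ennreal d)"
      using that by (intro mult_left_mono add_mono) auto
    also have "\<dots> = ennreal e"
      using d \<open>K > 0\<close> by (simp add: ennreal_mult[symmetric] ennreal_plus[symmetric] del: ennreal_plus)
    finally show ?thesis .
  qed
  obtain \<psi> where \<psi>: "\<psi> \<in> test_functions \<Omega>" "md (\<lambda>x. u x - \<psi> x) \<le> ennreal d" "md (\<lambda>x. g x - grad \<psi> x) \<le> ennreal d"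
    using Wpair_approx[OF u d(1)] by metis
  obtain w where w: "w \<in> test_functions \<Omega>" "md (\<lambda>x. v x - w x) \<le> ennreal d" "md (\<lambda>x. h x - grad w x) \<le> ennreal d"
    using Wpair_approx[OF v d(1)] by metis
  note [measurable] = test_function_lebesgue[OF \<psi>(1)] test_function_lebesgue[OF w(1)]
  note sm = test_function_smooth[OF \<psi>(1)] test_function_smooth[OF w(1)]
  show "\<exists>\<psi>\<in>test_functions \<Omega>. md (\<lambda>x. u x + c * v x - \<psi> x) \<le> ennreal e \<and> md (\<lambda>x. g x + c *\<^sub>R h x - grad \<psi> x) \<le> ennreal e"
  proof (intro bexI[of _ "\<lambda>x. \<psi> x + c * w x"] conjI)
    show "(\<lambda>x. \<psi> x + c * w x) \<in> test_functions \<Omega>" using \<psi>(1) w(1) by (rule test_function_add)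
    have "md (\<lambda>x. (u x - \<psi> x) + c *\<^sub>R (v x - w x)) \<le> ennreal K * (md (\<lambda>x. u x - \<psi> x) + md (\<lambda>x. v x - w x))"
      unfolding K_def by (rule md_lincomb) measurable
    also have "\<dots> \<le> ennreal e" using \<psi>(2) w(2) by (rule small)
    finally show "md (\<lambda>x. u x + c * v x - (\<psi> x + c * w x)) \<le> ennreal e" by (simp add: algebra_simps)
    have "md (\<lambda>x. (g x - grad \<psi> x) + c *\<^sub>R (h x - grad w x)) \<le> ennreal K * (md (\<lambda>x. g x - grad \<psi> x) + md (\<lambda>x. h x - grad w x))"
      unfolding K_def by (rule md_lincomb) measurable
    also have "\<dots> \<le> ennreal e" using \<psi>(3) w(3) by (rule small)
    finally show "md (\<lambda>x. g x + c *\<^sub>R h x - grad (\<lambda>x. \<psi> x + c * w x) x) \<le> ennreal e"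
      using sm by (simp add: grad_add grad_cmult smooth_mult algebra_simps)
  qed
qed

lemma Wpair_finite:
  fixes u :: "'a::euclidean_space \<Rightarrow> real"
  assumes u: "Wpair \<Omega> u g"
  shows "md u < \<infinity>" "md g < \<infinity>"
proof -
  obtain \<psi> where \<psi>: "\<psi> \<in> test_functions \<Omega>" "md (\<lambda>x. u x - \<psi> x) \<le> ennreal 1" "md (\<lambda>x. g x - grad \<psi> x) \<le> ennreal 1"
    using Wpair_approx[OF u] by (metis zero_less_one)
  note [measurable] = Wpair_measurable[OF u] test_function_lebesgue[OF \<psi>(1)]
  have m: "(\<lambda>x. u x - \<psi> x) \<in> borel_measurable lebesgue" "(\<lambda>x. g x - grad \<psi> x) \<in> borel_measurable lebesgue"
    by measurable
  have fin: "md (\<lambda>x. u x - \<psi> x) < \<infinity>" "md (\<lambda>x. g x - grad \<psi> x) < \<infinity>"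
    using le_less_trans[OF \<psi>(2)] le_less_trans[OF \<psi>(3)] by simp_all
  show "md u < \<infinity>"
    using md_lincomb_finite[OF m(1) test_function_lebesgue(1)[OF \<psi>(1)] fin(1) md_test_finite(1)[OF \<psi>(1)], of 1] by simp
  show "md g < \<infinity>"
    using md_lincomb_finite[OF m(2) test_function_lebesgue(2)[OF \<psi>(1)] fin(2) md_test_finite(2)[OF \<psi>(1)], of 1] by simp
qed

text \<open>The inequality for test functions passes to limits. Doubling moves the factor 1/L out of
  \<Phi>, so that one constant serves all pairs on D, hence on all its open subsets.\<close>

lemma Wpair_poincare:
  fixes D :: "'a::euclidean_space set"
  assumes "bounded D"
  shows "\<exists>C>0. \<forall>u g. Wpair D u g \<longrightarrow> md u \<le> ennreal C * md g"
proof -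
  obtain R where "\<forall>x\<in>D. norm x \<le> R" using assms unfolding bounded_iff by blast
  then have R: "D \<subseteq> cball 0 (max 0 R)" by (auto simp: le_max_iff_disj)
  define L where "L = 2 * max 0 R + 1"
  define K1 K3 where "K1 = 2 + addc 1 * scalec 1" and "K3 = scalec L"
  have K: "K1 > 0" "K3 > 0" using addc_pos[of 1] scalec_pos[of 1] by (simp_all add: K1_def K3_def add_pos_pos scalec_pos)
  note add = md_lincomb[where c = 1, folded K1_def, simplified]
  \<comment> \<open>One factor \<open>K1\<close> for splitting u, \<open>K3\<close> for undoing the
    division by L, and one more \<open>K1\<close> for splitting \<nabla>\<psi>.\<close>
  define C where "C = K1 * K3 * K1"
  show ?thesis
  proof (intro exI[of _ C] conjI allI impI)
    show "C > 0" using K by (simp add: C_def)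
    fix u g assume u: "Wpair D u g"
    note [measurable] = Wpair_measurable[OF u]
    show "md u \<le> ennreal C * md g"
    proof (rule ennreal_le_epsilon)
      fix e :: real assume "e > 0"
      define d where "d = e / (K1 + C)"
      have d: "d > 0" "K1 * d + C * d = e"
        using \<open>e > 0\<close> \<open>C > 0\<close> K(1) by (simp_all add: d_def add_divide_distrib[symmetric] distrib_right[symmetric])
      obtain \<psi> where \<psi>: "\<psi> \<in> test_functions D" "md (\<lambda>x. u x - \<psi> x) \<le> ennreal d" "md (\<lambda>x. g x - grad \<psi> x) \<le> ennreal d"
        using Wpair_approx[OF u d(1)] by metis
      note [measurable] = test_function_lebesgue[OF \<psi>(1)]
      have "md \<psi> = md (\<lambda>x. L *\<^sub>R (\<psi> x /\<^sub>R L))"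
      proof -
        have "L \<noteq> 0" using max.cobounded1[of 0 R] unfolding L_def by linarith
        then show ?thesis by (simp add: mult.assoc[symmetric])
      qed
      also have "\<dots> \<le> ennreal K3 * md (\<lambda>x. \<psi> x /\<^sub>R L)" unfolding K3_def by (rule md_scale) measurable
      also have "md (\<lambda>x. \<psi> x /\<^sub>R L) \<le> md (grad \<psi>)"
        unfolding L_def by (rule poincare_test[OF \<psi>(1) R]) simp
      also have "md (grad \<psi>) = md (\<lambda>x. g x + (grad \<psi> x - g x))" by simp
      also have "\<dots> \<le> ennreal K1 * (md g + md (\<lambda>x. grad \<psi> x - g x))" by (rule add) measurable
      also have "md (\<lambda>x. grad \<psi> x - g x) \<le> ennreal d" using \<psi>(3) by (simp add: md_minus_commute)
      finally have 1: "md \<psi> \<le> ennreal K3 * (ennreal K1 * (md g + ennreal d))"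
        by (simp add: mult_left_mono add_left_mono)
      have "md u = md (\<lambda>x. (u x - \<psi> x) + \<psi> x)" by simp
      also have "\<dots> \<le> ennreal K1 * (md (\<lambda>x. u x - \<psi> x) + md \<psi>)" by (rule add) measurable
      also have "\<dots> \<le> ennreal K1 * (ennreal d + ennreal K3 * (ennreal K1 * (md g + ennreal d)))"
        by (intro mult_left_mono add_mono \<psi>(2) 1) auto
      also have "\<dots> = ennreal C * md g + (ennreal (K1 * d) + ennreal (C * d))"
        using K d(1) by (simp add: C_def ennreal_mult algebra_simps)
      also have "ennreal (K1 * d) + ennreal (C * d) = ennreal e"
        using K(1) \<open>C > 0\<close> d by (simp add: ennreal_plus[symmetric] del: ennreal_plus)
      finally show "md u \<le> ennreal C * md g + ennreal e" .
    qed
  qed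
qed

lemma Wpair_integrable:
  assumes "Wpair D u g" "bounded D" "open D"
  shows "integrable lebesgue (\<lambda>x. indicator D x *\<^sub>R u x)" "integrable lebesgue (\<lambda>x. indicator D x *\<^sub>R g x)"
  using assms Wpair_finite[OF assms(1)] Wpair_measurable[OF assms(1)] lmeasurable_open
  by (blast intro: md_finite_integrable)+

lemma integrable_locally_integrable_on:
  assumes "integrable lebesgue (\<lambda>x. indicator D x *\<^sub>R u x)"
  shows "locally_integrable_on u D"
  unfolding locally_integrable_on_def
proof safe
  fix K assume K: "compact K" "K \<subseteq> D"
  have "set_integrable lebesgue D u" using assms by (simp add: set_integrable_def)
  then show "u absolutely_integrable_on K"
    by (rule set_integrable_subset) (use K in \<open>auto simp: borel_compact\<close>)
qed

text \<open>On a bounded set modular convergence implies convergence in L^1, and a test function and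
  its gradient are bounded; so integration by parts passes from the approximating functions to the
  limit.\<close>

lemma Wpair_has_weak_grad:
  fixes D :: "'a::euclidean_space set"
  assumes u: "Wpair D u g" and D: "bounded D" "open D"
  shows "has_weak_grad D u g"
  unfolding has_weak_grad_iff[OF D(2)]
proof (intro conjI ballI)
  have Dm: "D \<in> lmeasurable" using D by (rule lmeasurable_open)
  show li: "locally_integrable_on u D" "locally_integrable_on g D"
    using Wpair_integrable[OF u D] by (auto intro: integrable_locally_integrable_on)
  fix w b assume w: "w \<in> test_functions D" and b: "b \<in> (Basis :: 'a set)"
  obtain C where C: "C \<subseteq> D" "\<And>x. x \<notin> C \<Longrightarrow> w x = 0" "\<And>x. x \<notin> C \<Longrightarrow> grad w x = 0"
    using test_functionE[OF w] by metis
  obtain B where B: "B > 0" "\<And>x. norm (w x) \<le> B" "\<And>x. norm (grad w x) \<le> B"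
    using test_function_bounded[OF w] by metis
  have q1: "\<bar>grad w x \<bullet> b\<bar> \<le> B * indicator D x" for x
  proof (cases "x \<in> D")
    case True
    then show ?thesis using Cauchy_Schwarz_ineq2[of "grad w x" b] B(3)[of x] b by simp
  next
    case False
    then have "x \<notin> C" using C(1) by blast
    then show ?thesis using C(2,3)[of x] False by simp
  qed
  have q2: "\<bar>w x\<bar> \<le> B * indicator D x" for x
  proof (cases "x \<in> D")
    case True
    then show ?thesis using B(2)[of x] by simp
  next
    case False
    then have "x \<notin> C" using C(1) by blast
    then show ?thesis using C(2,3)[of x] False by simp
  qed
  note [measurable] = test_function_lebesgue[OF w] Wpair_measurable[OF u]
  let ?P = "\<integral>x. (grad w x \<bullet> b) * u x \<partial>lebesgue" and ?Q = "\<integral>x. w x * (g x \<bullet> b) \<partial>lebesgue"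
  have small: "\<bar>?P + ?Q\<bar> \<le> e" if "e > 0" for e
  proof -
    define e' where "e' = e / (2 * B)"
    have e': "e' > 0" "B * e' + B * e' = e" using B(1) \<open>e > 0\<close> by (auto simp: e'_def)
    obtain d1 where d1: "d1 > 0" "\<forall>g :: 'a \<Rightarrow> real. g \<in> borel_measurable lebesgue \<longrightarrow>
      md g \<le> ennreal d1 \<longrightarrow> (\<integral>\<^sup>+x. ennreal (norm (g x)) * indicator D x \<partial>lebesgue) \<le> ennreal e'"
      using md_small_L1[OF Dm e'(1), where 'b = real] by auto
    obtain d2 where d2: "d2 > 0" "\<forall>g :: 'a \<Rightarrow> 'a. g \<in> borel_measurable lebesgue \<longrightarrow>
      md g \<le> ennreal d2 \<longrightarrow> (\<integral>\<^sup>+x. ennreal (norm (g x)) * indicator D x \<partial>lebesgue) \<le> ennreal e'"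
      using md_small_L1[OF Dm e'(1), where 'b = 'a] by auto
    have "min d1 d2 > 0" using d1 d2 by simp
    from Wpair_approx[OF u this] obtain \<psi> where \<psi>: "\<psi> \<in> test_functions D"
      "md (\<lambda>x. u x - \<psi> x) \<le> ennreal (min d1 d2)" "md (\<lambda>x. g x - grad \<psi> x) \<le> ennreal (min d1 d2)"
      by metis
    note [measurable] = test_function_lebesgue[OF \<psi>(1)]
    have m1: "md (\<lambda>x. u x - \<psi> x) \<le> ennreal d1" "md (\<lambda>x. g x - grad \<psi> x) \<le> ennreal d2"
      using order_trans[OF \<psi>(2) ennreal_leI] order_trans[OF \<psi>(3) ennreal_leI] by auto
    have 1: "(\<integral>\<^sup>+x. ennreal (norm (u x - \<psi> x)) * indicator D x \<partial>lebesgue) \<le> ennreal e'"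
      using d1(2) m1(1) by simp
    have 2: "(\<integral>\<^sup>+x. ennreal (norm ((g x - grad \<psi> x) \<bullet> b)) * indicator D x \<partial>lebesgue) \<le> ennreal e'"
    proof -
      have "(\<integral>\<^sup>+x. ennreal (norm ((g x - grad \<psi> x) \<bullet> b)) * indicator D x \<partial>lebesgue)
        \<le> (\<integral>\<^sup>+x. ennreal (norm (g x - grad \<psi> x)) * indicator D x \<partial>lebesgue)"
        using b Cauchy_Schwarz_ineq2[of _ b] by (intro nn_integral_mono mult_right_mono ennreal_leI) (simp_all add: Basis_le_norm)
      also have "\<dots> \<le> ennreal e'" using d2(2) m1(2) by simp
      finally show ?thesis .
    qed
    have D': "D \<in> sets lebesgue" using D by auto
    have P: "integrable lebesgue (\<lambda>x. (grad w x \<bullet> b) * (u x - \<psi> x))"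
      "\<bar>\<integral>x. (grad w x \<bullet> b) * (u x - \<psi> x) \<partial>lebesgue\<bar> \<le> B * e'"
      using bounded_pairing[OF _ _ q1 _ D' 1] B(1) e'(1) by auto
    have Q: "integrable lebesgue (\<lambda>x. w x * ((g x - grad \<psi> x) \<bullet> b))"
      "\<bar>\<integral>x. w x * ((g x - grad \<psi> x) \<bullet> b) \<partial>lebesgue\<bar> \<le> B * e'"
      using bounded_pairing[OF _ _ q2 _ D' 2] B(1) e'(1) by auto
    note wg = has_weak_grad_test[OF D(2) test_function_smooth[OF \<psi>(1)]]
    have l: "locally_integrable_on \<psi> D" "locally_integrable_on (grad \<psi>) D"
      using wg by (auto simp: has_weak_grad_def)
    have ibp: "(\<integral>x. (grad w x \<bullet> b) * \<psi> x \<partial>lebesgue) = - (\<integral>x. w x * (grad \<psi> x \<bullet> b) \<partial>lebesgue)"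
      using wg[unfolded has_weak_grad_iff[OF D(2)]] w b by simp
    have "?P = (\<integral>x. (grad w x \<bullet> b) * (u x - \<psi> x) + (grad w x \<bullet> b) * \<psi> x \<partial>lebesgue)"
      by (simp add: algebra_simps)
    also have "\<dots> = (\<integral>x. (grad w x \<bullet> b) * (u x - \<psi> x) \<partial>lebesgue) + (\<integral>x. (grad w x \<bullet> b) * \<psi> x \<partial>lebesgue)"
      by (rule Bochner_Integration.integral_add[OF P(1) locally_integrable_mult_test_real(2)[OF l(1) w]])
    finally have 3: "?P = (\<integral>x. (grad w x \<bullet> b) * (u x - \<psi> x) \<partial>lebesgue) + (\<integral>x. (grad w x \<bullet> b) * \<psi> x \<partial>lebesgue)" .
    have "?Q = (\<integral>x. w x * ((g x - grad \<psi> x) \<bullet> b) + w x * (grad \<psi> x \<bullet> b) \<partial>lebesgue)"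
      by (simp add: algebra_simps inner_diff_left)
    also have "\<dots> = (\<integral>x. w x * ((g x - grad \<psi> x) \<bullet> b) \<partial>lebesgue) + (\<integral>x. w x * (grad \<psi> x \<bullet> b) \<partial>lebesgue)"
      by (rule Bochner_Integration.integral_add[OF Q(1) locally_integrable_mult_test_real(1)[OF locally_integrable_inner[OF l(2)] w]])
    finally have 4: "?Q = (\<integral>x. w x * ((g x - grad \<psi> x) \<bullet> b) \<partial>lebesgue) + (\<integral>x. w x * (grad \<psi> x \<bullet> b) \<partial>lebesgue)" .
    show ?thesis using 3 4 ibp P(2) Q(2) e'(2) by linarith
  qed
  have "?P + ?Q = 0"
  proof (rule ccontr)
    assume "?P + ?Q \<noteq> 0"
    then show False using small[of "\<bar>?P + ?Q\<bar> / 2"] by simp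
  qed
  then show "(\<integral>x. (grad w x \<bullet> b) *\<^sub>R u x \<partial>lebesgue) = - (\<integral>x. w x *\<^sub>R (g x \<bullet> b) \<partial>lebesgue)"
    by simp
qed


section \<open>Comparison of the modular with the Luxemburg norm\<close>

lemma md_cong_norm:
  fixes g :: "'a::euclidean_space \<Rightarrow> 'b::euclidean_space" and h :: "'a \<Rightarrow> 'c::euclidean_space"
  shows "(\<And>x. norm (g x) = norm (h x)) \<Longrightarrow> md g = md h"
  by (simp add: md_def)

text \<open>Only the lengths are compared, so that one statement serves both for a function and for
  the length of a gradient, with v the zero extension of either.\<close>

lemma orlicz_modular_eq_md:
  fixes v :: "'a::euclidean_space \<Rightarrow> 'b::euclidean_space"
  assumes "open \<Omega>" "\<And>x. indicator \<Omega> x * \<bar>w x\<bar> = norm (v x)"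
  shows "orlicz_modular \<Phi> \<Omega> w = md v"
proof -
  have "orlicz_modular \<Phi> \<Omega> w = (\<integral>\<^sup>+x. ennreal (\<Phi> \<bar>w x\<bar>) * indicator \<Omega> x \<partial>lebesgue)"
    unfolding orlicz_modular_def using assms(1) by (intro nn_integral_restrict_space) auto
  also have "\<dots> = md v"
    unfolding md_def assms(2)[symmetric] by (intro nn_integral_cong) (auto simp: indicator_def)
  finally show ?thesis .
qed

lemma orlicz_modular_divide_eq_md:
  fixes v :: "'a::euclidean_space \<Rightarrow> 'b::euclidean_space"
  assumes "open \<Omega>" "\<And>x. indicator \<Omega> x * \<bar>w x\<bar> = norm (v x)" "l > 0"
  shows "orlicz_modular \<Phi> \<Omega> (\<lambda>x. w x / l) = md (\<lambda>x. v x /\<^sub>R l)"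
proof (rule orlicz_modular_eq_md[OF assms(1)])
  fix x
  have "indicator \<Omega> x * \<bar>w x / l\<bar> = (indicator \<Omega> x * \<bar>w x\<bar>) / l"
    using assms(3) by simp
  also have "\<dots> = norm (v x) / l" by (simp only: assms(2))
  also have "\<dots> = norm (v x /\<^sub>R l)" using assms(3) by (simp add: divide_inverse mult.commute)
  finally show "indicator \<Omega> x * \<bar>w x / l\<bar> = norm (v x /\<^sub>R l)" .
qed

text \<open>For l \<ge> 1 convexity gives a modular of v/l of at most md v / l, so any l above both
  1 and the modular will do. The infimum of an empty set of reals would say nothing.\<close>

lemma orlicz_norm_set_nonempty:
  fixes v :: "'a::euclidean_space \<Rightarrow> 'b::euclidean_space"
  assumes "open \<Omega>" "\<And>x. indicator \<Omega> x * \<bar>w x\<bar> = norm (v x)"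
    and v: "v \<in> borel_measurable lebesgue" "md v < \<infinity>"
  shows "{l. l > 0 \<and> orlicz_modular \<Phi> \<Omega> (\<lambda>x. w x / l) \<le> 1} \<noteq> {}"
proof -
  define l where "l = max 1 (enn2real (md v))"
  have l: "l \<ge> 1" "enn2real (md v) \<le> l" by (auto simp: l_def)
  have "orlicz_modular \<Phi> \<Omega> (\<lambda>x. w x / l) = md (\<lambda>x. v x /\<^sub>R l)"
    using l(1) by (intro orlicz_modular_divide_eq_md assms(1,2)) auto
  also have "\<dots> \<le> ennreal (1 / l) * md v" by (rule md_divide_le[OF v(1) l(1)])
  also have "md v = ennreal (enn2real (md v))" using v(2) by simp
  also have "ennreal (1 / l) * \<dots> \<le> ennreal (1 / l) * ennreal l"
    by (intro mult_left_mono ennreal_leI l) auto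
  also have "\<dots> = 1" using l(1) by (simp add: ennreal_mult[symmetric])
  finally show ?thesis using l(1) by (auto intro!: exI[of _ l])
qed

lemma orlicz_norm_nonneg:
  fixes v :: "'a::euclidean_space \<Rightarrow> 'b::euclidean_space"
  assumes "open \<Omega>" "\<And>x. indicator \<Omega> x * \<bar>w x\<bar> = norm (v x)"
    and v: "v \<in> borel_measurable lebesgue" "md v < \<infinity>"
  shows "orlicz_norm \<Phi> \<Omega> w \<ge> 0"
  unfolding orlicz_norm_def
  by (rule cInf_greatest[OF orlicz_norm_set_nonempty[OF assms]]) auto

text \<open>Some l < e has modular of v/l at most 1, and as l \<le> 1, convexity gives \<Phi>(|v|)
  \<le> l \<Phi>(|v|/l).\<close>

lemma md_le_of_orlicz_norm_less:
  fixes v :: "'a::euclidean_space \<Rightarrow> 'b::euclidean_space"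
  assumes "open \<Omega>" "\<And>x. indicator \<Omega> x * \<bar>w x\<bar> = norm (v x)"
    and v: "v \<in> borel_measurable lebesgue" "md v < \<infinity>"
    and e: "orlicz_norm \<Phi> \<Omega> w < e" "e \<le> 1"
  shows "md v \<le> ennreal e"
proof -
  obtain l where l: "l > 0" "orlicz_modular \<Phi> \<Omega> (\<lambda>x. w x / l) \<le> 1" "l < e"
    using cInf_lessD[OF orlicz_norm_set_nonempty[OF assms(1-4)], of e] e(1) by (auto simp: orlicz_norm_def)
  have l1: "md (\<lambda>x. v x /\<^sub>R l) \<le> 1"
    using l(2) orlicz_modular_divide_eq_md[OF assms(1,2) l(1)] by simp
  have "md v = md (\<lambda>x. (v x /\<^sub>R l) /\<^sub>R (1 / l))" using l(1) by simp
  also have "\<dots> \<le> ennreal (1 / (1 / l)) * md (\<lambda>x. v x /\<^sub>R l)"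
    using v(1) l e(2) by (intro md_divide_le) (auto simp: field_simps)
  also have "\<dots> \<le> ennreal l * 1" using l1 l(1) by (intro mult_mono) auto
  also have "\<dots> \<le> ennreal e" using l by (simp add: ennreal_leI)
  finally show ?thesis .
qed

text \<open>The converse direction, where Delta_2 is essential: dividing by e costs a constant
  factor, and \<delta> is its reciprocal. It depends neither on the set nor on the function.\<close>

lemma orlicz_norm_le_of_md_small:
  assumes "e > 0"
  shows "\<exists>\<delta>>0. \<forall>\<Omega> w. \<forall>v :: 'a::euclidean_space \<Rightarrow> 'b::euclidean_space. open \<Omega> \<longrightarrow>
    (\<forall>x. indicator \<Omega> x * \<bar>w x\<bar> = norm (v x)) \<longrightarrow> v \<in> borel_measurable lebesgue \<longrightarrow>
    md v \<le> ennreal \<delta> \<longrightarrow> orlicz_norm \<Phi> \<Omega> w \<le> e"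
proof -
  define K where "K = scalec (inverse e)"
  have K: "K > 0" unfolding K_def by (rule scalec_pos)
  show ?thesis
  proof (intro exI[of _ "1 / K"] conjI allI impI)
    fix \<Omega> w and v :: "'a \<Rightarrow> 'b"
    assume A: "open \<Omega>" "\<forall>x. indicator \<Omega> x * \<bar>w x\<bar> = norm (v x)" "v \<in> borel_measurable lebesgue"
      "md v \<le> ennreal (1 / K)"
    have "orlicz_modular \<Phi> \<Omega> (\<lambda>x. w x / e) = md (\<lambda>x. v x /\<^sub>R e)"
      using A assms by (intro orlicz_modular_divide_eq_md) auto
    also have "\<dots> \<le> ennreal K * md v" unfolding K_def using A(3) by (rule md_scale)
    also have "\<dots> \<le> ennreal K * ennreal (1 / K)" by (intro mult_left_mono A) auto
    also have "\<dots> = 1" using K by (simp add: ennreal_mult[symmetric])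
    finally show "orlicz_norm \<Phi> \<Omega> w \<le> e"
      unfolding orlicz_norm_def using assms by (intro cInf_lower bdd_belowI[of _ 0]) auto
  qed (use K in auto)
qed

lemma weak_grad_has_weak_grad:
  "has_weak_grad \<Omega> u g \<Longrightarrow> has_weak_grad \<Omega> u (weak_grad \<Omega> u)"
  unfolding weak_grad_def by (rule someI[of "has_weak_grad \<Omega> u"])

lemma weak_grad_measurable:
  assumes "open \<Omega>" "has_weak_grad \<Omega> u g"
  shows "(\<lambda>x. indicator \<Omega> x *\<^sub>R weak_grad \<Omega> u x) \<in> borel_measurable lebesgue"
  using locally_integrable_measurable[OF _ assms(1)] weak_grad_has_weak_grad[OF assms(2)]
  by (auto simp: has_weak_grad_def)

lemma measurable_lebesgue_on_iff:
  fixes f :: "'a::euclidean_space \<Rightarrow> 'b::euclidean_space"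
  assumes "open \<Omega>"
  shows "f \<in> borel_measurable (lebesgue_on \<Omega>) \<longleftrightarrow> (\<lambda>x. indicator \<Omega> x *\<^sub>R f x) \<in> borel_measurable lebesgue"
  using assms by (intro borel_measurable_restrict_space_iff) auto

lemma Wpair_weak_grad_AE:
  assumes "Wpair D u g" "bounded D" "open D"
  shows "AE x in lebesgue. x \<in> D \<longrightarrow> weak_grad D u x = g x"
  by (rule weak_grad_unique[OF assms(3) Wpair_has_weak_grad[OF assms]])

lemma Wpair_weak_grad_md:
  fixes D :: "'a::euclidean_space set"
  assumes "Wpair D u g" "bounded D" "open D"
  shows "md (\<lambda>x. indicator D x *\<^sub>R weak_grad D u x) \<le> md g"
  using Wpair_weak_grad_AE[OF assms]
  by (intro md_mono_AE) (auto simp: indicator_def elim!: eventually_mono)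

lemma Wpair_sobolev:
  fixes D :: "'a::euclidean_space set"
  assumes u: "Wpair D u g" "bounded D" "open D"
  shows "u \<in> sobolev \<Phi> D"
proof -
  have m: "u \<in> borel_measurable (lebesgue_on D)"
    using Wpair_measurable(1)[OF u(1)] by (rule measurable_restrict_space1)
  have "orlicz_modular \<Phi> D u = md (\<lambda>x. indicator D x *\<^sub>R u x)"
    by (rule orlicz_modular_eq_md[OF u(3)]) (simp add: abs_mult)
  also have "\<dots> \<le> md u" by (rule md_mono) (simp add: indicator_def)
  also have "\<dots> < \<infinity>" by (rule Wpair_finite[OF u(1)])
  finally have 1: "orlicz_modular \<Phi> D u < \<infinity>" .
  have "orlicz_modular \<Phi> D (\<lambda>x. norm (weak_grad D u x)) = md (\<lambda>x. indicator D x *\<^sub>R weak_grad D u x)"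
    by (rule orlicz_modular_eq_md[OF u(3)]) simp
  also have "\<dots> \<le> md g" by (rule Wpair_weak_grad_md[OF u])
  also have "\<dots> < \<infinity>" by (rule Wpair_finite[OF u(1)])
  finally have 2: "orlicz_modular \<Phi> D (\<lambda>x. norm (weak_grad D u x)) < \<infinity>" .
  have "weak_grad D u \<in> borel_measurable (lebesgue_on D)"
    unfolding measurable_lebesgue_on_iff[OF u(3)]
    by (rule weak_grad_measurable[OF u(3) Wpair_has_weak_grad[OF u]])
  then have 3: "(\<lambda>x. norm (weak_grad D u x)) \<in> borel_measurable (lebesgue_on D)" by measurable
  show ?thesis
    using m 1 2 3 Wpair_has_weak_grad[OF u] by (auto simp: sobolev_def orlicz_space_def)
qed

text \<open>Nonnegativity is part of the conclusion because the norm is a bare infimum; it is needed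
  to read the upper bound as a bound of the absolute value.\<close>

lemma sobolev_norm_small:
  assumes "e > 0"
  shows "\<exists>\<delta>>0. \<forall>(D :: 'a::euclidean_space set) u g. Wpair D u g \<longrightarrow> bounded D \<longrightarrow> open D \<longrightarrow>
    md u \<le> ennreal \<delta> \<longrightarrow> md g \<le> ennreal \<delta> \<longrightarrow> 0 \<le> sobolev_norm \<Phi> D u \<and> sobolev_norm \<Phi> D u \<le> e"
proof -
  have e: "e / 2 > 0" using assms by simp
  obtain d1 where d1: "d1 > 0" "\<forall>\<Omega> w. \<forall>v :: 'a \<Rightarrow> real. open \<Omega> \<longrightarrow>
    (\<forall>x. indicator \<Omega> x * \<bar>w x\<bar> = norm (v x)) \<longrightarrow> v \<in> borel_measurable lebesgue \<longrightarrow>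
    md v \<le> ennreal d1 \<longrightarrow> orlicz_norm \<Phi> \<Omega> w \<le> e / 2"
    using orlicz_norm_le_of_md_small[OF e, where 'a = 'a and 'b = real] by auto
  obtain d2 where d2: "d2 > 0" "\<forall>\<Omega> w. \<forall>v :: 'a \<Rightarrow> 'a. open \<Omega> \<longrightarrow>
    (\<forall>x. indicator \<Omega> x * \<bar>w x\<bar> = norm (v x)) \<longrightarrow> v \<in> borel_measurable lebesgue \<longrightarrow>
    md v \<le> ennreal d2 \<longrightarrow> orlicz_norm \<Phi> \<Omega> w \<le> e / 2"
    using orlicz_norm_le_of_md_small[OF e, where 'a = 'a and 'b = 'a] by auto
  show ?thesis
  proof (intro exI[of _ "min d1 d2"] conjI allI impI)
    show "min d1 d2 > 0" using d1 d2 by simp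
    fix D :: "'a set" and u g
    assume u: "Wpair D u g" "bounded D" "open D" and md: "md u \<le> ennreal (min d1 d2)" "md g \<le> ennreal (min d1 d2)"
    let ?u = "\<lambda>x. indicator D x *\<^sub>R u x" and ?G = "\<lambda>x. indicator D x *\<^sub>R weak_grad D u x"
    have mu: "?u \<in> borel_measurable lebesgue"
      using u(3) Wpair_measurable(1)[OF u(1)] by (intro borel_measurable_scaleR borel_measurable_indicator) auto
    have mG: "?G \<in> borel_measurable lebesgue"
      by (rule weak_grad_measurable[OF u(3) Wpair_has_weak_grad[OF u]])
    have u_le: "md ?u \<le> md u" by (rule md_mono) (simp add: indicator_def)
    have G_le: "md ?G \<le> md g" by (rule Wpair_weak_grad_md[OF u])
    have eq: "indicator D x * \<bar>u x\<bar> = norm (?u x)" "indicator D x * \<bar>norm (weak_grad D u x)\<bar> = norm (?G x)" for x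
      by (simp_all add: abs_mult)
    have "orlicz_norm \<Phi> D u \<ge> 0"
      using le_less_trans[OF u_le Wpair_finite(1)[OF u(1)]] by (intro orlicz_norm_nonneg[OF u(3) eq(1) mu])
    moreover have "orlicz_norm \<Phi> D (\<lambda>x. norm (weak_grad D u x)) \<ge> 0"
      using le_less_trans[OF G_le Wpair_finite(2)[OF u(1)]] by (intro orlicz_norm_nonneg[OF u(3) eq(2) mG])
    ultimately show "0 \<le> sobolev_norm \<Phi> D u" by (simp add: sobolev_norm_def)
    have "md ?u \<le> ennreal d1" using order_trans[OF u_le order_trans[OF md(1) ennreal_leI]] by simp
    then have "orlicz_norm \<Phi> D u \<le> e / 2" using d1(2)[rule_format, OF u(3) eq(1) mu] by blast
    moreover have "md ?G \<le> ennreal d2" using order_trans[OF G_le order_trans[OF md(2) ennreal_leI]] by simp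
    then have "orlicz_norm \<Phi> D (\<lambda>x. norm (weak_grad D u x)) \<le> e / 2"
      using d2(2)[rule_format, OF u(3) eq(2) mG] by blast
    ultimately show "sobolev_norm \<Phi> D u \<le> e" by (simp add: sobolev_norm_def)
  qed
qed

lemma Wpair_diff_test:
  assumes "Wpair D u g" "\<psi> \<in> test_functions D"
  shows "Wpair D (\<lambda>x. u x - \<psi> x) (\<lambda>x. g x - grad \<psi> x)"
  using Wpair_add[OF assms(1) Wpair_test[OF assms(2)], of "-1"] by simp

lemma Wpair_sobolev0:
  fixes D :: "'a::euclidean_space set"
  assumes u: "Wpair D u g" "bounded D" "open D"
  shows "u \<in> sobolev0 \<Phi> D"
  unfolding sobolev0_def
proof (intro CollectI conjI allI impI)
  show "u \<in> sobolev \<Phi> D" by (rule Wpair_sobolev[OF u])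
  fix e :: real assume "e > 0"
  then have "e / 2 > 0" by simp
  from sobolev_norm_small[OF this, where 'a = 'a]
  obtain \<delta> where \<delta>: "\<delta> > 0" "\<forall>(D :: 'a set) u g. Wpair D u g \<longrightarrow> bounded D \<longrightarrow> open D \<longrightarrow>
    md u \<le> ennreal \<delta> \<longrightarrow> md g \<le> ennreal \<delta> \<longrightarrow> 0 \<le> sobolev_norm \<Phi> D u \<and> sobolev_norm \<Phi> D u \<le> e / 2"
    by auto
  obtain \<psi> where \<psi>: "\<psi> \<in> test_functions D" "md (\<lambda>x. u x - \<psi> x) \<le> ennreal \<delta>" "md (\<lambda>x. g x - grad \<psi> x) \<le> ennreal \<delta>"
    using Wpair_approx[OF u(1) \<delta>(1)] by metis
  have "sobolev_norm \<Phi> D (\<lambda>x. u x - \<psi> x) \<le> e / 2"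
    using \<delta>(2)[rule_format, OF Wpair_diff_test[OF u(1) \<psi>(1)] u(2,3) \<psi>(2,3)] by blast
  then show "\<exists>\<psi>\<in>test_functions D. sobolev_norm \<Phi> D (\<lambda>x. u x - \<psi> x) < e"
    using \<psi>(1) \<open>e > 0\<close> by (intro bexI[of _ \<psi>]) auto
qed

text \<open>With \<open>Wpair_sobolev0\<close> this is the bridge between norm closure and modular
  closure. The chosen gradient of u - \<psi> agrees with the difference of the gradients only almost
  everywhere, which modulars do not notice.\<close>

lemma sobolev0_Wpair:
  fixes \<Omega> :: "'a::euclidean_space set"
  assumes u: "u \<in> sobolev0 \<Phi> \<Omega>" and \<Omega>: "open \<Omega>"
  shows "Wpair \<Omega> (zero_ext \<Omega> u) (\<lambda>x. indicator \<Omega> x *\<^sub>R weak_grad \<Omega> u x)"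
  unfolding Wpair_def
proof (intro conjI allI impI)
  let ?U = "zero_ext \<Omega> u" and ?G = "\<lambda>x. indicator \<Omega> x *\<^sub>R weak_grad \<Omega> u x"
  have s: "u \<in> sobolev \<Phi> \<Omega>" using u by (simp add: sobolev0_def)
  then obtain g where hw: "has_weak_grad \<Omega> u g" by (auto simp: sobolev_def)
  have U: "?U = (\<lambda>x. indicator \<Omega> x *\<^sub>R u x)" by (auto simp: zero_ext_def indicator_def)
  have fin: "orlicz_modular \<Phi> \<Omega> u < \<infinity>" "orlicz_modular \<Phi> \<Omega> (\<lambda>x. norm (weak_grad \<Omega> u x)) < \<infinity>"
    and mu: "u \<in> borel_measurable (lebesgue_on \<Omega>)"
    using s by (auto simp: sobolev_def orlicz_space_def)
  show mU: "?U \<in> borel_measurable lebesgue"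
    using mu unfolding measurable_lebesgue_on_iff[OF \<Omega>] U .
  show mG: "?G \<in> borel_measurable lebesgue" by (rule weak_grad_measurable[OF \<Omega> hw])
  have "orlicz_modular \<Phi> \<Omega> u = md ?U"
    by (rule orlicz_modular_eq_md[OF \<Omega>]) (simp add: zero_ext_def)
  then have fU: "md ?U < \<infinity>" using fin(1) by simp
  have "orlicz_modular \<Phi> \<Omega> (\<lambda>x. norm (weak_grad \<Omega> u x)) = md ?G"
    by (rule orlicz_modular_eq_md[OF \<Omega>]) simp
  then have fG: "md ?G < \<infinity>" using fin(2) by simp
  fix e :: real assume "e > 0"
  \<comment> \<open>\<open>md_le_of_orlicz_norm_less\<close> works for bounds up to 1 only.\<close>
  define e' where "e' = min e 1"
  have e': "e' > 0" "e' \<le> 1" "e' \<le> e" using \<open>e > 0\<close> by (auto simp: e'_def)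
  obtain \<psi> where \<psi>: "\<psi> \<in> test_functions \<Omega>" and n: "sobolev_norm \<Phi> \<Omega> (\<lambda>x. u x - \<psi> x) < e'"
    using u e'(1) by (auto simp: sobolev0_def)
  obtain C where C: "C \<subseteq> \<Omega>" "\<And>x. x \<notin> C \<Longrightarrow> \<psi> x = 0" "\<And>x. x \<notin> C \<Longrightarrow> grad \<psi> x = 0"
    using test_functionE[OF \<psi>] by metis
  have z: "\<psi> x = 0" "grad \<psi> x = 0" if "x \<notin> \<Omega>" for x
    using C(1) C(2,3)[of x] that by blast+
  note m\<psi> = test_function_lebesgue[OF \<psi>]
  let ?d = "\<lambda>x. ?U x - \<psi> x" and ?V = "\<lambda>x. indicator \<Omega> x *\<^sub>R weak_grad \<Omega> (\<lambda>x. u x - \<psi> x) x"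
  have hd: "has_weak_grad \<Omega> (\<lambda>x. u x - \<psi> x) (\<lambda>x. weak_grad \<Omega> u x - grad \<psi> x)"
    using has_weak_grad_add[OF \<Omega> weak_grad_has_weak_grad[OF hw] has_weak_grad_test[OF \<Omega> test_function_smooth[OF \<psi>]], of "-1"]
    by simp
  have V_AE: "AE x in lebesgue. ?V x = ?G x - grad \<psi> x"
    using weak_grad_unique[OF \<Omega> hd] z(2) by (auto simp: indicator_def elim!: eventually_mono)
  have md: "?d \<in> borel_measurable lebesgue" using mU m\<psi>(1) by (rule borel_measurable_diff)
  have mV: "?V \<in> borel_measurable lebesgue" by (rule weak_grad_measurable[OF \<Omega> hd])
  have fd: "md ?d < \<infinity>"
    using md_lincomb_finite[OF mU m\<psi>(1) fU md_test_finite(1)[OF \<psi>], of "-1"] by simp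
  have "md (\<lambda>x. ?G x + (-1) *\<^sub>R grad \<psi> x) < \<infinity>"
    by (rule md_lincomb_finite[OF mG m\<psi>(2) fG md_test_finite(2)[OF \<psi>]])
  then have fV: "md ?V < \<infinity>" using md_cong_AE[OF V_AE] by simp
  have eq1: "indicator \<Omega> x * \<bar>u x - \<psi> x\<bar> = norm (?d x)" for x
    using z(1)[of x] by (simp add: zero_ext_def)
  have eq2: "indicator \<Omega> x * \<bar>norm (weak_grad \<Omega> (\<lambda>x. u x - \<psi> x) x)\<bar> = norm (?V x)" for x by simp
  have n1: "orlicz_norm \<Phi> \<Omega> (\<lambda>x. u x - \<psi> x) \<ge> 0" by (rule orlicz_norm_nonneg[OF \<Omega> eq1 md fd])
  have n2: "orlicz_norm \<Phi> \<Omega> (\<lambda>x. norm (weak_grad \<Omega> (\<lambda>x. u x - \<psi> x) x)) \<ge> 0"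
    by (rule orlicz_norm_nonneg[OF \<Omega> eq2 mV fV])
  have "orlicz_norm \<Phi> \<Omega> (\<lambda>x. u x - \<psi> x) < e'" using n n2 by (simp add: sobolev_norm_def)
  then have "md ?d \<le> ennreal e'" by (rule md_le_of_orlicz_norm_less[OF \<Omega> eq1 md fd _ e'(2)])
  moreover have "orlicz_norm \<Phi> \<Omega> (\<lambda>x. norm (weak_grad \<Omega> (\<lambda>x. u x - \<psi> x) x)) < e'"
    using n n1 by (simp add: sobolev_norm_def)
  then have "md ?V \<le> ennreal e'" by (rule md_le_of_orlicz_norm_less[OF \<Omega> eq2 mV fV _ e'(2)])
  then have "md (\<lambda>x. ?G x - grad \<psi> x) \<le> ennreal e'" using md_cong_AE[OF V_AE] by simp
  ultimately show "\<exists>\<psi>\<in>test_functions \<Omega>. md (\<lambda>x. ?U x - \<psi> x) \<le> ennreal e \<and> md (\<lambda>x. ?G x - grad \<psi> x) \<le> ennreal e"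
    using \<psi> ennreal_leI[OF e'(3)] by (intro bexI[of _ \<psi>]) (auto intro: order_trans)
qed

end


section \<open>Mollification\<close>

lemma integrable_continuous_support:
  fixes F :: "'a::euclidean_space \<Rightarrow> 'b::euclidean_space"
  assumes "continuous_on UNIV F" "compact S" "\<And>y. y \<notin> S \<Longrightarrow> F y = 0"
  shows "integrable lborel F"
proof -
  have "integrable lborel (\<lambda>x. indicator S x *\<^sub>R F x)"
    using assms(1) by (intro borel_integrable_compact assms(2)) (rule continuous_on_subset, auto)
  moreover have "(\<lambda>x. indicator S x *\<^sub>R F x) = F"
    using assms(3) by (auto simp: indicator_def fun_eq_iff)
  ultimately show ?thesis by simp
qed

lemma integral_continuous_support:
  fixes F :: "'a::euclidean_space \<Rightarrow> 'b::euclidean_space"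
  assumes "continuous_on UNIV F" "compact S" "\<And>y. y \<notin> S \<Longrightarrow> F y = 0" "S \<subseteq> cbox a b"
  shows "integral (cbox a b) F = (\<integral>y. F y \<partial>lborel)"
proof -
  have "(\<integral>y. F y \<partial>lborel) = integral UNIV F"
    using integral_lborel[OF integrable_continuous_support[OF assms(1-3)]] by simp
  also have "\<dots> = integral (cbox a b) F"
  proof -
    have "(\<lambda>y. if y \<in> cbox a b then F y else 0) = F"
      using assms(3,4) by (auto simp: fun_eq_iff)
    then show ?thesis
      using Henstock_Kurzweil_Integration.integral_restrict_UNIV[of "cbox a b" F] by simp
  qed
  finally show ?thesis by simp
qed

lemma convolution_has_derivative:
  fixes e \<rho> :: "'a::euclidean_space \<Rightarrow> real"
  assumes e: "continuous_on UNIV e" and \<rho>: "smooth \<rho>"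
  shows "((\<lambda>x. integral (cbox a b) (\<lambda>y. e y * \<rho> (x - y))) has_derivative
    (\<lambda>h. integral (cbox a b) (\<lambda>y. e y * (grad \<rho> (x - y) \<bullet> h)))) (at x)"
proof -
  \<comment> \<open>\<open>leibniz_rule\<close> wants the derivative as a bounded linear map that
    depends continuously on both variables.\<close>
  define fx where "fx x y = e y *\<^sub>R blinfun_inner_left (grad \<rho> (x - y))" for x y
  have c\<rho>: "continuous_on UNIV \<rho>" "continuous_on UNIV (grad \<rho>)"
    using \<rho> by (auto intro: smooth_continuous smooth_continuous_grad)
  have cfx: "continuous_on UNIV (\<lambda>p. fx (fst p) (snd p))"
    unfolding fx_def
    by (intro continuous_on_scaleR continuous_on_compose2[OF e] bounded_linear.continuous_on[OF bounded_linear_blinfun_inner_left]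
        continuous_on_compose2[OF c\<rho>(2)] continuous_intros) auto
  have cx: "continuous_on (cbox a b) (fx x)" for x
    using continuous_on_compose2[OF cfx, of "cbox a b" "\<lambda>y. (x, y)"] by (simp add: continuous_on_Pair)
  have "((\<lambda>x. integral (cbox a b) (\<lambda>y. e y * \<rho> (x - y))) has_derivative integral (cbox a b) (fx x)) (at x within UNIV)"
  proof (rule leibniz_rule)
    show "((\<lambda>x. e y * \<rho> (x - y)) has_derivative blinfun_apply (fx x y)) (at x within UNIV)" for x y
    proof -
      have "((\<lambda>x. \<rho> (x - y)) has_derivative (\<lambda>h. grad \<rho> (x - y) \<bullet> h)) (at x)"
        by (rule has_derivative_compose[of "\<lambda>x. x - y" "\<lambda>h. h" x UNIV \<rho>, OF _ smooth_has_derivative[OF \<rho>]])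
          (auto intro!: derivative_eq_intros)
      from has_derivative_mult_right[OF this, of "e y"] show ?thesis
        by (rule has_derivative_eq_rhs) (simp add: fx_def fun_eq_iff scaleR_blinfun.rep_eq inner_commute)
    qed
    show "(\<lambda>y. e y * \<rho> (x - y)) integrable_on cbox a b" for x
      by (intro integrable_continuous continuous_intros continuous_on_subset[OF e] continuous_on_compose2[OF c\<rho>(1)]) auto
    show "continuous_on (UNIV \<times> cbox a b) (\<lambda>(x, y). fx x y)"
      using continuous_on_subset[OF cfx, of "UNIV \<times> cbox a b"] by (simp add: split_beta)
  qed auto
  moreover have "blinfun_apply (integral (cbox a b) (fx x)) = (\<lambda>h. integral (cbox a b) (\<lambda>y. e y * (grad \<rho> (x - y) \<bullet> h)))"
  proof
    fix h
    have "(fx x has_integral integral (cbox a b) (fx x)) (cbox a b)"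
      using cx by (intro integrable_integral integrable_continuous)
    from has_integral_linear[OF this bounded_bilinear.bounded_linear_left[OF bounded_bilinear_blinfun_apply], of h]
    show "blinfun_apply (integral (cbox a b) (fx x)) h = integral (cbox a b) (\<lambda>y. e y * (grad \<rho> (x - y) \<bullet> h))"
      by (intro integral_unique[symmetric]) (simp add: o_def fx_def scaleR_blinfun.rep_eq inner_commute)
  qed
  ultimately show ?thesis by simp
qed

text \<open>Every derivative falls on \<rho> and leaves a convolution of the same kind, so e need
  only be continuous.\<close>

lemma C_k_convolution:
  fixes e \<rho> :: "'a::euclidean_space \<Rightarrow> real"
  assumes e: "continuous_on UNIV e"
  shows "smooth \<rho> \<Longrightarrow> C_k k (\<lambda>x. integral (cbox a b) (\<lambda>y. e y * \<rho> (x - y)))"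
proof (induction k arbitrary: \<rho>)
  case 0
  have "(\<lambda>x. integral (cbox a b) (\<lambda>y. e y * \<rho> (x - y))) differentiable (at x)" for x
    using convolution_has_derivative[OF e 0] by (auto simp: differentiable_def)
  then show ?case
    by (auto intro!: differentiable_imp_continuous_on simp: differentiable_on_def)
next
  case (Suc k)
  show ?case
  proof (rule C_k_SucI[OF convolution_has_derivative[OF e Suc.prems]])
    fix c :: 'a assume "c \<in> Basis"
    have "(\<lambda>x. grad \<rho> x \<bullet> c) = (\<lambda>x. frechet_derivative \<rho> (at x) c)"
      using frechet_eq_grad[OF Suc.prems] by auto
    then have "smooth (\<lambda>x. grad \<rho> x \<bullet> c)" using smooth_partial[OF Suc.prems \<open>c \<in> Basis\<close>] by simp
    from Suc.IH[OF this] show "C_k k (\<lambda>x. integral (cbox a b) (\<lambda>y. e y * (grad \<rho> (x - y) \<bullet> c)))" .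
  qed
qed

lemma compact_open_margin:
  fixes S :: "'a::euclidean_space set"
  assumes "compact S" "open D" "S \<subseteq> D"
  obtains d where "d > 0" "\<And>y. y \<in> S \<Longrightarrow> cball y d \<subseteq> D"
proof (cases "S = {}")
  case True
  then show ?thesis using that[of 1] by simp
next
  case False
  obtain d where d: "d > 0" "{x. infdist x S \<le> d} \<subseteq> D"
    by (rule compact_in_open_separated[OF False assms])
  have "cball y d \<subseteq> D" if "y \<in> S" for y
  proof
    fix z assume "z \<in> cball y d"
    then have "infdist z S \<le> d"
      using infdist_le2[OF that, of z d] by (simp add: dist_commute)
    then show "z \<in> D" using d(2) by blast
  qed
  then show ?thesis using that d(1) by blast
qed

text \<open>A normalized bump. The kernel is a probability density in each variable: Jensen's
  inequality integrates over y, and Fubini over x. The two are equivalent since the bump is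
  radial.\<close>

lemma mollifier_exists:
  assumes "\<delta> > 0"
  obtains \<rho> :: "'a::euclidean_space \<Rightarrow> real" where "\<rho> \<in> test_functions (cball 0 \<delta>)" "\<And>z. \<rho> z \<ge> 0"
    "\<And>x. (\<integral>\<^sup>+y. ennreal (\<rho> (x - y)) \<partial>lborel) = 1" "\<And>y. (\<integral>\<^sup>+x. ennreal (\<rho> (x - y)) \<partial>lborel) = 1"
proof -
  let ?b = "bump (0::'a) \<delta>"
  have bt: "?b \<in> test_functions (cball 0 \<delta>)" using assms by (rule test_function_bump) simp
  obtain C where C: "compact C" "\<And>x. x \<notin> C \<Longrightarrow> ?b x = 0"
    using test_functionE[OF bt] by metis
  have cb: "continuous_on UNIV ?b" by (rule smooth_continuous[OF smooth_bump])
  have ib: "integrable lborel ?b" by (rule integrable_continuous_support[OF cb C])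
  define I where "I = (\<integral>x. ?b x \<partial>lborel)"
  have "I \<noteq> 0"
  proof
    assume "I = 0"
    then have "AE x in lborel. ?b x = 0"
      using integral_nonneg_eq_0_iff_AE[OF ib] bump_nonneg[of "0::'a" \<delta>] by (simp add: I_def)
    then have "AE x in lborel. x \<notin> ball (0::'a) \<delta>"
      by (rule eventually_mono) (use bump_pos_iff[OF assms] in \<open>metis less_irrefl\<close>)
    then have "emeasure lborel (ball (0::'a) \<delta>) = 0"
      by (subst (asm) AE_iff_measurable[OF _ refl]) (auto simp: ball_def)
    moreover have "\<not> negligible (ball (0::'a) \<delta>)" using assms by (simp add: open_not_negligible)
    ultimately show False
      by (simp add: negligible_iff_null_sets null_sets_def)
  qed
  moreover have "I \<ge> 0" unfolding I_def by (rule Bochner_Integration.integral_nonneg) (rule bump_nonneg)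
  ultimately have I: "I > 0" by simp
  define \<rho> where "\<rho> z = ?b z / I" for z
  have \<rho>_eq: "\<rho> = (\<lambda>z. 0 + (1 / I) * ?b z)" by (simp add: \<rho>_def fun_eq_iff)
  have t: "\<rho> \<in> test_functions (cball 0 \<delta>)"
    unfolding \<rho>_eq by (rule test_function_add[OF test_function_zero bt])
  have nn: "\<rho> z \<ge> 0" for z using I bump_nonneg[of 0 \<delta> z] by (simp add: \<rho>_def)
  have sym: "\<rho> (x - y) = \<rho> (y - x)" for x y
    by (simp add: \<rho>_def bump_def dot_square_norm norm_minus_commute)
  have [measurable]: "\<rho> \<in> borel_measurable borel" by (rule test_function_borel[OF t])
  have one: "(\<integral>\<^sup>+z. ennreal (\<rho> z) \<partial>lborel) = 1"
  proof -
    have "integrable lborel \<rho>" unfolding \<rho>_def using ib by (rule integrable_divide)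
    then have "(\<integral>\<^sup>+z. ennreal (\<rho> z) \<partial>lborel) = ennreal (\<integral>z. \<rho> z \<partial>lborel)"
      using nn by (intro nn_integral_eq_integral) auto
    also have "(\<integral>z. \<rho> z \<partial>lborel) = 1" using I by (simp add: \<rho>_def I_def[symmetric])
    finally show ?thesis by simp
  qed
  have tr: "(\<integral>\<^sup>+x. ennreal (\<rho> (x - y)) \<partial>lborel) = 1" for y
  proof -
    have "(\<integral>\<^sup>+x. ennreal (\<rho> (- y + x)) \<partial>lborel) = (\<integral>\<^sup>+x. ennreal (\<rho> x) \<partial>lborel)"
      by (rule nn_integral_lborel_translate) measurable
    then show ?thesis using one by simp
  qed
  show ?thesis
  proof (rule that[OF t nn _ tr])
    show "(\<integral>\<^sup>+y. ennreal (\<rho> (x - y)) \<partial>lborel) = 1" for x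
      unfolding sym[of x] by (rule tr)
  qed
qed

context young
begin

text \<open>Mollifying does not increase the modular of the gradient, by Jensen's inequality.\<close>

lemma admissible_test_function:
  fixes D K :: "'a::euclidean_space set"
  assumes D: "open D" and K: "compact K" "K \<subseteq> D" and \<eta>: "\<eta> \<in> cap_admissible \<Phi> K D"
  shows "\<exists>w\<in>test_functions D. (\<forall>x\<in>K. w x > 1) \<and> (\<forall>x. w x \<ge> 0) \<and>
    md (grad w) \<le> orlicz_modular \<Phi> D (\<lambda>x. norm (weak_grad D \<eta> x))"
proof -
  define S where "S = closure (support_on D \<eta>)"
  have S: "compact S" "S \<subseteq> D" and c\<eta>: "continuous_on D \<eta>" and sob: "\<eta> \<in> sobolev \<Phi> D"
    and gt1: "\<And>x. x \<in> K \<Longrightarrow> \<eta> x > 1" and nn: "\<And>x. x \<in> D \<Longrightarrow> \<eta> x \<ge> 0"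
    using \<eta> by (auto simp: cap_admissible_def S_def)
  define e where "e = zero_ext D \<eta>"
  have eS: "e x = 0" if "x \<notin> S" for x
    using that closure_subset[of "support_on D \<eta>"] by (auto simp: e_def zero_ext_def S_def support_on_def)
  have eD: "e x = \<eta> x" if "x \<in> D" for x using that by (simp add: e_def zero_ext_def)
  have e0: "e x \<ge> 0" for x using nn by (simp add: e_def zero_ext_def)
  have ce: "continuous_on UNIV e"
  proof -
    have "continuous_on D e" using c\<eta> eD by (simp cong: continuous_on_cong)
    moreover have "continuous_on (- S) e"
      by (rule continuous_on_eq[OF continuous_on_const[of _ 0]]) (simp add: eS)
    ultimately have "continuous_on (D \<union> - S) e"
      using D S(1) by (intro continuous_on_open_Un) (auto simp: compact_imp_closed open_Compl)
    moreover have "D \<union> - S = UNIV" using S(2) by blast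
    ultimately show ?thesis by simp
  qed
  \<comment> \<open>Compactness of K leaves a margin above 1, and the strict bound by c persists on
    a neighbourhood of K, where the averages are taken.\<close>
  obtain c where c: "c > 1" "\<And>x. x \<in> K \<Longrightarrow> e x > c"
  proof (cases "K = {}")
    case True
    then show ?thesis using that[of 2] by simp
  next
    case False
    have "continuous_on K e" using ce by (rule continuous_on_subset) simp
    from continuous_attains_inf[OF K(1) False this]
    obtain x0 where x0: "x0 \<in> K" "\<And>x. x \<in> K \<Longrightarrow> e x0 \<le> e x" by blast
    have "e x0 > 1" using gt1[OF x0(1)] eD[of x0] K(2) x0(1) by auto
    show ?thesis
    proof (rule that)
      show "(1 + e x0) / 2 > 1" using \<open>e x0 > 1\<close> by simp
      show "e x > (1 + e x0) / 2" if "x \<in> K" for x using x0(2)[OF that] \<open>e x0 > 1\<close> by simp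
    qed
  qed
  have oV: "open {x. e x > c}" using ce by (intro open_Collect_less continuous_on_const)
  obtain d1 where d1: "d1 > 0" "\<And>y. y \<in> K \<Longrightarrow> cball y d1 \<subseteq> {x. e x > c}"
    by (rule compact_open_margin[OF K(1) oV]) (use c(2) in auto)
  obtain d2 where d2: "d2 > 0" "\<And>y. y \<in> S \<Longrightarrow> cball y d2 \<subseteq> D"
    using compact_open_margin[OF S(1) D S(2)] by metis
  \<comment> \<open>\<open>d1\<close> keeps the averages at points of K inside the set where e
    exceeds c. Half of \<open>d2\<close> ensures that a ball of radius \<delta> that meets S lies in
    D.\<close>
  define \<delta> where "\<delta> = min d1 (d2 / 2)"
  have \<delta>: "\<delta> > 0" "\<delta> \<le> d1" "2 * \<delta> \<le> d2" using d1(1) d2(1) by (auto simp: \<delta>_def)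
  obtain \<rho> :: "'a \<Rightarrow> real" where \<rho>: "\<rho> \<in> test_functions (cball 0 \<delta>)" "\<And>z. \<rho> z \<ge> 0"
    "\<And>x. (\<integral>\<^sup>+y. ennreal (\<rho> (x - y)) \<partial>lborel) = 1" "\<And>y. (\<integral>\<^sup>+x. ennreal (\<rho> (x - y)) \<partial>lborel) = 1"
    using mollifier_exists[OF \<delta>(1)] by metis
  obtain C\<rho> where C\<rho>: "C\<rho> \<subseteq> cball 0 \<delta>" "\<And>z. z \<notin> C\<rho> \<Longrightarrow> \<rho> z = 0" "\<And>z. z \<notin> C\<rho> \<Longrightarrow> grad \<rho> z = 0"
    using test_functionE[OF \<rho>(1)] by metis
  have \<rho>0: "\<rho> z = 0" "grad \<rho> z = 0" if "norm z > \<delta>" for z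
  proof -
    have "z \<notin> C\<rho>" using that C\<rho>(1) by auto
    then show "\<rho> z = 0" "grad \<rho> z = 0" using C\<rho>(2,3) by blast+
  qed
  have sm: "smooth \<rho>" by (rule test_function_smooth[OF \<rho>(1)])
  have c\<rho>: "continuous_on UNIV (\<lambda>y. \<rho> (x - y))" "continuous_on UNIV (\<lambda>y. grad \<rho> (x - y))" for x
    by (intro continuous_on_compose2[OF smooth_continuous[OF sm, of UNIV]]
        continuous_on_compose2[OF smooth_continuous_grad[OF sm, of UNIV]] continuous_intros; simp)+
  note [measurable] = test_function_borel[OF \<rho>(1)] borel_measurable_continuous_onI[OF ce]
  obtain a b where ab: "S \<subseteq> cbox a b"
    using bounded_subset_cbox_symmetric[OF compact_imp_bounded[OF S(1)]] by blast
  define w where "w x = integral (cbox a b) (\<lambda>y. e y * \<rho> (x - y))" for x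
  have smw: "smooth w"
    using C_k_convolution[OF ce sm] by (simp add: smooth_def w_def[abs_def])
  have w_eq: "w x = (\<integral>y. e y * \<rho> (x - y) \<partial>lborel)" and w_int: "integrable lborel (\<lambda>y. e y * \<rho> (x - y))" for x
  proof -
    have cont: "continuous_on UNIV (\<lambda>y. e y * \<rho> (x - y))" by (intro continuous_intros ce c\<rho>)
    have zero: "e y * \<rho> (x - y) = 0" if "y \<notin> S" for y using eS[OF that] by simp
    show "w x = (\<integral>y. e y * \<rho> (x - y) \<partial>lborel)"
      unfolding w_def by (rule integral_continuous_support[OF cont S(1) zero ab])
    show "integrable lborel (\<lambda>y. e y * \<rho> (x - y))"
      by (rule integrable_continuous_support[OF cont S(1) zero])
  qed
  have wgrad: "grad w x \<bullet> h = (\<integral>y. e y * (grad \<rho> (x - y) \<bullet> h) \<partial>lborel)" for x h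
  proof -
    have "(w has_derivative (\<lambda>h. integral (cbox a b) (\<lambda>y. e y * (grad \<rho> (x - y) \<bullet> h)))) (at x)"
      unfolding w_def by (rule convolution_has_derivative[OF ce sm])
    from has_derivative_unique[OF this smooth_has_derivative[OF smw]]
    have "grad w x \<bullet> h = integral (cbox a b) (\<lambda>y. e y * (grad \<rho> (x - y) \<bullet> h))" by metis
    also have "\<dots> = (\<integral>y. e y * (grad \<rho> (x - y) \<bullet> h) \<partial>lborel)"
      by (rule integral_continuous_support[OF _ S(1) _ ab]) (use eS in \<open>auto intro!: continuous_intros ce c\<rho>\<close>)
    finally show ?thesis .
  qed
  have int\<rho>: "integrable lborel (\<lambda>y. \<rho> (x - y))" "(\<integral>y. \<rho> (x - y) \<partial>lborel) = 1" for x
  proof -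
    show i: "integrable lborel (\<lambda>y. \<rho> (x - y))"
      by (rule integrableI_nonneg) (use \<rho>(2,3) in auto)
    have "ennreal (\<integral>y. \<rho> (x - y) \<partial>lborel) = 1"
      using nn_integral_eq_integral[OF i] \<rho>(2,3) by simp
    then show "(\<integral>y. \<rho> (x - y) \<partial>lborel) = 1" by simp
  qed
  have w0: "w x \<ge> 0" for x
    unfolding w_eq by (intro Bochner_Integration.integral_nonneg mult_nonneg_nonneg e0 \<rho>(2))
  have w1: "w x > 1" if "x \<in> K" for x
  proof -
    have "c = (\<integral>y. c * \<rho> (x - y) \<partial>lborel)" using int\<rho>[of x] by simp
    also have "\<dots> \<le> w x"
      unfolding w_eq
    proof (rule integral_mono)
      show "c * \<rho> (x - y) \<le> e y * \<rho> (x - y)" for y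
      proof (cases "norm (x - y) > \<delta>")
        case True
        then show ?thesis using \<rho>0 by simp
      next
        case False
        then have "y \<in> cball x d1" using \<delta>(2) by (simp add: dist_norm)
        then have "e y > c" using d1(2)[OF that] by blast
        then show ?thesis using \<rho>(2)[of "x - y"] by (simp add: mult_right_mono)
      qed
    qed (use int\<rho> w_int in auto)
    finally show ?thesis using c(1) by simp
  qed
  have wt: "w \<in> test_functions D"
  proof (rule test_functionI[OF smw])
    show "compact (\<Union>x\<in>S. \<Union>y\<in>cball 0 \<delta>. {x + y})" using S(1) by (intro compact_sums') auto
    show "(\<Union>x\<in>S. \<Union>y\<in>cball 0 \<delta>. {x + y}) \<subseteq> D"
    proof safe
      fix x y :: 'a assume "x \<in> S" "y \<in> cball 0 \<delta>"
      then have "x + y \<in> cball x d2" using \<delta> by (simp add: dist_norm)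
      then show "x + y \<in> D" using d2(2)[OF \<open>x \<in> S\<close>] by blast
    qed
    show "w x = 0" if "x \<notin> (\<Union>x\<in>S. \<Union>y\<in>cball 0 \<delta>. {x + y})" for x
    proof -
      have z: "e y * \<rho> (x - y) = 0" for y
      proof (cases "y \<in> S")
        case True
        then have "x - y \<notin> cball 0 \<delta>" using that by force
        then show ?thesis using \<rho>0(1)[of "x - y"] by simp
      qed (simp add: eS)
      show ?thesis unfolding w_eq z by simp
    qed
  qed
  define G where "G = weak_grad D \<eta>"
  define G0 where "G0 x = indicator D x *\<^sub>R G x" for x
  have hw: "has_weak_grad D \<eta> G"
    using sob weak_grad_has_weak_grad unfolding sobolev_def G_def by blast
  have mG0: "G0 \<in> borel_measurable lebesgue"
    using weak_grad_measurable[OF D hw] by (simp add: G0_def[abs_def] G_def)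
  have md_eq: "orlicz_modular \<Phi> D (\<lambda>x. norm (weak_grad D \<eta> x)) = md G0"
    by (rule orlicz_modular_eq_md[OF D]) (simp add: G0_def G_def)
  have fin: "md G0 < \<infinity>" using sob unfolding md_eq[symmetric] by (simp add: sobolev_def orlicz_space_def)
  have pointwise: "ennreal (\<Phi> (norm (grad w x))) \<le> (\<integral>\<^sup>+y. ennreal (\<rho> (x - y)) * ennreal (\<Phi> (norm (G0 y))) \<partial>lebesgue)" for x
  \<comment> \<open>If the ball misses S, the gradient at x is 0. Otherwise the ball lies in D, and
    the reflected kernel q is a test function of D, to which the definition of the weak gradient
    applies.\<close>
  proof (cases "cball x \<delta> \<inter> S = {}")
    case True
    have "grad w x \<bullet> h = 0" for h
    proof -
      have z: "e y * (grad \<rho> (x - y) \<bullet> h) = 0" for y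
      proof (cases "y \<in> S")
        case yS: True
        then have "norm (x - y) > \<delta>" using True by (auto simp: dist_norm disjoint_iff not_le)
        then show ?thesis using \<rho>0 by simp
      qed (simp add: eS)
      show ?thesis unfolding wgrad z by simp
    qed
    then have "grad w x = 0" by (metis inner_eq_zero_iff)
    then show ?thesis by simp
  next
    case False
    then obtain s where s: "s \<in> S" "dist x s \<le> \<delta>" by auto
    have sub: "cball x \<delta> \<subseteq> D"
    proof
      fix z assume "z \<in> cball x \<delta>"
      then have "dist s z \<le> \<delta> + \<delta>" using s(2) dist_triangle[of s z x] by (simp add: dist_commute)
      then have "z \<in> cball s d2" using \<delta>(3) by simp
      then show "z \<in> D" using d2(2)[OF s(1)] by blast
    qed
    define q where "q y = \<rho> (x - y)" for y
    have qt: "q \<in> test_functions D"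
    proof (rule test_functionI[OF _ compact_cball sub])
      show "smooth q" unfolding q_def by (rule smooth_reflect[OF sm])
      show "q y = 0" if "y \<notin> cball x \<delta>" for y
        using that \<rho>0(1)[of "x - y"] by (simp add: q_def dist_norm)
    qed
    have gq: "grad q y = - grad \<rho> (x - y)" for y unfolding q_def by (rule grad_reflect[OF sm])
    have gqD: "grad \<rho> (x - y) = 0" if "y \<notin> D" for y
    proof -
      have "y \<notin> cball x \<delta>" using sub that by blast
      then show ?thesis using \<rho>0(2)[of "x - y"] by (simp add: dist_norm)
    qed
    have qD: "q y = 0" if "y \<notin> D" for y
    proof -
      have "y \<notin> cball x \<delta>" using sub that by blast
      then show ?thesis using \<rho>0(1)[of "x - y"] by (simp add: dist_norm q_def)
    qed
    note hw' = hw[unfolded has_weak_grad_iff[OF D]]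
    have liG: "locally_integrable_on G D" using hw by (simp add: has_weak_grad_def)
    have iqG: "integrable lebesgue (\<lambda>y. q y *\<^sub>R G y)" by (rule locally_integrable_mult_test(1)[OF liG qt])
    define V where "V = (\<integral>y. q y *\<^sub>R G y \<partial>lebesgue)"
    have "grad w x \<bullet> h = V \<bullet> h" if h: "h \<in> Basis" for h
    proof -
      have "grad w x \<bullet> h = (\<integral>y. e y * (grad \<rho> (x - y) \<bullet> h) \<partial>lebesgue)"
        unfolding wgrad by (rule integral_completion[symmetric]) measurable
      \<comment> \<open>Reflection of the kernel brings in one sign, integration by parts another;
        together they move the derivative onto \<eta>.\<close>
      also have "\<dots> = (\<integral>y. - ((grad q y \<bullet> h) *\<^sub>R \<eta> y) \<partial>lebesgue)"
      proof (rule Bochner_Integration.integral_cong[OF refl])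
        show "e y * (grad \<rho> (x - y) \<bullet> h) = - ((grad q y \<bullet> h) *\<^sub>R \<eta> y)" for y
          by (cases "y \<in> D") (simp_all add: gq eD gqD)
      qed
      also have "\<dots> = (\<integral>y. q y *\<^sub>R (G y \<bullet> h) \<partial>lebesgue)"
        using hw' qt h by simp
      also have "\<dots> = V \<bullet> h"
        unfolding V_def using integral_inner_left[OF iqG, of h] by simp
      finally show ?thesis .
    qed
    then have gV: "grad w x = V" by (rule euclidean_eqI)
    define T where "T = (\<integral>y. q y * norm (G0 y) \<partial>lebesgue)"
    have qG0: "q y *\<^sub>R G y = q y *\<^sub>R G0 y" for y by (cases "y \<in> D") (simp_all add: G0_def qD)
    have iT: "integrable lebesgue (\<lambda>y. q y * norm (G0 y))"
      using integrable_norm[OF iqG] unfolding qG0 using \<rho>(2) by (simp add: q_def)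
    have VT: "norm V \<le> T"
      using integral_norm_bound[of lebesgue "\<lambda>y. q y *\<^sub>R G y"] \<rho>(2) unfolding V_def T_def qG0
      by (simp add: q_def)
    then have T0: "T \<ge> 0" using norm_ge_zero[of V] by linarith
    obtain B where B: "\<And>y. norm (q y) \<le> B" using test_function_bounded[OF qt] by metis
    have mq: "q \<in> borel_measurable lebesgue" by (rule test_function_lebesgue[OF qt])
    have iPhi: "integrable lebesgue (\<lambda>y. \<Phi> (norm (G0 y)))"
      by (rule integrableI_nonneg[OF measurable_Phi_norm[OF mG0]])
        (use fin Phi_nonneg in \<open>auto simp: md_def\<close>)
    have iqPhi: "integrable lebesgue (\<lambda>y. q y * \<Phi> (norm (G0 y)))"
    proof (rule Bochner_Integration.integrable_bound[OF integrable_mult_right[OF iPhi, of B]])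
      show "(\<lambda>y. q y * \<Phi> (norm (G0 y))) \<in> borel_measurable lebesgue"
        using mq measurable_Phi_norm[OF mG0] by (rule borel_measurable_times)
      show "AE y in lebesgue. norm (q y * \<Phi> (norm (G0 y))) \<le> norm (B * \<Phi> (norm (G0 y)))"
      proof (intro always_eventually allI)
        fix y
        have "\<bar>q y\<bar> \<le> \<bar>B\<bar>" using B[of y] by simp
        then show "norm (q y * \<Phi> (norm (G0 y))) \<le> norm (B * \<Phi> (norm (G0 y)))"
          unfolding norm_mult by (intro mult_right_mono) auto
      qed
    qed
    have iq: "integrable lebesgue q" "(\<integral>y. q y \<partial>lebesgue) = 1"
      using int\<rho>[of x] by (simp_all add: q_def[abs_def] integrable_completion integral_completion)
    \<comment> \<open>Jensen's inequality for the density q: the tangent of \<Phi> at the mean T,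
      multiplied by q and integrated.\<close>
    have "\<Phi> T = (\<integral>y. (\<Phi> T - \<phi> T * T) * q y + \<phi> T * (q y * norm (G0 y)) \<partial>lebesgue)"
      using iq iT by (simp add: T_def[symmetric])
    also have "\<dots> \<le> (\<integral>y. q y * \<Phi> (norm (G0 y)) \<partial>lebesgue)"
    proof (rule integral_mono)
      show "(\<Phi> T - \<phi> T * T) * q y + \<phi> T * (q y * norm (G0 y)) \<le> q y * \<Phi> (norm (G0 y))" for y
        using mult_left_mono[OF Phi_subgradient[of "norm (G0 y)" T], of "q y"] T0 \<rho>(2)[of "x - y"]
        by (simp add: q_def algebra_simps)
    qed (use iq iT iqPhi in auto)
    finally have "\<Phi> (norm V) \<le> (\<integral>y. q y * \<Phi> (norm (G0 y)) \<partial>lebesgue)"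
      using Phi_mono[OF norm_ge_zero VT] by linarith
    then have "ennreal (\<Phi> (norm V)) \<le> ennreal (\<integral>y. q y * \<Phi> (norm (G0 y)) \<partial>lebesgue)" by (rule ennreal_leI)
    also have "\<dots> = (\<integral>\<^sup>+y. ennreal (q y * \<Phi> (norm (G0 y))) \<partial>lebesgue)"
      using \<rho>(2) Phi_nonneg by (intro nn_integral_eq_integral[OF iqPhi, symmetric]) (auto simp: q_def)
    also have "\<dots> = (\<integral>\<^sup>+y. ennreal (\<rho> (x - y)) * ennreal (\<Phi> (norm (G0 y))) \<partial>lebesgue)"
      using \<rho>(2) Phi_nonneg by (intro nn_integral_cong) (simp add: q_def ennreal_mult)
    finally show ?thesis unfolding gV .
  qed
  \<comment> \<open>Fubini is applied for the Borel measure, so the Lebesgue measurable integrand is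
    first replaced by a Borel function H that agrees with it almost everywhere.\<close>
  have "(\<lambda>y. \<Phi> (norm (G0 y))) \<in> borel_measurable (completion lborel)" by (rule measurable_Phi_norm[OF mG0])
  from completion_ex_borel_measurable_real[OF this]
  obtain H where H: "H \<in> borel_measurable lborel" "AE y in lborel. \<Phi> (norm (G0 y)) = H y" by blast
  note [measurable] = H(1)[unfolded measurable_lborel1]
  have HAE: "AE y in lebesgue. \<Phi> (norm (G0 y)) = H y" using H(2) by (rule AE_completion)
  have "md (grad w) \<le> (\<integral>\<^sup>+x. \<integral>\<^sup>+y. ennreal (\<rho> (x - y)) * ennreal (H y) \<partial>lborel \<partial>lborel)"
    unfolding md_def nn_integral_completion
  proof (rule nn_integral_mono)
    fix x
    have "(\<integral>\<^sup>+y. ennreal (\<rho> (x - y)) * ennreal (\<Phi> (norm (G0 y))) \<partial>lebesgue)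
        = (\<integral>\<^sup>+y. ennreal (\<rho> (x - y)) * ennreal (H y) \<partial>lebesgue)"
      using HAE by (intro nn_integral_cong_AE) (auto elim!: eventually_mono)
    then show "ennreal (\<Phi> (norm (grad w x))) \<le> (\<integral>\<^sup>+y. ennreal (\<rho> (x - y)) * ennreal (H y) \<partial>lborel)"
      using pointwise[of x] by (simp add: nn_integral_completion)
  qed
  also have "\<dots> = (\<integral>\<^sup>+y. \<integral>\<^sup>+x. ennreal (\<rho> (x - y)) * ennreal (H y) \<partial>lborel \<partial>lborel)"
    by (rule lborel_pair.Fubini') measurable
  also have "\<dots> = (\<integral>\<^sup>+y. ennreal (H y) \<partial>lborel)"
  proof (rule nn_integral_cong)
    fix y
    have "(\<integral>\<^sup>+x. ennreal (\<rho> (x - y)) * ennreal (H y) \<partial>lborel) = (\<integral>\<^sup>+x. ennreal (\<rho> (x - y)) \<partial>lborel) * ennreal (H y)"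
      by (rule nn_integral_multc) measurable
    then show "(\<integral>\<^sup>+x. ennreal (\<rho> (x - y)) * ennreal (H y) \<partial>lborel) = ennreal (H y)" by (simp add: \<rho>(4))
  qed
  also have "\<dots> = (\<integral>\<^sup>+y. ennreal (H y) \<partial>lebesgue)" by (simp add: nn_integral_completion)
  also have "\<dots> = md G0"
    unfolding md_def using HAE by (intro nn_integral_cong_AE) (auto elim!: eventually_mono)
  finally have "md (grad w) \<le> md G0" .
  then show ?thesis using wt w0 w1 unfolding md_eq by blast
qed

end


section \<open>The right-hand side\<close>

text \<open>By the mean value theorem s - sin s = s (1 - cos z) with z between 0 and s, and 1 - cos
  z is at most |z|.\<close>

lemma abs_sin_minus_le: "\<bar>s - sin s\<bar> \<le> s\<^sup>2" for s :: real
proof -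
  have cos: "\<bar>1 - cos t\<bar> \<le> \<bar>t\<bar>" for t :: real
  proof -
    have "\<bar>1 - cos t\<bar> = 2 * (\<bar>sin (t / 2)\<bar> * \<bar>sin (t / 2)\<bar>)"
      using cos_double_sin[of "t / 2"] by (simp add: power2_eq_square abs_mult[symmetric])
    also have "\<dots> \<le> 2 * (\<bar>t / 2\<bar> * 1)"
      using abs_sin_x_le_abs_x[of "t / 2"] abs_sin_le_one[of "t / 2"] by (intro mult_left_mono mult_mono) auto
    finally show ?thesis by simp
  qed
  have pos: "\<bar>s - sin s\<bar> \<le> s\<^sup>2" if s: "s > 0" for s :: real
  proof -
    have d: "((\<lambda>s. s - sin s) has_real_derivative (1 - cos x)) (at x)" for x :: real
      by (auto intro!: derivative_eq_intros)
    obtain z where z: "0 < z" "z < s" "(s - sin s) - (0 - sin 0) = (s - 0) * (1 - cos z)"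
      using MVT2[OF s d] by blast
    have "\<bar>s - sin s\<bar> = s * \<bar>1 - cos z\<bar>" using z(3) s by (simp add: abs_mult)
    also have "\<dots> \<le> s * s" using cos[of z] z(1,2) s by (intro mult_left_mono) auto
    finally show ?thesis by (simp add: power2_eq_square)
  qed
  consider "s > 0" | "s = 0" | "- s > 0" by linarith
  then show ?thesis
  proof cases
    case 3
    from pos[OF this] show ?thesis by (simp add: abs_minus_commute)
  qed (use pos in auto)
qed

text \<open>The first bound gains from a large M and serves where f is bounded; the second serves
  where |f| is large, with a constant independent of M.\<close>

lemma abs_minus_scaled_sin_le:
  fixes t M :: real
  assumes "M > 0"
  shows "\<bar>t - M * sin (t / M)\<bar> \<le> t\<^sup>2 / M" "\<bar>t - M * sin (t / M)\<bar> \<le> 2 * \<bar>t\<bar>"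
proof -
  have "\<bar>t - M * sin (t / M)\<bar> = M * \<bar>t / M - sin (t / M)\<bar>"
    using assms by (simp add: abs_mult_pos' right_diff_distrib)
  also have "\<dots> \<le> M * (t / M)\<^sup>2" using assms abs_sin_minus_le by (intro mult_left_mono) auto
  finally show "\<bar>t - M * sin (t / M)\<bar> \<le> t\<^sup>2 / M" using assms by (simp add: power2_eq_square)
  have "\<bar>M * sin (t / M)\<bar> \<le> M * \<bar>t / M\<bar>"
    using assms abs_sin_x_le_abs_x[of "t / M"] by (simp add: abs_mult mult_left_mono del: abs_divide)
  then have "\<bar>M * sin (t / M)\<bar> \<le> \<bar>t\<bar>" using assms by simp
  then show "\<bar>t - M * sin (t / M)\<bar> \<le> 2 * \<bar>t\<bar>" by linarith
qed

context young
begin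

section \<open>Pairings with functions of finite conjugate modular\<close>

definition cm :: "('a::euclidean_space \<Rightarrow> real) \<Rightarrow> ennreal" where
  "cm F = (\<integral>\<^sup>+x. ennreal (\<Phi>c \<bar>F x\<bar>) \<partial>lebesgue)"

lemma measurable_conj:
  "F \<in> borel_measurable M \<Longrightarrow> (\<lambda>x. \<Phi>c \<bar>F x\<bar>) \<in> borel_measurable M"
  by measurable

lemma cm_finite_scale:
  fixes F :: "'a::euclidean_space \<Rightarrow> real"
  assumes F: "F \<in> borel_measurable lebesgue" and "cm F < \<infinity>" "l \<ge> 1"
  shows "cm (\<lambda>x. l * F x) < \<infinity>"
proof -
  note [measurable] = measurable_conj[OF F]
  have "cm (\<lambda>x. l * F x) \<le> (\<integral>\<^sup>+x. ennreal (l\<^sup>2) * ennreal (\<Phi>c \<bar>F x\<bar>) \<partial>lebesgue)"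
    unfolding cm_def
  proof (rule nn_integral_mono)
    fix x
    have "\<Phi>c \<bar>l * F x\<bar> \<le> l\<^sup>2 * \<Phi>c \<bar>F x\<bar>"
      using conj_delta2[OF assms(3), of "\<bar>F x\<bar>"] assms(3) by (simp add: abs_mult)
    then show "ennreal (\<Phi>c \<bar>l * F x\<bar>) \<le> ennreal (l\<^sup>2) * ennreal (\<Phi>c \<bar>F x\<bar>)"
      using conj_nonneg by (simp add: ennreal_mult[symmetric] ennreal_leI)
  qed
  also have "\<dots> = ennreal (l\<^sup>2) * cm F" by (simp add: nn_integral_cmult cm_def)
  also have "\<dots> < \<infinity>" using assms(2) by (simp add: ennreal_mult_less_top)
  finally show ?thesis .
qed

text \<open>Young's inequality for l F and v / l. The free parameter l shifts weight between the two
  modulars.\<close>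

lemma pairing_le:
  fixes F v :: "'a::euclidean_space \<Rightarrow> real"
  assumes F: "F \<in> borel_measurable lebesgue" and v: "v \<in> borel_measurable lebesgue" and l: "l > 0"
  shows "(\<integral>\<^sup>+x. ennreal \<bar>F x * v x\<bar> \<partial>lebesgue) \<le> cm (\<lambda>x. l * F x) + md (\<lambda>x. v x /\<^sub>R l)"
proof -
  have vl: "(\<lambda>x. v x /\<^sub>R l) \<in> borel_measurable lebesgue" using v by measurable
  have lF: "(\<lambda>x. l * F x) \<in> borel_measurable lebesgue" using F by measurable
  note [measurable] = measurable_conj[OF lF] measurable_Phi_norm[OF vl]
  have "(\<integral>\<^sup>+x. ennreal \<bar>F x * v x\<bar> \<partial>lebesgue)
      \<le> (\<integral>\<^sup>+x. ennreal (\<Phi>c \<bar>l * F x\<bar>) + ennreal (\<Phi> (norm (v x /\<^sub>R l))) \<partial>lebesgue)"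
  proof (rule nn_integral_mono)
    fix x
    have "\<bar>F x * v x\<bar> = \<bar>l * F x\<bar> * norm (v x /\<^sub>R l)" using l by (simp add: abs_mult)
    also have "\<dots> \<le> \<Phi>c \<bar>l * F x\<bar> + \<Phi> (norm (v x /\<^sub>R l))" by (rule young_ineq') auto
    finally show "ennreal \<bar>F x * v x\<bar> \<le> ennreal (\<Phi>c \<bar>l * F x\<bar>) + ennreal (\<Phi> (norm (v x /\<^sub>R l)))"
      using conj_nonneg Phi_nonneg by (simp add: ennreal_plus[symmetric] ennreal_leI del: ennreal_plus)
  qed
  also have "\<dots> = cm (\<lambda>x. l * F x) + md (\<lambda>x. v x /\<^sub>R l)"
    unfolding cm_def md_def by (rule nn_integral_add) measurable
  finally show ?thesis .
qed

lemma pairing_integrable: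
  fixes F v :: "'a::euclidean_space \<Rightarrow> real"
  assumes F: "F \<in> borel_measurable lebesgue" "cm F < \<infinity>" and v: "v \<in> borel_measurable lebesgue" "md v < \<infinity>"
  shows "integrable lebesgue (\<lambda>x. F x * v x)"
proof (rule integrableI_bounded)
  show "(\<lambda>x. F x * v x) \<in> borel_measurable lebesgue" using F(1) v(1) by (rule borel_measurable_times)
  show "(\<integral>\<^sup>+x. ennreal (norm (F x * v x)) \<partial>lebesgue) < \<infinity>"
    using le_less_trans[OF pairing_le[OF F(1) v(1), of 1]] F(2) v(2) by simp
qed

text \<open>First l is taken small, so that the conjugate modular of l F is at most e/2; with l
  fixed, dividing v by l costs only a constant.\<close>

lemma pairing_small:
  fixes F :: "'a::euclidean_space \<Rightarrow> real"
  assumes F: "F \<in> borel_measurable lebesgue" "cm F < \<infinity>" and e: "e > 0"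
  shows "\<exists>\<delta>>0. \<forall>v. v \<in> borel_measurable lebesgue \<longrightarrow> md v \<le> ennreal \<delta> \<longrightarrow>
    (\<integral>\<^sup>+x. ennreal \<bar>F x * v x\<bar> \<partial>lebesgue) \<le> ennreal e"
proof -
  define c where "c = enn2real (cm F)"
  have c: "c \<ge> 0" "cm F = ennreal c" using F(2) by (auto simp: c_def)
  define l where "l = min 1 (e / (2 * (c + 1)))"
  have l: "l > 0" "l \<le> 1" using c(1) e by (auto simp: l_def)
  have lc: "l * c \<le> e / 2"
  proof -
    have "l * c \<le> e / (2 * (c + 1)) * c" using c(1) by (intro mult_right_mono) (auto simp: l_def)
    also have "\<dots> = e / 2 * (c / (c + 1))" by simp
    also have "\<dots> \<le> e / 2 * 1" using c(1) e by (intro mult_left_mono) auto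
    finally show ?thesis by simp
  qed
  note [measurable] = measurable_conj[OF F(1)]
  have "cm (\<lambda>x. l * F x) \<le> (\<integral>\<^sup>+x. ennreal l * ennreal (\<Phi>c \<bar>F x\<bar>) \<partial>lebesgue)"
    unfolding cm_def
  proof (rule nn_integral_mono)
    fix x
    have "\<Phi>c \<bar>l * F x\<bar> \<le> l * \<Phi>c \<bar>F x\<bar>" using conj_scale_le[of l "\<bar>F x\<bar>"] l by (simp add: abs_mult)
    then show "ennreal (\<Phi>c \<bar>l * F x\<bar>) \<le> ennreal l * ennreal (\<Phi>c \<bar>F x\<bar>)"
      using conj_nonneg l by (simp add: ennreal_mult[symmetric] ennreal_leI)
  qed
  also have "\<dots> = ennreal l * cm F" by (simp add: nn_integral_cmult cm_def)
  also have "\<dots> = ennreal (l * c)" using c l by (simp add: ennreal_mult)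
  also have "\<dots> \<le> ennreal (e / 2)" by (rule ennreal_leI[OF lc])
  finally have 1: "cm (\<lambda>x. l * F x) \<le> ennreal (e / 2)" .
  define K where "K = scalec (inverse l)"
  have K: "K > 0" unfolding K_def by (rule scalec_pos)
  show ?thesis
  proof (intro exI[of _ "e / (2 * K)"] conjI allI impI)
    fix v :: "'a \<Rightarrow> real" assume v: "v \<in> borel_measurable lebesgue" "md v \<le> ennreal (e / (2 * K))"
    have "(\<integral>\<^sup>+x. ennreal \<bar>F x * v x\<bar> \<partial>lebesgue) \<le> cm (\<lambda>x. l * F x) + md (\<lambda>x. v x /\<^sub>R l)"
      by (rule pairing_le[OF F(1) v(1) l(1)])
    also have "md (\<lambda>x. v x /\<^sub>R l) \<le> ennreal K * md v" unfolding K_def using v(1) by (rule md_scale)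
    also have "\<dots> \<le> ennreal K * ennreal (e / (2 * K))" by (intro mult_left_mono v(2)) auto
    also have "\<dots> = ennreal (e / 2)" using K e by (simp add: ennreal_mult[symmetric])
    finally have "(\<integral>\<^sup>+x. ennreal \<bar>F x * v x\<bar> \<partial>lebesgue) \<le> cm (\<lambda>x. l * F x) + ennreal (e / 2)"
      by (simp add: add_left_mono)
    also have "\<dots> \<le> ennreal (e / 2) + ennreal (e / 2)" using 1 by (intro add_right_mono)
    also have "\<dots> = ennreal e" using e by (simp add: ennreal_plus[symmetric] del: ennreal_plus)
    finally show "(\<integral>\<^sup>+x. ennreal \<bar>F x * v x\<bar> \<partial>lebesgue) \<le> ennreal e" .
  qed (use K e in auto)
qed

lemma cm_tail_small:
  fixes F :: "'a::euclidean_space \<Rightarrow> real"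
  assumes F: "F \<in> borel_measurable lebesgue" "cm F < \<infinity>" and e: "e > 0"
  shows "\<exists>N::nat. cm (\<lambda>x. if \<bar>F x\<bar> > real N then F x else 0) < ennreal e"
proof -
  let ?r = "\<lambda>N x. if \<bar>F x\<bar> > real N then F x else 0"
  have mr: "?r N \<in> borel_measurable lebesgue" for N using F(1) by measurable
  have "(\<lambda>N. \<integral>\<^sup>+x. ennreal (\<Phi>c \<bar>?r N x\<bar>) \<partial>lebesgue) \<longlonglongrightarrow> (\<integral>\<^sup>+(x::'a). 0 \<partial>lebesgue)"
  proof (rule nn_integral_dominated_convergence[where w = "\<lambda>x. ennreal (\<Phi>c \<bar>F x\<bar>)"])
    show "(\<lambda>x. ennreal (\<Phi>c \<bar>?r N x\<bar>)) \<in> borel_measurable lebesgue" for N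
      using measurable_conj[OF mr] by measurable
    show "(\<lambda>x. ennreal (\<Phi>c \<bar>F x\<bar>)) \<in> borel_measurable lebesgue"
      using measurable_conj[OF F(1)] by measurable
    show "(\<integral>\<^sup>+x. ennreal (\<Phi>c \<bar>F x\<bar>) \<partial>lebesgue) < \<infinity>" using F(2) by (simp add: cm_def)
    show "AE x in lebesgue. ennreal (\<Phi>c \<bar>?r N x\<bar>) \<le> ennreal (\<Phi>c \<bar>F x\<bar>)" for N by simp
    show "AE x in lebesgue. (\<lambda>N. ennreal (\<Phi>c \<bar>?r N x\<bar>)) \<longlonglongrightarrow> 0"
    proof (intro always_eventually allI)
      fix x
      obtain N0 where "\<bar>F x\<bar> \<le> real N0" using real_arch_simple by blast
      then have "\<forall>\<^sub>F N in sequentially. ennreal (\<Phi>c \<bar>?r N x\<bar>) = 0"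
        by (intro eventually_sequentiallyI[of N0]) auto
      then show "(\<lambda>N. ennreal (\<Phi>c \<bar>?r N x\<bar>)) \<longlonglongrightarrow> 0" by (rule tendsto_eventually)
    qed
  qed auto
  then have "(\<lambda>N. cm (?r N)) \<longlonglongrightarrow> 0" by (simp add: cm_def)
  then have "\<forall>\<^sub>F N in sequentially. cm (?r N) < ennreal e"
    using e by (intro order_tendstoD(2)) auto
  then show ?thesis by (meson eventually_sequentially order_refl)
qed

text \<open>Split according to the size of |F|. Where it is at most N, the error is at most v^2 / M,
  controlled by the modular of v, and M is taken large. Where it exceeds N, the error is at most 2
  |v|, and Young's inequality meets the small tail of F. M depends on v only through the bound
  C.\<close>

lemma pairing_truncation:
  fixes F :: "'a::euclidean_space \<Rightarrow> real"
  assumes F: "F \<in> borel_measurable lebesgue" "cm F < \<infinity>" and D: "D \<in> lmeasurable" "\<And>x. x \<notin> D \<Longrightarrow> F x = 0"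
    and C: "C > 0" and e: "e > 0"
  shows "\<exists>M>0. \<forall>v. v \<in> borel_measurable lebesgue \<longrightarrow> md v \<le> ennreal C \<longrightarrow>
    (\<integral>\<^sup>+x. ennreal \<bar>F x * (v x - M * sin (v x / M))\<bar> \<partial>lebesgue) \<le> ennreal e"
proof -
  define l where "l = max 1 (3 * C / e)"
  have l: "l \<ge> 1" "C / l \<le> e / 3"
  proof -
    show l1: "l \<ge> 1" by (simp add: l_def)
    have "3 * C / e \<le> l" by (simp add: l_def)
    then show "C / l \<le> e / 3" using l1 e by (simp add: field_simps)
  qed
  have "cm (\<lambda>x. (2 * l) * F x) < \<infinity>" using l(1) by (intro cm_finite_scale F) auto
  moreover have "(\<lambda>x. (2 * l) * F x) \<in> borel_measurable lebesgue" using F(1) by measurable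
  ultimately obtain N' :: nat where N': "cm (\<lambda>x. if \<bar>(2 * l) * F x\<bar> > real N' then (2 * l) * F x else 0) < ennreal (e / 3)"
    using cm_tail_small[of "\<lambda>x. (2 * l) * F x" "e / 3"] e by auto
  \<comment> \<open>The tail estimate was for 2 * l * F at level N'; this is the same level for
    F.\<close>
  define N where "N = real N' / (2 * l)"
  define r where "r x = (if \<bar>F x\<bar> > N then F x else 0)" for x
  have N: "N \<ge> 0" using l(1) by (simp add: N_def)
  have "(\<lambda>x. if \<bar>(2 * l) * F x\<bar> > real N' then (2 * l) * F x else 0) = (\<lambda>x. l * (2 * r x))"
    using l(1) by (auto simp: r_def N_def fun_eq_iff abs_mult field_simps)
  then have r: "cm (\<lambda>x. l * (2 * r x)) \<le> ennreal (e / 3)" using N' by simp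
  have mr: "(\<lambda>x. 2 * r x) \<in> borel_measurable lebesgue" unfolding r_def using F(1) by measurable
  define m where "m = measure lebesgue D"
  have m: "m \<ge> 0" "emeasure lebesgue D = ennreal m"
    unfolding m_def using emeasure_eq_measure2[OF D(1)] by simp_all
  define A where "A = N * (m + C / \<Phi> 1)"
  have A: "A \<ge> 0" using N m C Phi_pos[of 1] by (simp add: A_def)
  define M where "M = 3 * (A + 1) / e"
  have M: "M > 0" using A e by (simp add: M_def)
  have AM: "A / M \<le> e / 3"
  proof -
    have "A / M = e / 3 * (A / (A + 1))" using A e by (simp add: M_def)
    also have "\<dots> \<le> e / 3 * 1" using A e by (intro mult_left_mono) auto
    finally show ?thesis by simp
  qed
  show ?thesis
  proof (intro exI[of _ M] conjI M allI impI)
    fix v :: "'a \<Rightarrow> real" assume v: "v \<in> borel_measurable lebesgue" "md v \<le> ennreal C"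
    note [measurable] = v(1) measurable_Phi_norm[OF v(1)] mr
    have Dm [measurable]: "D \<in> sets lebesgue" using D(1) by auto
    let ?a = "\<lambda>x. ennreal (N / M) * (indicator D x + ennreal (1 / \<Phi> 1) * ennreal (\<Phi> (norm (v x))))"
    have "(\<integral>\<^sup>+x. ennreal \<bar>F x * (v x - M * sin (v x / M))\<bar> \<partial>lebesgue)
      \<le> (\<integral>\<^sup>+x. ?a x + ennreal \<bar>(2 * r x) * v x\<bar> \<partial>lebesgue)"
    proof (rule nn_integral_mono)
      fix x
      show "ennreal \<bar>F x * (v x - M * sin (v x / M))\<bar> \<le> ?a x + ennreal \<bar>(2 * r x) * v x\<bar>"
      proof (cases "x \<in> D")
        case False then show ?thesis using D(2) by simp
      next
        case xD: True
        show ?thesis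
        proof (cases "\<bar>F x\<bar> > N")
          case True
          have "\<bar>F x * (v x - M * sin (v x / M))\<bar> \<le> \<bar>F x\<bar> * (2 * \<bar>v x\<bar>)"
            unfolding abs_mult by (intro mult_left_mono abs_minus_scaled_sin_le(2) M) auto
          also have "\<dots> = \<bar>(2 * r x) * v x\<bar>" using True by (simp add: r_def abs_mult)
          finally have "ennreal \<bar>F x * (v x - M * sin (v x / M))\<bar> \<le> ennreal \<bar>(2 * r x) * v x\<bar>"
            by (rule ennreal_leI)
          then show ?thesis by (rule order_trans) simp
        next
          case False
          have "\<bar>F x * (v x - M * sin (v x / M))\<bar> \<le> N * ((v x)\<^sup>2 / M)"
            unfolding abs_mult using False N by (intro mult_mono abs_minus_scaled_sin_le(1) M) auto
          also have "\<dots> = N / M * (norm (v x))\<^sup>2" by simp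
          also have "\<dots> \<le> N / M * (1 + \<Phi> (norm (v x)) / \<Phi> 1)"
            using N M by (intro mult_left_mono square_le_Phi) auto
          finally have "ennreal \<bar>F x * (v x - M * sin (v x / M))\<bar> \<le> ennreal (N / M * (1 + \<Phi> (norm (v x)) / \<Phi> 1))"
            by (rule ennreal_leI)
          also have "\<dots> = ?a x"
            using N M Phi_nonneg[of "norm (v x)"] Phi_pos[of 1] xD
            by (simp add: ennreal_mult ennreal_mult[symmetric] ennreal_plus[symmetric] ennreal_1[symmetric] del: ennreal_plus ennreal_1)
          finally show ?thesis by (rule order_trans) simp
        qed
      qed
    qed
    also have "\<dots> = (\<integral>\<^sup>+x. ?a x \<partial>lebesgue) + (\<integral>\<^sup>+x. ennreal \<bar>(2 * r x) * v x\<bar> \<partial>lebesgue)"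
      by (rule nn_integral_add) measurable
    also have "(\<integral>\<^sup>+x. ?a x \<partial>lebesgue) = ennreal (N / M) * (emeasure lebesgue D + ennreal (1 / \<Phi> 1) * md v)"
    proof -
      let ?h = "\<lambda>x. ennreal (1 / \<Phi> 1) * ennreal (\<Phi> (norm (v x)))"
      have "(\<integral>\<^sup>+x. ?a x \<partial>lebesgue) = ennreal (N / M) * (\<integral>\<^sup>+x. indicator D x + ?h x \<partial>lebesgue)"
        by (rule nn_integral_cmult) measurable
      also have "(\<integral>\<^sup>+x. indicator D x + ?h x \<partial>lebesgue) = (\<integral>\<^sup>+x. indicator D x \<partial>lebesgue) + (\<integral>\<^sup>+x. ?h x \<partial>lebesgue)"
        by (rule nn_integral_add) measurable
      also have "(\<integral>\<^sup>+x. indicator D x \<partial>lebesgue) = emeasure lebesgue D" by (rule nn_integral_indicator[OF Dm])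
      also have "(\<integral>\<^sup>+x. ?h x \<partial>lebesgue) = ennreal (1 / \<Phi> 1) * md v"
        unfolding md_def by (rule nn_integral_cmult) measurable
      finally show ?thesis .
    qed
    also have "\<dots> \<le> ennreal (N / M) * (ennreal m + ennreal (1 / \<Phi> 1) * ennreal C)"
      unfolding m(2) by (intro mult_left_mono add_left_mono v(2)) auto
    also have "\<dots> = ennreal (A / M)"
      using N M m(1) C Phi_pos[of 1] by (simp add: A_def ennreal_mult[symmetric] ennreal_plus[symmetric] del: ennreal_plus)
    also have "\<dots> \<le> ennreal (e / 3)" by (rule ennreal_leI[OF AM])
    also have "(\<integral>\<^sup>+x. ennreal \<bar>(2 * r x) * v x\<bar> \<partial>lebesgue) \<le> cm (\<lambda>x. l * (2 * r x)) + md (\<lambda>x. v x /\<^sub>R l)"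
      using l(1) by (intro pairing_le mr v(1)) auto
    also have "\<dots> \<le> ennreal (e / 3) + ennreal (e / 3)"
    proof (intro add_mono r)
      have "md (\<lambda>x. v x /\<^sub>R l) \<le> ennreal (1 / l) * md v" by (rule md_divide_le[OF v(1) l(1)])
      also have "\<dots> \<le> ennreal (1 / l) * ennreal C" by (intro mult_left_mono v(2)) auto
      also have "\<dots> = ennreal (C / l)" using l(1) C by (simp add: ennreal_mult[symmetric])
      also have "\<dots> \<le> ennreal (e / 3)" by (rule ennreal_leI[OF l(2)])
      finally show "md (\<lambda>x. v x /\<^sub>R l) \<le> ennreal (e / 3)" .
    qed
    finally show "(\<integral>\<^sup>+x. ennreal \<bar>F x * (v x - M * sin (v x / M))\<bar> \<partial>lebesgue) \<le> ennreal e"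
      using e by (simp add: ennreal_plus[symmetric] add_left_mono add_right_mono del: ennreal_plus)
  qed
qed


text \<open>Multiplying by the cutoff \<open>cutoff \<circ> \<eta>\<close> is cheap only for bounded functions, because of the term
  \<open>\<psi> \<nabla>\<eta>\<close>; this is why \<open>\<psi>\<close> is first replaced by the bounded \<open>M sin (\<psi> / M)\<close>, whose gradient is
  dominated by that of \<open>\<psi>\<close>.\<close>

lemma truncated_cutoff:
  fixes F :: "'a::euclidean_space \<Rightarrow> real"
  assumes F: "F \<in> borel_measurable lebesgue" "cm F < \<infinity>" and D: "open D" "bounded D" "\<And>x. x \<notin> D \<Longrightarrow> F x = 0"
    and C: "C > 0" and e: "e > 0"
  shows "\<exists>M>0. \<exists>\<delta>>0. \<forall>\<psi>\<in>test_functions D. \<forall>\<eta>\<in>test_functions D. (\<forall>x. \<eta> x \<ge> 0) \<longrightarrow>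
    md (grad \<psi>) \<le> ennreal C \<longrightarrow> md (grad \<eta>) \<le> ennreal \<delta> \<longrightarrow>
    md (grad (\<lambda>x. M * sin (\<psi> x / M) * cutoff (\<eta> x))) \<le> md (grad \<psi>) + ennreal e \<and>
    (\<integral>\<^sup>+x. ennreal \<bar>F x * (\<psi> x - M * sin (\<psi> x / M) * cutoff (\<eta> x))\<bar> \<partial>lebesgue) \<le> ennreal e"
proof -
  have e2: "e / 2 > 0" using e by simp
  obtain P where P: "P > 0" "\<forall>u g. Wpair D u g \<longrightarrow> md u \<le> ennreal P * md g"
    using Wpair_poincare[OF D(2)] by auto
  have Dm: "D \<in> lmeasurable" using D(1,2) by (intro lmeasurable_open)
  have "P * C > 0" using P(1) C by simp
  from pairing_truncation[OF F Dm D(3) this e2]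
  obtain M where M: "M > 0" "\<forall>v. v \<in> borel_measurable lebesgue \<longrightarrow> md v \<le> ennreal (P * C) \<longrightarrow>
    (\<integral>\<^sup>+x. ennreal \<bar>F x * (v x - M * sin (v x / M))\<bar> \<partial>lebesgue) \<le> ennreal (e / 2)"
    by auto
  obtain d0 where d0: "d0 > 0" "\<forall>v. v \<in> borel_measurable lebesgue \<longrightarrow> md v \<le> ennreal d0 \<longrightarrow>
    (\<integral>\<^sup>+x. ennreal \<bar>F x * v x\<bar> \<partial>lebesgue) \<le> ennreal (e / 2)"
    using pairing_small[OF F e2] by auto
  \<comment> \<open>The coefficient 1 + e/(2 C) adds at most e/2 to an energy of at most C;
    \<open>K2\<close> is the resulting price of the gradient of \<eta>, and \<open>K1\<close> that
    of its factor 6 M.\<close>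
  define K1 K2 where "K1 = scalec (6 * M)" and "K2 = addc (e / (2 * C))"
  have K: "K1 > 0" "K2 > 0" unfolding K1_def K2_def by (rule scalec_pos addc_pos)+
  have eC: "e / (2 * C) > 0" using e C by simp
  define \<delta> where "\<delta> = min (d0 / (K1 * P)) (e / (2 * K2 * K1))"
  have \<delta>: "\<delta> > 0" "K1 * (P * \<delta>) \<le> d0" "K2 * (K1 * \<delta>) \<le> e / 2"
  proof -
    show "\<delta> > 0" using d0(1) K P(1) e by (simp add: \<delta>_def)
    have "\<delta> \<le> d0 / (K1 * P)" "\<delta> \<le> e / (2 * K2 * K1)" by (auto simp: \<delta>_def)
    then show "K1 * (P * \<delta>) \<le> d0" "K2 * (K1 * \<delta>) \<le> e / 2"
      using K P(1) by (simp_all add: field_simps)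
  qed
  show ?thesis
  proof (rule exI[of _ M], rule conjI[OF M(1)], rule exI[of _ \<delta>], rule conjI[OF \<delta>(1)], intro ballI impI conjI)
    fix \<psi> \<eta> :: "'a \<Rightarrow> real"
    assume \<psi>: "\<psi> \<in> test_functions D" and \<eta>: "\<eta> \<in> test_functions D" and \<eta>0: "\<forall>x. \<eta> x \<ge> 0"
      and md\<psi>: "md (grad \<psi>) \<le> ennreal C" and md\<eta>: "md (grad \<eta>) \<le> ennreal \<delta>"
    note [measurable] = test_function_lebesgue[OF \<psi>] test_function_lebesgue[OF \<eta>]
    note sm = test_function_smooth[OF \<psi>] test_function_smooth[OF \<eta>]
    define T where "T x = M * sin (\<psi> x / M)" for x
    have smT: "smooth T"
      using smooth_mult[OF smooth_const[of M] smooth_sin[OF smooth_mult[OF smooth_const[of "1 / M"] sm(1)]]]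
      by (simp add: T_def[abs_def])
    have smc: "smooth (\<lambda>x. cutoff (\<eta> x))" by (rule smooth_cutoff[OF sm(2)])
    have gT: "grad T x = cos (\<psi> x / M) *\<^sub>R grad \<psi> x" for x
    proof -
      have "((\<lambda>t. M * sin (t / M)) has_real_derivative cos (\<psi> x / M)) (at (\<psi> x))"
        using M(1) by (auto intro!: derivative_eq_intros)
      from grad_compose[OF this sm(1)] show ?thesis by (simp add: T_def[abs_def])
    qed
    have gc: "grad (\<lambda>x. cutoff (\<eta> x)) x = cutoff' (\<eta> x) *\<^sub>R grad \<eta> x" for x
      by (rule grad_compose[OF has_real_derivative_cutoff sm(2)])
    have gw: "grad (\<lambda>x. T x * cutoff (\<eta> x)) x
        = T x *\<^sub>R (cutoff' (\<eta> x) *\<^sub>R grad \<eta> x) + cutoff (\<eta> x) *\<^sub>R (cos (\<psi> x / M) *\<^sub>R grad \<psi> x)" for x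
      using grad_mult[OF smT smc, of x] by (simp only: gT gc)
    have T_le: "\<bar>T x\<bar> \<le> M" for x
      using M(1) abs_sin_le_one[of "\<psi> x / M"] by (simp add: T_def abs_mult)
    \<comment> \<open>The factors cos and cutoff are at most 1, so \<nabla>\<psi> keeps the
      coefficient 1; the other term has 6 M because |T| \<le> M and the slope of the cutoff is at
      most 6.\<close>
    have norm_gw: "norm (grad (\<lambda>x. T x * cutoff (\<eta> x)) x) \<le> norm (grad \<psi> x) + (6 * M) * norm (grad \<eta> x)" for x
    proof -
      have "norm (T x *\<^sub>R (cutoff' (\<eta> x) *\<^sub>R grad \<eta> x)) = (\<bar>T x\<bar> * \<bar>cutoff' (\<eta> x)\<bar>) * norm (grad \<eta> x)" by (simp add: abs_mult)
      also have "\<dots> \<le> (M * 6) * norm (grad \<eta> x)"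
        using T_le[of x] abs_cutoff'_le[of "\<eta> x"] M(1) by (intro mult_right_mono mult_mono) auto
      finally have 1: "norm (T x *\<^sub>R (cutoff' (\<eta> x) *\<^sub>R grad \<eta> x)) \<le> (6 * M) * norm (grad \<eta> x)" by (simp add: mult.commute)
      have "norm (cutoff (\<eta> x) *\<^sub>R (cos (\<psi> x / M) *\<^sub>R grad \<psi> x)) = (\<bar>cutoff (\<eta> x)\<bar> * \<bar>cos (\<psi> x / M)\<bar>) * norm (grad \<psi> x)" by (simp add: abs_mult)
      also have "\<dots> \<le> (1 * 1) * norm (grad \<psi> x)"
        using cutoff_nonneg[of "\<eta> x"] cutoff_le_1[of "\<eta> x"] \<eta>0 by (intro mult_right_mono mult_mono) auto
      finally have 2: "norm (cutoff (\<eta> x) *\<^sub>R (cos (\<psi> x / M) *\<^sub>R grad \<psi> x)) \<le> norm (grad \<psi> x)" by simp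
      show ?thesis unfolding gw using norm_triangle_mono[OF 1 2] by simp
    qed
    have md_norm: "md (\<lambda>x. norm (grad \<psi> x)) = md (grad \<psi>)" "md (\<lambda>x. norm (grad \<eta> x)) = md (grad \<eta>)"
      by (rule md_cong_norm, simp)+
    have "md (grad (\<lambda>x. T x * cutoff (\<eta> x))) \<le> md (\<lambda>x. norm (grad \<psi> x) + (6 * M) *\<^sub>R norm (grad \<eta> x))"
    proof -
      have "md (grad (\<lambda>x. T x * cutoff (\<eta> x))) = md (\<lambda>x. norm (grad (\<lambda>x. T x * cutoff (\<eta> x)) x))"
        by (rule md_cong_norm) simp
      also have "\<dots> \<le> md (\<lambda>x. norm (grad \<psi> x) + (6 * M) *\<^sub>R norm (grad \<eta> x))"
        by (rule md_mono) (use norm_gw M(1) in auto)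
      finally show ?thesis .
    qed
    also have "\<dots> \<le> ennreal (1 + e / (2 * C)) * md (\<lambda>x. norm (grad \<psi> x)) + ennreal K2 * md (\<lambda>x. (6 * M) *\<^sub>R norm (grad \<eta> x))"
      unfolding K2_def by (rule md_add[OF eC]) measurable
    also have "\<dots> \<le> (md (grad \<psi>) + ennreal (e / 2)) + ennreal (e / 2)"
    proof (rule add_mono)
      have "ennreal (1 + e / (2 * C)) * md (grad \<psi>) = md (grad \<psi>) + ennreal (e / (2 * C)) * md (grad \<psi>)"
        using e C by (simp add: ennreal_plus distrib_right)
      also have "\<dots> \<le> md (grad \<psi>) + ennreal (e / (2 * C)) * ennreal C"
        by (intro add_left_mono mult_left_mono md\<psi>) auto
      also have "ennreal (e / (2 * C)) * ennreal C = ennreal (e / 2)"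
        using e C by (simp add: ennreal_mult[symmetric])
      finally show "ennreal (1 + e / (2 * C)) * md (\<lambda>x. norm (grad \<psi> x)) \<le> md (grad \<psi>) + ennreal (e / 2)"
        unfolding md_norm .
      have "md (\<lambda>x. (6 * M) *\<^sub>R norm (grad \<eta> x)) \<le> ennreal K1 * md (\<lambda>x. norm (grad \<eta> x))"
        unfolding K1_def by (rule md_scale) measurable
      also have "\<dots> \<le> ennreal K1 * ennreal \<delta>" unfolding md_norm by (intro mult_left_mono md\<eta>) auto
      finally have "ennreal K2 * md (\<lambda>x. (6 * M) *\<^sub>R norm (grad \<eta> x)) \<le> ennreal K2 * (ennreal K1 * ennreal \<delta>)"
        by (rule mult_left_mono) simp
      also have "\<dots> = ennreal (K2 * (K1 * \<delta>))" using K \<delta>(1) by (simp add: ennreal_mult)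
      also have "\<dots> \<le> ennreal (e / 2)" by (rule ennreal_leI[OF \<delta>(3)])
      finally show "ennreal K2 * md (\<lambda>x. (6 * M) *\<^sub>R norm (grad \<eta> x)) \<le> ennreal (e / 2)" .
    qed
    also have "\<dots> = md (grad \<psi>) + ennreal e"
      using e by (simp add: add.assoc ennreal_plus[symmetric] del: ennreal_plus)
    finally show "md (grad (\<lambda>x. M * sin (\<psi> x / M) * cutoff (\<eta> x))) \<le> md (grad \<psi>) + ennreal e"
      unfolding T_def .
    have "md \<psi> \<le> ennreal P * md (grad \<psi>)" using P(2) Wpair_test[OF \<psi>] by blast
    also have "\<dots> \<le> ennreal P * ennreal C" by (intro mult_left_mono md\<psi>) auto
    also have "\<dots> = ennreal (P * C)" using P(1) C by (simp add: ennreal_mult)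
    finally have 1: "(\<integral>\<^sup>+x. ennreal \<bar>F x * (\<psi> x - T x)\<bar> \<partial>lebesgue) \<le> ennreal (e / 2)"
      unfolding T_def using M(2) test_function_lebesgue(1)[OF \<psi>] by blast
    have "md (\<lambda>x. (6 * M) *\<^sub>R \<eta> x) \<le> ennreal K1 * md \<eta>" unfolding K1_def by (rule md_scale) measurable
    also have "\<dots> \<le> ennreal K1 * (ennreal P * md (grad \<eta>))"
      using P(2) Wpair_test[OF \<eta>] by (intro mult_left_mono) auto
    also have "\<dots> \<le> ennreal K1 * (ennreal P * ennreal \<delta>)" by (intro mult_left_mono md\<eta>) auto
    also have "\<dots> = ennreal (K1 * (P * \<delta>))" using P(1) K(1) \<delta>(1) by (simp add: ennreal_mult)
    also have "\<dots> \<le> ennreal d0" by (rule ennreal_leI[OF \<delta>(2)])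
    finally have 2: "(\<integral>\<^sup>+x. ennreal \<bar>F x * ((6 * M) *\<^sub>R \<eta> x)\<bar> \<partial>lebesgue) \<le> ennreal (e / 2)"
      using d0(2)[rule_format, of "\<lambda>x. (6 * M) *\<^sub>R \<eta> x"] by simp
    have mT: "T \<in> borel_measurable lebesgue"
      using smooth_continuous[OF smT] by (rule continuous_imp_measurable_lebesgue)
    note [measurable] = F(1) mT
    have "(\<integral>\<^sup>+x. ennreal \<bar>F x * (\<psi> x - T x * cutoff (\<eta> x))\<bar> \<partial>lebesgue)
        \<le> (\<integral>\<^sup>+x. ennreal \<bar>F x * (\<psi> x - T x)\<bar> + ennreal \<bar>F x * ((6 * M) *\<^sub>R \<eta> x)\<bar> \<partial>lebesgue)"
    proof (rule nn_integral_mono)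
      fix x
      have "\<bar>\<psi> x - T x * cutoff (\<eta> x)\<bar> \<le> \<bar>\<psi> x - T x\<bar> + \<bar>(6 * M) *\<^sub>R \<eta> x\<bar>"
      proof -
        have "\<bar>T x * (1 - cutoff (\<eta> x))\<bar> \<le> M * (6 * \<eta> x)"
          unfolding abs_mult using T_le[of x] one_minus_cutoff_le[of "\<eta> x"] cutoff_le_1[of "\<eta> x"] \<eta>0 M(1)
          by (intro mult_mono) auto
        also have "\<dots> = \<bar>(6 * M) *\<^sub>R \<eta> x\<bar>" using \<eta>0 M(1) by (simp add: abs_mult)
        finally have "\<bar>T x * (1 - cutoff (\<eta> x))\<bar> \<le> \<bar>(6 * M) *\<^sub>R \<eta> x\<bar>" .
        moreover have "\<psi> x - T x * cutoff (\<eta> x) = (\<psi> x - T x) + T x * (1 - cutoff (\<eta> x))" by (simp add: algebra_simps)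
        ultimately show ?thesis by linarith
      qed
      then have "\<bar>F x * (\<psi> x - T x * cutoff (\<eta> x))\<bar> \<le> \<bar>F x * (\<psi> x - T x)\<bar> + \<bar>F x * ((6 * M) *\<^sub>R \<eta> x)\<bar>"
        unfolding abs_mult[of "F x"] distrib_left[symmetric] by (rule mult_left_mono) simp
      then show "ennreal \<bar>F x * (\<psi> x - T x * cutoff (\<eta> x))\<bar> \<le> ennreal \<bar>F x * (\<psi> x - T x)\<bar> + ennreal \<bar>F x * ((6 * M) *\<^sub>R \<eta> x)\<bar>"
        by (simp add: ennreal_plus[symmetric] ennreal_leI del: ennreal_plus)
    qed
    also have "\<dots> = (\<integral>\<^sup>+x. ennreal \<bar>F x * (\<psi> x - T x)\<bar> \<partial>lebesgue) + (\<integral>\<^sup>+x. ennreal \<bar>F x * ((6 * M) *\<^sub>R \<eta> x)\<bar> \<partial>lebesgue)"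
      by (rule nn_integral_add) measurable
    also have "\<dots> \<le> ennreal (e / 2) + ennreal (e / 2)" by (rule add_mono[OF 1 2])
    also have "\<dots> = ennreal e" using e by (simp add: ennreal_plus[symmetric] del: ennreal_plus)
    finally show "(\<integral>\<^sup>+x. ennreal \<bar>F x * (\<psi> x - M * sin (\<psi> x / M) * cutoff (\<eta> x))\<bar> \<partial>lebesgue) \<le> ennreal e"
      unfolding T_def .
  qed
qed

section \<open>Weak solutions\<close>

definition En :: "('a::euclidean_space \<Rightarrow> 'b::euclidean_space) \<Rightarrow> real" where
  "En g = (\<integral>x. \<Phi> (norm (g x)) \<partial>lebesgue)"

lemma Phi_integrable:
  assumes "g \<in> borel_measurable lebesgue" "md g < \<infinity>"
  shows "integrable lebesgue (\<lambda>x. \<Phi> (norm (g x)))"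
  by (rule integrableI_nonneg[OF measurable_Phi_norm[OF assms(1)]])
    (use assms(2) Phi_nonneg in \<open>auto simp: md_def\<close>)

lemma md_eq_En:
  assumes "g \<in> borel_measurable lebesgue" "md g < \<infinity>"
  shows "md g = ennreal (En g)"
  unfolding md_def En_def using Phi_nonneg
  by (intro nn_integral_eq_integral Phi_integrable assms) auto

lemma En_nonneg: "En g \<ge> 0"
  unfolding En_def using Phi_nonneg by (intro Bochner_Integration.integral_nonneg) auto

lemma flux_measurable [measurable]: "(flux :: 'b::euclidean_space \<Rightarrow> 'b) \<in> borel_measurable borel"
proof -
  have "(\<lambda>t. \<phi> (max 0 t)) \<in> borel_measurable borel"
    by (intro borel_measurable_mono monoI phi_mono) auto
  then have "(\<lambda>a::'b. \<phi> (max 0 (norm a))) \<in> borel_measurable borel" by measurable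
  then have [measurable]: "(\<lambda>a::'b. \<phi> (norm a)) \<in> borel_measurable borel" by simp
  show ?thesis unfolding flux_def[abs_def] by measurable
qed

lemma flux_integrable:
  fixes G H :: "'a::euclidean_space \<Rightarrow> 'b::euclidean_space"
  assumes G: "G \<in> borel_measurable lebesgue" "md G < \<infinity>" and H: "H \<in> borel_measurable lebesgue" "md H < \<infinity>"
  shows "integrable lebesgue (\<lambda>x. flux (G x) \<bullet> H x)"
proof -
  have "integrable lebesgue (\<lambda>x. scalec 2 * (\<Phi> (norm (G x)) + \<Phi> (norm (H x))))"
    using Phi_integrable[OF G] Phi_integrable[OF H] by simp
  then show ?thesis
  proof (rule Bochner_Integration.integrable_bound)
    show "(\<lambda>x. flux (G x) \<bullet> H x) \<in> borel_measurable lebesgue" using G(1) H(1) by measurable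
    show "AE x in lebesgue. norm (flux (G x) \<bullet> H x) \<le> norm (scalec 2 * (\<Phi> (norm (G x)) + \<Phi> (norm (H x))))"
    proof (intro always_eventually allI)
      fix x
      have "\<bar>flux (G x) \<bullet> H x\<bar> \<le> \<phi> (norm (G x)) * norm (H x)"
        using Cauchy_Schwarz_ineq2[of "flux (G x)" "H x"] by (simp add: norm_flux)
      also have "\<dots> \<le> scalec 2 * (\<Phi> (norm (G x)) + \<Phi> (norm (H x)))" by (rule phi_mult_le) auto
      finally show "norm (flux (G x) \<bullet> H x) \<le> norm (scalec 2 * (\<Phi> (norm (G x)) + \<Phi> (norm (H x))))" by simp
    qed
  qed
qed

text \<open>The equation as an identity on the whole space. H may be any measurable representative
  of the gradient of v, in particular the classical gradient of a test function.\<close>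

lemma weak_solution_equation:
  fixes \<Omega> D :: "'a::euclidean_space set"
  assumes \<Omega>: "open \<Omega>" "\<Omega> \<subseteq> D" and u: "weak_solution \<Phi> \<phi> \<Omega> f u" and v: "v \<in> sobolev0 \<Phi> \<Omega>"
    and H: "AE x in lebesgue. indicator \<Omega> x *\<^sub>R weak_grad \<Omega> v x = H x" "H \<in> borel_measurable lebesgue"
  shows "(\<integral>x. flux (indicator \<Omega> x *\<^sub>R weak_grad \<Omega> u x) \<bullet> H x \<partial>lebesgue)
    = (\<integral>x. zero_ext D f x * zero_ext \<Omega> v x \<partial>lebesgue)"
proof -
  let ?G = "\<lambda>x. indicator \<Omega> x *\<^sub>R weak_grad \<Omega> u x"
  have "(\<integral>x. flux (?G x) \<bullet> H x \<partial>lebesgue) = (\<integral>x. flux (?G x) \<bullet> (indicator \<Omega> x *\<^sub>R weak_grad \<Omega> v x) \<partial>lebesgue)"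
  proof (rule integral_cong_AE)
    have "u \<in> sobolev0 \<Phi> \<Omega>" using u by (simp add: weak_solution_def)
    note [measurable] = Wpair_measurable(2)[OF sobolev0_Wpair[OF this \<Omega>(1)]]
      Wpair_measurable(2)[OF sobolev0_Wpair[OF v \<Omega>(1)]] H(2)
    show "(\<lambda>x. flux (?G x) \<bullet> H x) \<in> borel_measurable lebesgue"
      "(\<lambda>x. flux (?G x) \<bullet> (indicator \<Omega> x *\<^sub>R weak_grad \<Omega> v x)) \<in> borel_measurable lebesgue"
      by measurable
    show "AE x in lebesgue. flux (?G x) \<bullet> H x = flux (?G x) \<bullet> (indicator \<Omega> x *\<^sub>R weak_grad \<Omega> v x)"
      using H(1) by (rule eventually_mono) simp
  qed
  also have "\<dots> = (\<integral>x. \<phi> (norm (weak_grad \<Omega> u x)) / norm (weak_grad \<Omega> u x)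
      * (weak_grad \<Omega> u x \<bullet> weak_grad \<Omega> v x) \<partial>lebesgue_on \<Omega>)"
    unfolding integral_lebesgue_on[OF \<Omega>(1)]
    by (intro Bochner_Integration.integral_cong) (auto simp: flux_def indicator_def)
  also have "\<dots> = (\<integral>x. f x * v x \<partial>lebesgue_on \<Omega>)"
    using u v by (simp add: weak_solution_def)
  also have "\<dots> = (\<integral>x. zero_ext D f x * zero_ext \<Omega> v x \<partial>lebesgue)"
    unfolding integral_lebesgue_on[OF \<Omega>(1)] using \<Omega>(2)
    by (intro Bochner_Integration.integral_cong) (auto simp: zero_ext_def indicator_def)
  finally show ?thesis .
qed

lemma test_function_sobolev0:
  fixes \<Omega> :: "'a::euclidean_space set"
  assumes \<psi>: "\<psi> \<in> test_functions \<Omega>" and \<Omega>: "bounded \<Omega>" "open \<Omega>"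
  shows "\<psi> \<in> sobolev0 \<Phi> \<Omega>" "zero_ext \<Omega> \<psi> = \<psi>"
    "AE x in lebesgue. indicator \<Omega> x *\<^sub>R weak_grad \<Omega> \<psi> x = grad \<psi> x"
proof -
  obtain C where C: "C \<subseteq> \<Omega>" "\<And>x. x \<notin> C \<Longrightarrow> \<psi> x = 0" "\<And>x. x \<notin> C \<Longrightarrow> grad \<psi> x = 0"
    using test_functionE[OF \<psi>] by metis
  have z: "\<psi> x = 0" "grad \<psi> x = 0" if "x \<notin> \<Omega>" for x
    using C(1) C(2,3)[of x] that by blast+
  show "\<psi> \<in> sobolev0 \<Phi> \<Omega>" by (rule Wpair_sobolev0[OF Wpair_test[OF \<psi>] \<Omega>])
  show "zero_ext \<Omega> \<psi> = \<psi>" using z(1) by (auto simp: zero_ext_def fun_eq_iff)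
  show "AE x in lebesgue. indicator \<Omega> x *\<^sub>R weak_grad \<Omega> \<psi> x = grad \<psi> x"
    using Wpair_weak_grad_AE[OF Wpair_test[OF \<psi>] \<Omega>] z(2) by (auto simp: indicator_def elim!: eventually_mono)
qed

text \<open>Minimality with a remainder: \<open>Phi_uniformly_convex\<close> is integrated with a =
  G and b = \<nabla>\<psi>, and its linear term is evaluated by the equation, tested with \<psi> and
  with the solution itself.\<close>

lemma weak_solution_energy_gap:
  fixes \<Omega> D :: "'a::euclidean_space set"
  assumes \<Omega>: "bounded \<Omega>" "open \<Omega>" "\<Omega> \<subseteq> D" and u: "weak_solution \<Phi> \<phi> \<Omega> f u"
    and F: "zero_ext D f \<in> borel_measurable lebesgue" "cm (zero_ext D f) < \<infinity>"
    and \<psi>: "\<psi> \<in> test_functions \<Omega>"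
  defines "U \<equiv> zero_ext \<Omega> u" and "G \<equiv> \<lambda>x. indicator \<Omega> x *\<^sub>R weak_grad \<Omega> u x" and "F \<equiv> zero_ext D f"
  shows "En G - (\<integral>x. F x * U x \<partial>lebesgue) + 2 * En (\<lambda>x. (1/2) *\<^sub>R (G x - grad \<psi> x))
    \<le> En (grad \<psi>) - (\<integral>x. F x * \<psi> x \<partial>lebesgue)"
proof -
  have u0: "u \<in> sobolev0 \<Phi> \<Omega>" using u by (simp add: weak_solution_def)
  have W: "Wpair \<Omega> U G" unfolding U_def G_def by (rule sobolev0_Wpair[OF u0 \<Omega>(2)])
  note m = Wpair_measurable[OF W] test_function_lebesgue[OF \<psi>]
  note fin = Wpair_finite[OF W] md_test_finite[OF \<psi>]
  have Wd: "Wpair \<Omega> (\<lambda>x. U x - \<psi> x) (\<lambda>x. G x - grad \<psi> x)" by (rule Wpair_diff_test[OF W \<psi>])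
  have md: "(\<lambda>x. (1/2) *\<^sub>R (G x - grad \<psi> x)) \<in> borel_measurable lebesgue"
    using Wpair_measurable(2)[OF Wd] by measurable
  have "md (\<lambda>x. (1/2) *\<^sub>R (G x - grad \<psi> x)) \<le> md (\<lambda>x. G x - grad \<psi> x)" by (rule md_mono) simp
  then have fd: "md (\<lambda>x. (1/2) *\<^sub>R (G x - grad \<psi> x)) < \<infinity>"
    using Wpair_finite(2)[OF Wd] by (rule le_less_trans)
  have e1: "(\<integral>x. flux (G x) \<bullet> grad \<psi> x \<partial>lebesgue) = (\<integral>x. F x * \<psi> x \<partial>lebesgue)"
    using weak_solution_equation[OF \<Omega>(2,3) u test_function_sobolev0(1,3)[OF \<psi> \<Omega>(1,2)] m(4)]
    unfolding test_function_sobolev0(2)[OF \<psi> \<Omega>(1,2)] G_def F_def .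
  have e2: "(\<integral>x. flux (G x) \<bullet> G x \<partial>lebesgue) = (\<integral>x. F x * U x \<partial>lebesgue)"
    using weak_solution_equation[OF \<Omega>(2,3) u u0, of G] m(2) by (simp add: G_def F_def U_def)
  have i: "integrable lebesgue (\<lambda>x. flux (G x) \<bullet> grad \<psi> x)" "integrable lebesgue (\<lambda>x. flux (G x) \<bullet> G x)"
    by (intro flux_integrable m fin)+
  have p: "integrable lebesgue (\<lambda>x. \<Phi> (norm (G x)))" "integrable lebesgue (\<lambda>x. \<Phi> (norm (grad \<psi> x)))"
    "integrable lebesgue (\<lambda>x. \<Phi> (norm ((1/2) *\<^sub>R (G x - grad \<psi> x))))"
    by (rule Phi_integrable[OF m(2) fin(2)] Phi_integrable[OF m(4) fin(4)] Phi_integrable[OF md fd])+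
  have "(\<integral>x. (\<Phi> (norm (G x)) + (flux (G x) \<bullet> grad \<psi> x - flux (G x) \<bullet> G x))
      + 2 * \<Phi> (norm ((1/2) *\<^sub>R (G x - grad \<psi> x))) \<partial>lebesgue) \<le> (\<integral>x. \<Phi> (norm (grad \<psi> x)) \<partial>lebesgue)"
  proof (rule integral_mono)
    show "(\<Phi> (norm (G x)) + (flux (G x) \<bullet> grad \<psi> x - flux (G x) \<bullet> G x))
      + 2 * \<Phi> (norm ((1/2) *\<^sub>R (G x - grad \<psi> x))) \<le> \<Phi> (norm (grad \<psi> x))" for x
      using Phi_uniformly_convex[of "G x" "grad \<psi> x"] by (simp add: inner_diff_right)
  qed (intro Bochner_Integration.integrable_add Bochner_Integration.integrable_diff integrable_mult_right i p)+
  also have "(\<integral>x. (\<Phi> (norm (G x)) + (flux (G x) \<bullet> grad \<psi> x - flux (G x) \<bullet> G x))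
      + 2 * \<Phi> (norm ((1/2) *\<^sub>R (G x - grad \<psi> x))) \<partial>lebesgue)
      = (En G + ((\<integral>x. F x * \<psi> x \<partial>lebesgue) - (\<integral>x. F x * U x \<partial>lebesgue))) + 2 * En (\<lambda>x. (1/2) *\<^sub>R (G x - grad \<psi> x))"
    using i p unfolding En_def e1[symmetric] e2[symmetric]
    by (simp only: Bochner_Integration.integral_add Bochner_Integration.integral_diff integral_mult_right_zero
        Bochner_Integration.integrable_add Bochner_Integration.integrable_diff integrable_mult_right)
  finally show ?thesis unfolding En_def by linarith
qed

end


section \<open>Convergence of the solutions\<close>

lemma eventually_compact_subset:
  fixes \<Omega> D :: "'a::euclidean_space set"
  assumes lim: "(\<lambda>k. hausdorff_compl_distance (\<Omega>s k) \<Omega>) \<longlonglongrightarrow> 0"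
    and \<Omega>: "open \<Omega>" "bounded \<Omega>" and K: "compact K" "K \<subseteq> \<Omega>"
  shows "\<forall>\<^sub>F k in sequentially. K \<subseteq> \<Omega>s k"
proof -
  obtain d where d: "d > 0" "\<And>y. y \<in> K \<Longrightarrow> cball y d \<subseteq> \<Omega>"
    using compact_open_margin[OF K(1) \<Omega>(1) K(2)] by metis
  have "\<forall>\<^sub>F k in sequentially. hausdorff_compl_distance (\<Omega>s k) \<Omega> < ennreal d"
    using lim d(1) by (intro order_tendstoD(2)) auto
  then show ?thesis
  proof (rule eventually_mono)
    fix k assume k: "hausdorff_compl_distance (\<Omega>s k) \<Omega> < ennreal d"
    show "K \<subseteq> \<Omega>s k"
    proof (rule subsetI, rule ccontr)
      fix y assume y: "y \<in> K" "y \<notin> \<Omega>s k"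
      \<comment> \<open>Distances to the empty set are 0 by convention; boundedness of \<Omega>
        excludes this case.\<close>
      have ne: "- \<Omega> \<noteq> {}" using \<Omega>(2) not_bounded_UNIV by (metis Compl_empty_eq double_compl)
      have "d \<le> infdist y (- \<Omega>)"
        unfolding infdist_notempty[OF ne]
      proof (rule cINF_greatest[OF ne])
        fix z assume "z \<in> - \<Omega>"
        then have "z \<notin> cball y d" using d(2)[OF y(1)] by blast
        then show "d \<le> dist y z" by simp
      qed
      then have "ennreal d \<le> ennreal (infdist y (- \<Omega>))" by (rule ennreal_leI)
      also have "\<dots> \<le> (SUP a\<in>- \<Omega>s k. ennreal (infdist a (- \<Omega>)))" using y(2) by (intro SUP_upper) auto
      also have "\<dots> \<le> hausdorff_compl_distance (\<Omega>s k) \<Omega>"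
        unfolding hausdorff_compl_distance_def hausdorff_distance_def by (rule sup_ge1)
      finally show False using k by simp
    qed
  qed
qed

context young
begin

text \<open>Some open U around E has capacity below \<delta>; K is among the compact sets in the
  supremum for U, so it has an admissible function of small energy, which is then mollified.\<close>

lemma capacity_test_function:
  fixes D E :: "'a::euclidean_space set"
  assumes "open D" and cap: "capacity \<Phi> E D < ennreal \<delta>" and K: "compact K" "K \<subseteq> E"
  shows "\<exists>w\<in>test_functions D. (\<forall>x\<in>K. w x > 1) \<and> (\<forall>x. w x \<ge> 0) \<and> md (grad w) \<le> ennreal \<delta>"
proof -
  obtain U where U: "open U" "E \<subseteq> U" "U \<subseteq> D" "cap_open \<Phi> U D < ennreal \<delta>"
    using cap unfolding capacity_def INF_less_iff by blast
  have KU: "K \<subseteq> U" using K(2) U(2) by blast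
  have "cap_compact \<Phi> K D \<le> cap_open \<Phi> U D"
    unfolding cap_open_def using K(1) KU by (intro SUP_upper) auto
  then have "cap_compact \<Phi> K D < ennreal \<delta>" using U(4) by (rule le_less_trans)
  then obtain \<eta> where \<eta>: "\<eta> \<in> cap_admissible \<Phi> K D" "orlicz_modular \<Phi> D (\<lambda>x. norm (weak_grad D \<eta> x)) < ennreal \<delta>"
    unfolding cap_compact_def INF_less_iff by blast
  have "K \<subseteq> D" using KU U(3) by blast
  from admissible_test_function[OF assms(1) K(1) this \<eta>(1)] \<eta>(2) show ?thesis
    by (meson less_imp_le order_trans)
qed

lemma pairing_diff_le:
  fixes F u v :: "'a::euclidean_space \<Rightarrow> real"
  assumes F: "F \<in> borel_measurable lebesgue" "cm F < \<infinity>"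
    and u: "u \<in> borel_measurable lebesgue" "md u < \<infinity>" and v: "v \<in> borel_measurable lebesgue" "md v < \<infinity>"
    and e: "(\<integral>\<^sup>+x. ennreal \<bar>F x * (u x - v x)\<bar> \<partial>lebesgue) \<le> ennreal e" "e \<ge> 0"
  shows "\<bar>(\<integral>x. F x * u x \<partial>lebesgue) - (\<integral>x. F x * v x \<partial>lebesgue)\<bar> \<le> e"
proof -
  note i = pairing_integrable[OF F u] pairing_integrable[OF F v]
  have eq: "(\<integral>x. F x * u x \<partial>lebesgue) - (\<integral>x. F x * v x \<partial>lebesgue) = (\<integral>x. F x * (u x - v x) \<partial>lebesgue)"
    using Bochner_Integration.integral_diff[OF i] by (simp add: right_diff_distrib)
  have "integrable lebesgue (\<lambda>x. F x * (u x - v x))"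
    using Bochner_Integration.integrable_diff[OF i] by (simp add: right_diff_distrib)
  from integral_norm_bound_ennreal[OF this] e(1)
  have "ennreal \<bar>\<integral>x. F x * (u x - v x) \<partial>lebesgue\<bar> \<le> ennreal e" by simp
  then show ?thesis unfolding eq using e(2) by (simp add: ennreal_le_iff)
qed

text \<open>Modular closeness alone bounds energies up to a factor; the excess is made additive by
  \<open>md_add\<close> with \<epsilon> such that \<epsilon> times the energy of g is at most
  e/2.\<close>

lemma Wpair_approx_energy:
  fixes u :: "'a::euclidean_space \<Rightarrow> real"
  assumes F: "F \<in> borel_measurable lebesgue" "cm F < \<infinity>" and W: "Wpair \<Omega> u g" and e: "e > 0"
  shows "\<exists>\<psi>\<in>test_functions \<Omega>. md (\<lambda>x. g x - grad \<psi> x) \<le> ennreal e \<and> En (grad \<psi>) \<le> En g + e \<and>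
    \<bar>(\<integral>x. F x * \<psi> x \<partial>lebesgue) - (\<integral>x. F x * u x \<partial>lebesgue)\<bar> \<le> e"
proof -
  note m = Wpair_measurable[OF W] and fin = Wpair_finite[OF W]
  have g: "md g = ennreal (En g)" by (rule md_eq_En[OF m(2) fin(2)])
  define \<epsilon> where "\<epsilon> = e / (2 * (En g + 1))"
  have g0: "En g \<ge> 0" by (rule En_nonneg)
  have \<epsilon>: "\<epsilon> > 0" using e g0 by (simp add: \<epsilon>_def)
  have \<epsilon>g: "\<epsilon> * En g \<le> e / 2"
  proof -
    have "\<epsilon> * En g = e / 2 * (En g / (En g + 1))" by (simp add: \<epsilon>_def)
    also have "\<dots> \<le> e / 2 * 1" using e g0 by (intro mult_left_mono) auto
    finally show ?thesis by simp
  qed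
  define K where "K = addc \<epsilon>"
  have K: "K > 0" unfolding K_def by (rule addc_pos)
  obtain d0 where d0: "d0 > 0" "\<forall>v. v \<in> borel_measurable lebesgue \<longrightarrow> md v \<le> ennreal d0 \<longrightarrow>
    (\<integral>\<^sup>+x. ennreal \<bar>F x * v x\<bar> \<partial>lebesgue) \<le> ennreal e"
    using pairing_small[OF F e] by auto
  define d where "d = min (min d0 e) (e / (2 * K))"
  have d: "d > 0" "d \<le> d0" "d \<le> e" "K * d \<le> e / 2"
  proof -
    show "d > 0" "d \<le> d0" "d \<le> e" using d0(1) e K by (auto simp: d_def)
    have "d \<le> e / (2 * K)" by (simp add: d_def)
    then show "K * d \<le> e / 2" using K by (simp add: field_simps)
  qed
  obtain \<psi> where \<psi>: "\<psi> \<in> test_functions \<Omega>" "md (\<lambda>x. u x - \<psi> x) \<le> ennreal d" "md (\<lambda>x. g x - grad \<psi> x) \<le> ennreal d"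
    using Wpair_approx[OF W d(1)] by metis
  note m\<psi> = test_function_lebesgue[OF \<psi>(1)] and f\<psi> = md_test_finite[OF \<psi>(1)]
  note [measurable] = m m\<psi>
  show ?thesis
  proof (intro bexI[OF _ \<psi>(1)] conjI)
    show "md (\<lambda>x. g x - grad \<psi> x) \<le> ennreal e" using \<psi>(3) ennreal_leI[OF d(3)] by (rule order_trans)
    have "md (grad \<psi>) = md (\<lambda>x. g x + (grad \<psi> x - g x))" by simp
    also have "\<dots> \<le> ennreal (1 + \<epsilon>) * md g + ennreal K * md (\<lambda>x. grad \<psi> x - g x)"
      unfolding K_def by (rule md_add[OF \<epsilon>]) measurable
    also have "\<dots> \<le> ennreal (1 + \<epsilon>) * ennreal (En g) + ennreal K * ennreal d"
      using \<psi>(3) unfolding md_minus_commute[of "grad \<psi>"] g by (intro add_mono mult_left_mono) auto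
    also have "\<dots> = ennreal ((1 + \<epsilon>) * En g + K * d)"
      using \<epsilon> g0 K d(1) by (simp add: ennreal_mult[symmetric] ennreal_plus[symmetric] del: ennreal_plus)
    finally have "En (grad \<psi>) \<le> (1 + \<epsilon>) * En g + K * d"
      unfolding md_eq_En[OF m\<psi>(2) f\<psi>(2)] using \<epsilon> g0 K d(1)
      by (simp add: ennreal_le_iff del: ennreal_plus)
    then show "En (grad \<psi>) \<le> En g + e" using \<epsilon>g d(4) by (simp add: distrib_right)
    have "md (\<lambda>x. \<psi> x - u x) \<le> ennreal d0"
      using order_trans[OF \<psi>(2) ennreal_leI[OF d(2)]] by (simp add: md_minus_commute[of \<psi>])
    then have "(\<integral>\<^sup>+x. ennreal \<bar>F x * (\<psi> x - u x)\<bar> \<partial>lebesgue) \<le> ennreal e"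
      by (intro d0(2)[rule_format]) measurable
    then show "\<bar>(\<integral>x. F x * \<psi> x \<partial>lebesgue) - (\<integral>x. F x * u x \<partial>lebesgue)\<bar> \<le> e"
      using e by (intro pairing_diff_le F m m\<psi> fin f\<psi>) auto
  qed
qed

text \<open>Comparison with zero bounds the energy by the pairing with f. Young's and Poincare's
  inequalities bound that by a constant plus half the energy, which is finite and can be absorbed.
  The constant depends on D and f only.\<close>

lemma weak_solution_energy_bound:
  fixes D :: "'a::euclidean_space set"
  assumes D: "open D" "bounded D" and F: "zero_ext D f \<in> borel_measurable lebesgue" "cm (zero_ext D f) < \<infinity>"
  shows "\<exists>C>0. \<forall>\<Omega> u. open \<Omega> \<longrightarrow> \<Omega> \<subseteq> D \<longrightarrow> weak_solution \<Phi> \<phi> \<Omega> f u \<longrightarrow>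
    En (\<lambda>x. indicator \<Omega> x *\<^sub>R weak_grad \<Omega> u x) \<le> C"
proof -
  let ?F = "zero_ext D f"
  obtain P where P: "P > 0" "\<forall>u g. Wpair D u g \<longrightarrow> md u \<le> ennreal P * md g"
    using Wpair_poincare[OF D(2)] by auto
  \<comment> \<open>With l \<ge> 2 P the Poincare term is at most half the energy.\<close>
  define l where "l = max 1 (2 * P)"
  have l: "l \<ge> 1" "P / l \<le> 1 / 2"
  proof -
    show l1: "l \<ge> 1" by (simp add: l_def)
    have "2 * P \<le> l" by (simp add: l_def)
    then show "P / l \<le> 1 / 2" using l1 by (simp add: field_simps)
  qed
  define c where "c = enn2real (cm (\<lambda>x. l * ?F x))"
  have c: "cm (\<lambda>x. l * ?F x) = ennreal c" "c \<ge> 0"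
    using cm_finite_scale[OF F l(1)] by (auto simp: c_def)
  show ?thesis
  proof (intro exI[of _ "2 * c + 1"] conjI allI impI)
    show "2 * c + 1 > 0" using c(2) by simp
    fix \<Omega> u assume \<Omega>: "open \<Omega>" "\<Omega> \<subseteq> D" and u: "weak_solution \<Phi> \<phi> \<Omega> f u"
    define G where "G = (\<lambda>x. indicator \<Omega> x *\<^sub>R weak_grad \<Omega> u x)"
    define U where "U = zero_ext \<Omega> u"
    have u0: "u \<in> sobolev0 \<Phi> \<Omega>" using u by (simp add: weak_solution_def)
    have W: "Wpair \<Omega> U G" unfolding U_def G_def by (rule sobolev0_Wpair[OF u0 \<Omega>(1)])
    note m = Wpair_measurable[OF W] and fin = Wpair_finite[OF W]
    have b\<Omega>: "bounded \<Omega>" using D(2) \<Omega>(2) by (rule bounded_subset)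
    have "En (grad (\<lambda>x::'a. 0)) = 0" by (simp add: En_def)
    then have "En G \<le> (\<integral>x. ?F x * U x \<partial>lebesgue)"
      using weak_solution_energy_gap[OF b\<Omega> \<Omega> u F test_function_zero] En_nonneg[of "\<lambda>x. (1/2) *\<^sub>R (G x - grad (\<lambda>x. 0) x)"]
      unfolding G_def U_def by simp
    also have "\<dots> \<le> \<bar>\<integral>x. ?F x * U x \<partial>lebesgue\<bar>" by simp
    finally have "ennreal (En G) \<le> ennreal \<bar>\<integral>x. ?F x * U x \<partial>lebesgue\<bar>" by (rule ennreal_leI)
    also have "\<dots> \<le> (\<integral>\<^sup>+x. ennreal \<bar>?F x * U x\<bar> \<partial>lebesgue)"
      using integral_norm_bound_ennreal[OF pairing_integrable[OF F m(1) fin(1)]] by simp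
    also have "\<dots> \<le> cm (\<lambda>x. l * ?F x) + md (\<lambda>x. U x /\<^sub>R l)"
      using l(1) by (intro pairing_le F m) auto
    also have "md (\<lambda>x. U x /\<^sub>R l) \<le> ennreal (1 / l) * md U" by (rule md_divide_le[OF m(1) l(1)])
    also have "md U \<le> ennreal P * md G" using P(2) Wpair_mono[OF W \<Omega>(2)] by blast
    also have "md G = ennreal (En G)" by (rule md_eq_En[OF m(2) fin(2)])
    also have "ennreal (1 / l) * (ennreal P * ennreal (En G)) = ennreal (P / l * En G)"
      using l(1) P(1) En_nonneg[of G] by (simp add: ennreal_mult[symmetric])
    also have "\<dots> \<le> ennreal (1 / 2 * En G)"
      using l(2) En_nonneg[of G] by (intro ennreal_leI mult_right_mono) auto
    finally have "ennreal (En G) \<le> ennreal c + ennreal (1 / 2 * En G)"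
      unfolding c(1) by (simp add: add_left_mono mult_left_mono)
    also have "\<dots> = ennreal (c + 1 / 2 * En G)"
      using c(2) En_nonneg[of G] by (simp add: ennreal_plus)
    finally have "En G \<le> c + 1 / 2 * En G"
      using c(2) En_nonneg[of G] by (simp add: ennreal_le_iff del: ennreal_plus)
    then show "En (\<lambda>x. indicator \<Omega> x *\<^sub>R weak_grad \<Omega> u x) \<le> 2 * c + 1" unfolding G_def by simp
  qed
qed

text \<open>One fixed test function v of \<Omega> is both the competitor on the varying sets and the
  intermediate field between the two gradients. \<open>lower\<close> gives the opposite comparison
  of the minima, so the remainder in the energy gap must be small.\<close>

lemma md_gradient_convergence:
  fixes D \<Omega> :: "'a::euclidean_space set"
  assumes D: "open D" "bounded D" and F: "zero_ext D f \<in> borel_measurable lebesgue" "cm (zero_ext D f) < \<infinity>"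
    and \<Omega>s: "\<And>k. open (\<Omega>s k) \<and> \<Omega>s k \<subseteq> D" and \<Omega>: "open \<Omega>" "\<Omega> \<subseteq> D"
    and haus: "(\<lambda>k. hausdorff_compl_distance (\<Omega>s k) \<Omega>) \<longlonglongrightarrow> 0"
    and cap: "(\<lambda>k. capacity \<Phi> (\<Omega>s k - \<Omega>) D) \<longlonglongrightarrow> 0"
    and us: "\<And>k. weak_solution \<Phi> \<phi> (\<Omega>s k) f (us k)" and u: "weak_solution \<Phi> \<phi> \<Omega> f u"
    and e: "e > 0"
  shows "\<forall>\<^sub>F k in sequentially. md (\<lambda>x. indicator (\<Omega>s k) x *\<^sub>R weak_grad (\<Omega>s k) (us k) x
    - indicator \<Omega> x *\<^sub>R weak_grad \<Omega> u x) \<le> ennreal e"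
proof -
  let ?F = "zero_ext D f"
  define G where "G = (\<lambda>x. indicator \<Omega> x *\<^sub>R weak_grad \<Omega> u x)"
  define U where "U = zero_ext \<Omega> u"
  define Gs where "Gs k = (\<lambda>x. indicator (\<Omega>s k) x *\<^sub>R weak_grad (\<Omega>s k) (us k) x)" for k
  define Us where "Us k = zero_ext (\<Omega>s k) (us k)" for k
  have b: "bounded \<Omega>" "bounded (\<Omega>s k)" for k
    using bounded_subset[OF D(2) \<Omega>(2)] bounded_subset[OF D(2), of "\<Omega>s k"] \<Omega>s[of k] by simp_all
  have o: "open (\<Omega>s k)" "\<Omega>s k \<subseteq> D" for k using \<Omega>s by auto
  have W: "Wpair \<Omega> U G" unfolding U_def G_def
    using u by (intro sobolev0_Wpair[OF _ \<Omega>(1)]) (simp add: weak_solution_def)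
  have Ws: "Wpair (\<Omega>s k) (Us k) (Gs k)" for k unfolding Us_def Gs_def
    using us[of k] by (intro sobolev0_Wpair[OF _ o(1)]) (simp add: weak_solution_def)
  let ?l = "\<lambda>v. \<integral>x. ?F x * v x \<partial>lebesgue"
  have gap: "En G - ?l U + 2 * En (\<lambda>x. (1/2) *\<^sub>R (G x - grad \<psi> x)) \<le> En (grad \<psi>) - ?l \<psi>"
    if "\<psi> \<in> test_functions \<Omega>" for \<psi>
    unfolding G_def U_def by (rule weak_solution_energy_gap[OF b(1) \<Omega> u F that])
  have gaps: "En (Gs k) - ?l (Us k) + 2 * En (\<lambda>x. (1/2) *\<^sub>R (Gs k x - grad \<psi> x)) \<le> En (grad \<psi>) - ?l \<psi>"
    if "\<psi> \<in> test_functions (\<Omega>s k)" for \<psi> k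
    unfolding Gs_def Us_def by (rule weak_solution_energy_gap[OF b(2) o us F that])
  obtain C where C0: "C > 0" "\<forall>\<Omega> u. open \<Omega> \<longrightarrow> \<Omega> \<subseteq> D \<longrightarrow> weak_solution \<Phi> \<phi> \<Omega> f u \<longrightarrow>
    En (\<lambda>x. indicator \<Omega> x *\<^sub>R weak_grad \<Omega> u x) \<le> C"
    using weak_solution_energy_bound[OF D F] by (elim exE conjE)
  have C: "C > 0" "En (Gs k) \<le> C" for k
    unfolding Gs_def by (rule C0(1), rule C0(2)[rule_format, OF o us])
  define K1 K2 where "K1 = 2 + addc 1 * scalec 1" and "K2 = scalec 2"
  have K: "K1 > 0" "K2 > 0" using addc_pos[of 1] scalec_pos[of 1] by (simp_all add: K1_def K2_def add_pos_pos scalec_pos)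
  \<comment> \<open>The remainder will be at most 3 \<epsilon>; doubling the halved difference costs
    \<open>K2\<close>, and the triangle inequality costs \<open>K1\<close>.\<close>
  define \<epsilon> where "\<epsilon> = e / (K1 * (3 * K2 + 1))"
  have \<epsilon>: "\<epsilon> > 0" "K1 * (K2 * (3 * \<epsilon>) + \<epsilon>) = e"
  proof -
    have p: "K1 * (3 * K2 + 1) > 0" using K by simp
    show "\<epsilon> > 0" unfolding \<epsilon>_def using p e by (rule divide_pos_pos[rotated])
    have "K1 * (K2 * (3 * \<epsilon>) + \<epsilon>) = \<epsilon> * (K1 * (3 * K2 + 1))" by (simp add: algebra_simps)
    also have "\<dots> = e" unfolding \<epsilon>_def using nonzero_eq_divide_eq[OF less_imp_neq[OF p, symmetric]] by blast
    finally show "K1 * (K2 * (3 * \<epsilon>) + \<epsilon>) = e" .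
  qed
  obtain v where v: "v \<in> test_functions \<Omega>" "md (\<lambda>x. G x - grad v x) \<le> ennreal \<epsilon>" "En (grad v) \<le> En G + \<epsilon>"
    "\<bar>?l v - ?l U\<bar> \<le> \<epsilon>"
    using Wpair_approx_energy[OF F W \<epsilon>(1)] by blast
  obtain Cv where Cv: "smooth v" "compact Cv" "Cv \<subseteq> \<Omega>" "\<And>x. x \<notin> Cv \<Longrightarrow> v x = 0"
    using test_functionE[OF v(1)] by metis
  have ev1: "\<forall>\<^sub>F k in sequentially. Cv \<subseteq> \<Omega>s k"
    by (rule eventually_compact_subset[OF haus \<Omega>(1) b(1) Cv(2,3)])
  have F0: "?F x = 0" if "x \<notin> D" for x using that by (simp add: zero_ext_def)
  \<comment> \<open>This bounds the energy of every \<psi> used below, so M and \<delta> can be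
    fixed before k.\<close>
  have "C + \<epsilon> > 0" using C(1) \<epsilon>(1) by simp
  from truncated_cutoff[OF F D F0 this \<epsilon>(1)]
  obtain M \<delta> where M: "M > 0" "\<delta> > 0" and T: "\<forall>\<psi>\<in>test_functions D. \<forall>\<eta>\<in>test_functions D. (\<forall>x. \<eta> x \<ge> 0) \<longrightarrow>
    md (grad \<psi>) \<le> ennreal (C + \<epsilon>) \<longrightarrow> md (grad \<eta>) \<le> ennreal \<delta> \<longrightarrow>
    md (grad (\<lambda>x. M * sin (\<psi> x / M) * cutoff (\<eta> x))) \<le> md (grad \<psi>) + ennreal \<epsilon> \<and>
    (\<integral>\<^sup>+x. ennreal \<bar>?F x * (\<psi> x - M * sin (\<psi> x / M) * cutoff (\<eta> x))\<bar> \<partial>lebesgue) \<le> ennreal \<epsilon>"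
    by blast
  have ev2: "\<forall>\<^sub>F k in sequentially. capacity \<Phi> (\<Omega>s k - \<Omega>) D < ennreal \<delta>"
    using cap M(2) by (intro order_tendstoD(2)) auto
  \<comment> \<open>Two \<epsilon> are lost in replacing the solution by \<psi>, one in the energy
    and one in the pairing, and two more in passing from \<psi> to w.\<close>
  have lower: "En G - ?l U \<le> En (Gs k) - ?l (Us k) + 4 * \<epsilon>" if k: "capacity \<Phi> (\<Omega>s k - \<Omega>) D < ennreal \<delta>" for k
  proof -
    obtain \<psi> where \<psi>: "\<psi> \<in> test_functions (\<Omega>s k)" "En (grad \<psi>) \<le> En (Gs k) + \<epsilon>" "\<bar>?l \<psi> - ?l (Us k)\<bar> \<le> \<epsilon>"
      using Wpair_approx_energy[OF F Ws \<epsilon>(1)] by blast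
    obtain S where S: "smooth \<psi>" "compact S" "S \<subseteq> \<Omega>s k" "\<And>x. x \<notin> S \<Longrightarrow> \<psi> x = 0"
      using test_functionE[OF \<psi>(1)] by metis
    have K: "compact (S - \<Omega>)" "S - \<Omega> \<subseteq> \<Omega>s k - \<Omega>" using S(2,3) \<Omega>(1) by (auto intro: compact_diff)
    obtain \<eta> where \<eta>: "\<eta> \<in> test_functions D" "\<And>x. x \<in> S - \<Omega> \<Longrightarrow> \<eta> x > 1" "\<forall>x. \<eta> x \<ge> 0" "md (grad \<eta>) \<le> ennreal \<delta>"
      using capacity_test_function[OF D(1) k K] by blast
    define w where "w x = M * sin (\<psi> x / M) * cutoff (\<eta> x)" for x
    have \<psi>D: "\<psi> \<in> test_functions D" using \<psi>(1) test_functions_mono[OF o(2)] by blast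
    have sm\<eta>: "smooth \<eta>" by (rule test_function_smooth[OF \<eta>(1)])
    have w\<Omega>: "w \<in> test_functions \<Omega>"
    proof (rule test_functionI)
      have "smooth (\<lambda>x. M * sin (1 / M * \<psi> x) * cutoff (\<eta> x))"
        by (intro smooth_mult smooth_const smooth_sin smooth_cutoff S(1) sm\<eta>)
      then show "smooth w" by (simp add: w_def[abs_def])
      have "closed {x. \<eta> x \<le> 1}"
        by (intro closed_Collect_le continuous_on_const smooth_continuous[OF sm\<eta>])
      \<comment> \<open>Points of S outside \<Omega> have \<eta> > 1, so this part of S lies in
        \<Omega>; and w vanishes where \<eta> \<ge> 1.\<close>
      then show "compact (S \<inter> {x. \<eta> x \<le> 1})" using S(2) by (rule compact_Int_closed[rotated])
      show "S \<inter> {x. \<eta> x \<le> 1} \<subseteq> \<Omega>"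
      proof
        fix x assume x: "x \<in> S \<inter> {x. \<eta> x \<le> 1}"
        show "x \<in> \<Omega>"
        proof (rule ccontr)
          assume "x \<notin> \<Omega>"
          then show False using \<eta>(2)[of x] x by simp
        qed
      qed
      show "w x = 0" if "x \<notin> S \<inter> {x. \<eta> x \<le> 1}" for x
        using that S(4)[of x] cutoff_eq_0[of "\<eta> x"] by (cases "x \<in> S") (auto simp: w_def)
    qed
    note fins = md_test_finite[OF \<psi>(1)] md_test_finite[OF w\<Omega>]
    note ms = test_function_lebesgue[OF \<psi>(1)] test_function_lebesgue[OF w\<Omega>]
    have "En (grad \<psi>) \<le> C + \<epsilon>" using \<psi>(2) C(2)[of k] by linarith
    then have "md (grad \<psi>) \<le> ennreal (C + \<epsilon>)"
      unfolding md_eq_En[OF ms(2) fins(2)] by (rule ennreal_leI)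
    then have Tw: "md (grad w) \<le> md (grad \<psi>) + ennreal \<epsilon>"
      "(\<integral>\<^sup>+x. ennreal \<bar>?F x * (\<psi> x - w x)\<bar> \<partial>lebesgue) \<le> ennreal \<epsilon>"
      using T \<psi>D \<eta>(1,3,4) unfolding w_def[abs_def] by blast+
    have "En (grad w) \<le> En (grad \<psi>) + \<epsilon>"
      using Tw(1) \<epsilon>(1) En_nonneg[of "grad \<psi>"] unfolding md_eq_En[OF ms(2) fins(2)] md_eq_En[OF ms(4) fins(4)]
      by (simp add: ennreal_plus[symmetric] ennreal_le_iff del: ennreal_plus)
    moreover have "\<bar>?l \<psi> - ?l w\<bar> \<le> \<epsilon>"
      using Tw(2) \<epsilon>(1) by (intro pairing_diff_le F ms fins) auto
    moreover have "En G - ?l U \<le> En (grad w) - ?l w"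
      using gap[OF w\<Omega>] En_nonneg[of "\<lambda>x. (1/2) *\<^sub>R (G x - grad w x)"] by linarith
    ultimately show ?thesis using \<psi>(2,3) by linarith
  qed
  from ev1 ev2 have "\<forall>\<^sub>F k in sequentially. md (\<lambda>x. Gs k x - G x) \<le> ennreal e"
  proof eventually_elim
    fix k assume k: "Cv \<subseteq> \<Omega>s k" "capacity \<Phi> (\<Omega>s k - \<Omega>) D < ennreal \<delta>"
    have vk: "v \<in> test_functions (\<Omega>s k)" by (rule test_functionI[OF Cv(1,2) k(1) Cv(4)])
    let ?h = "\<lambda>x. (1/2) *\<^sub>R (Gs k x - grad v x)"
    \<comment> \<open>Twice the remainder is at most 4 \<epsilon> from \<open>lower\<close> plus 2
      \<epsilon> from replacing the solution on \<Omega> by v.\<close>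
    have h: "En ?h \<le> 3 * \<epsilon>" using gaps[OF vk] lower[OF k(2)] v(3,4) by linarith
    note [measurable] = Wpair_measurable[OF W] Wpair_measurable[OF Ws] test_function_lebesgue[OF v(1)]
    have mh: "?h \<in> borel_measurable lebesgue" by measurable
    have Wd: "Wpair (\<Omega>s k) (\<lambda>x. Us k x - v x) (\<lambda>x. Gs k x - grad v x)" by (rule Wpair_diff_test[OF Ws vk])
    have "md ?h \<le> md (\<lambda>x. Gs k x - grad v x)" by (rule md_mono) simp
    also have "\<dots> < \<infinity>" by (rule Wpair_finite(2)[OF Wd])
    finally have fh: "md ?h < \<infinity>" .
    have "md (\<lambda>x. Gs k x - grad v x) = md (\<lambda>x. 2 *\<^sub>R ?h x)" by simp
    also have "\<dots> \<le> ennreal K2 * md ?h" unfolding K2_def using mh by (rule md_scale)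
    also have "md ?h = ennreal (En ?h)" by (rule md_eq_En[OF mh fh])
    also have "ennreal K2 * \<dots> \<le> ennreal K2 * ennreal (3 * \<epsilon>)" by (intro mult_left_mono ennreal_leI h) auto
    finally have 1: "md (\<lambda>x. Gs k x - grad v x) \<le> ennreal (K2 * (3 * \<epsilon>))"
      using K(2) \<epsilon>(1) by (simp add: ennreal_mult)
    have 2: "md (\<lambda>x. grad v x - G x) \<le> ennreal \<epsilon>" using v(2) by (simp add: md_minus_commute)
    have "md (\<lambda>x. Gs k x - G x) = md (\<lambda>x. (Gs k x - grad v x) + (grad v x - G x))" by simp
    also have "\<dots> \<le> ennreal K1 * (md (\<lambda>x. Gs k x - grad v x) + md (\<lambda>x. grad v x - G x))"
      unfolding K1_def using md_lincomb[of "\<lambda>x. Gs k x - grad v x" "\<lambda>x. grad v x - G x" 1] by simp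
    also have "\<dots> \<le> ennreal K1 * (ennreal (K2 * (3 * \<epsilon>)) + ennreal \<epsilon>)"
      by (intro mult_left_mono add_mono 1 2) auto
    also have "\<dots> = ennreal (K1 * (K2 * (3 * \<epsilon>) + \<epsilon>))"
      using K \<epsilon>(1) by (simp add: ennreal_mult[symmetric] ennreal_plus[symmetric] del: ennreal_plus)
    finally show "md (\<lambda>x. Gs k x - G x) \<le> ennreal e" unfolding \<epsilon>(2) .
  qed
  then show ?thesis unfolding Gs_def G_def .
qed

text \<open>Modular convergence of the gradients and the Poincare inequality give convergence in the
  Sobolev norm, and a bounded functional cannot see a difference that tends to 0 in norm.\<close>

lemma weak_convergence:
  fixes D \<Omega> :: "'a::euclidean_space set"
  assumes D: "open D" "bounded D" and f: "f \<in> orlicz_space \<Phi>c D"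
    and \<Omega>s: "\<And>k. open (\<Omega>s k) \<and> \<Omega>s k \<subseteq> D" and \<Omega>: "open \<Omega>" "\<Omega> \<subseteq> D"
    and haus: "(\<lambda>k. hausdorff_compl_distance (\<Omega>s k) \<Omega>) \<longlonglongrightarrow> 0"
    and cap: "(\<lambda>k. capacity \<Phi> (\<Omega>s k - \<Omega>) D) \<longlonglongrightarrow> 0"
    and us: "\<And>k. weak_solution \<Phi> \<phi> (\<Omega>s k) f (us k)" and u: "weak_solution \<Phi> \<phi> \<Omega> f u"
  shows "weakly_converges_sobolev0 \<Phi> D (\<lambda>k. zero_ext (\<Omega>s k) (us k)) (zero_ext \<Omega> u)"
proof -
  have F_eq: "zero_ext D f = (\<lambda>x. indicator D x *\<^sub>R f x)" by (auto simp: zero_ext_def indicator_def)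
  have F: "zero_ext D f \<in> borel_measurable lebesgue"
    using f unfolding F_eq by (simp only: orlicz_space_def measurable_lebesgue_on_iff[OF D(1), symmetric] mem_Collect_eq)
  have "orlicz_modular \<Phi>c D f = (\<integral>\<^sup>+x. ennreal (\<Phi>c \<bar>f x\<bar>) * indicator D x \<partial>lebesgue)"
    unfolding orlicz_modular_def using D(1) by (intro nn_integral_restrict_space) auto
  also have "\<dots> = cm (zero_ext D f)"
    unfolding cm_def by (intro nn_integral_cong) (auto simp: zero_ext_def indicator_def)
  finally have Ff: "cm (zero_ext D f) < \<infinity>" using f by (simp add: orlicz_space_def)
  define G where "G = (\<lambda>x. indicator \<Omega> x *\<^sub>R weak_grad \<Omega> u x)"
  define U where "U = zero_ext \<Omega> u"
  define Gs where "Gs k = (\<lambda>x. indicator (\<Omega>s k) x *\<^sub>R weak_grad (\<Omega>s k) (us k) x)" for k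
  define Us where "Us k = zero_ext (\<Omega>s k) (us k)" for k
  have W: "Wpair D U G" unfolding U_def G_def
    using u by (intro Wpair_mono[OF sobolev0_Wpair[OF _ \<Omega>(1)] \<Omega>(2)]) (simp add: weak_solution_def)
  have Ws: "Wpair D (Us k) (Gs k)" for k unfolding Us_def Gs_def
    using us[of k] \<Omega>s by (intro Wpair_mono[OF sobolev0_Wpair]) (auto simp: weak_solution_def)
  \<comment> \<open>Differences are written with the factor -1 to match the two linearity clauses in
    \<open>sobolev0_dual\<close>.\<close>
  have Wd: "Wpair D (\<lambda>x. Us k x + (-1) * U x) (\<lambda>x. Gs k x + (-1) *\<^sub>R G x)" for k
    by (rule Wpair_add[OF Ws W])
  have WU: "Wpair D (\<lambda>x. (-1) * U x) (\<lambda>x. (-1) *\<^sub>R G x)"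
    using Wpair_add[OF Wpair_test[OF test_function_zero] W, of "-1"] by simp
  obtain P where P: "P > 0" "\<forall>u g. Wpair D u g \<longrightarrow> md u \<le> ennreal P * md g"
    using Wpair_poincare[OF D(2)] by auto
  have norm_lim: "(\<lambda>k. sobolev_norm \<Phi> D (\<lambda>x. Us k x + (-1) * U x)) \<longlonglongrightarrow> 0"
  proof (rule LIMSEQ_I)
    fix r :: real assume "r > 0"
    then have "r / 2 > 0" by simp
    from sobolev_norm_small[OF this, where 'a = 'a]
    obtain \<delta> where \<delta>: "\<delta> > 0" "\<forall>(D :: 'a set) u g. Wpair D u g \<longrightarrow> bounded D \<longrightarrow> open D \<longrightarrow>
      md u \<le> ennreal \<delta> \<longrightarrow> md g \<le> ennreal \<delta> \<longrightarrow> 0 \<le> sobolev_norm \<Phi> D u \<and> sobolev_norm \<Phi> D u \<le> r / 2"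
      by auto
    define d where "d = min \<delta> (\<delta> / P)"
    have d: "d > 0" "d \<le> \<delta>" "P * d \<le> \<delta>"
    proof -
      show "d > 0" "d \<le> \<delta>" using \<delta>(1) P(1) by (auto simp: d_def)
      have "d \<le> \<delta> / P" by (simp add: d_def)
      then show "P * d \<le> \<delta>" using P(1) by (simp add: field_simps)
    qed
    have "\<forall>\<^sub>F k in sequentially. md (\<lambda>x. Gs k x - G x) \<le> ennreal d"
      unfolding Gs_def G_def by (rule md_gradient_convergence[OF D F Ff \<Omega>s \<Omega> haus cap us u d(1)])
    then obtain N where N: "\<And>k. k \<ge> N \<Longrightarrow> md (\<lambda>x. Gs k x - G x) \<le> ennreal d"
      unfolding eventually_sequentially by blast
    have "norm (sobolev_norm \<Phi> D (\<lambda>x. Us k x + (-1) * U x) - 0) < r" if "k \<ge> N" for k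
    proof -
      have g: "md (\<lambda>x. Gs k x + (-1) *\<^sub>R G x) \<le> ennreal d" using N[OF that] by simp
      have "md (\<lambda>x. Us k x + (-1) * U x) \<le> ennreal P * md (\<lambda>x. Gs k x + (-1) *\<^sub>R G x)"
        using P(2) Wd by blast
      also have "\<dots> \<le> ennreal P * ennreal d" by (intro mult_left_mono g) auto
      also have "\<dots> = ennreal (P * d)" using P(1) d(1) by (simp add: ennreal_mult)
      also have "\<dots> \<le> ennreal \<delta>" by (rule ennreal_leI[OF d(3)])
      finally have "md (\<lambda>x. Us k x + (-1) * U x) \<le> ennreal \<delta>" .
      then have "0 \<le> sobolev_norm \<Phi> D (\<lambda>x. Us k x + (-1) * U x) \<and> sobolev_norm \<Phi> D (\<lambda>x. Us k x + (-1) * U x) \<le> r / 2"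
        by (rule \<delta>(2)[rule_format, OF Wd D(2,1) _ order_trans[OF g ennreal_leI[OF d(2)]]])
      then show ?thesis using \<open>r > 0\<close> by simp
    qed
    then show "\<exists>N. \<forall>k\<ge>N. norm (sobolev_norm \<Phi> D (\<lambda>x. Us k x + (-1) * U x) - 0) < r" by blast
  qed
  have s0: "U \<in> sobolev0 \<Phi> D" "Us k \<in> sobolev0 \<Phi> D" "(\<lambda>x. (-1) * U x) \<in> sobolev0 \<Phi> D"
    "(\<lambda>x. Us k x + (-1) * U x) \<in> sobolev0 \<Phi> D" for k
    by (rule Wpair_sobolev0[OF W D(2,1)] Wpair_sobolev0[OF Ws D(2,1)] Wpair_sobolev0[OF WU D(2,1)] Wpair_sobolev0[OF Wd D(2,1)])+
  have "(\<lambda>k. L (Us k)) \<longlonglongrightarrow> L U" if L: "L \<in> sobolev0_dual \<Phi> D" for L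
  proof -
    have add: "\<And>u v. u \<in> sobolev0 \<Phi> D \<Longrightarrow> v \<in> sobolev0 \<Phi> D \<Longrightarrow> L (\<lambda>x. u x + v x) = L u + L v"
      and scale: "\<And>c u. u \<in> sobolev0 \<Phi> D \<Longrightarrow> L (\<lambda>x. c * u x) = c * L u"
      using L by (auto simp: sobolev0_dual_def)
    obtain C where C: "\<forall>u\<in>sobolev0 \<Phi> D. \<bar>L u\<bar> \<le> C * sobolev_norm \<Phi> D u"
      using L by (auto simp: sobolev0_dual_def)
    have "L (\<lambda>x. Us k x + (-1) * U x) = L (Us k) - L U" for k
      using add[OF s0(2,3), of k] scale[OF s0(1), of "-1"] by simp
    then have le: "norm (L (Us k) - L U) \<le> C * sobolev_norm \<Phi> D (\<lambda>x. Us k x + (-1) * U x)" for k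
      using bspec[OF C s0(4), of k] by simp
    have "(\<lambda>k. C * sobolev_norm \<Phi> D (\<lambda>x. Us k x + (-1) * U x)) \<longlonglongrightarrow> 0"
      using tendsto_mult_left[OF norm_lim, of C] by simp
    then have "(\<lambda>k. L (Us k) - L U) \<longlonglongrightarrow> 0"
      by (rule Lim_null_comparison[rotated]) (use le in \<open>simp add: always_eventually\<close>)
    then show ?thesis by (rule LIM_zero_cancel)
  qed
  then show ?thesis
    using s0 unfolding weakly_converges_sobolev0_def Us_def U_def by blast
qed

end

theorem theorem3p11:
  fixes D \<Omega> :: "'a::euclidean_space set"
    and \<Omega>s :: "nat \<Rightarrow> 'a set"
    and \<Phi> \<phi> :: "real \<Rightarrow> real"
    and pm pp :: real
    and f u :: "'a \<Rightarrow> real"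
    and us :: "nat \<Rightarrow> 'a \<Rightarrow> real"
  assumes "open D" and "bounded D"
    and "young_function \<Phi> \<phi>"
    and "\<And>t. t > 0 \<Longrightarrow> \<phi> differentiable (at t)"
    and "1 < pm"
    and "\<And>t. t > 0 \<Longrightarrow> pm \<le> t * deriv \<phi> t / \<phi> t \<and> t * deriv \<phi> t / \<phi> t \<le> pp"
    and "convex_on {0..} \<phi>"
    and "f \<in> orlicz_space (young_conj \<Phi>) D"
    and "\<And>k. open (\<Omega>s k) \<and> \<Omega>s k \<subseteq> D"
    and "open \<Omega>" and "\<Omega> \<subseteq> D"
    and "(\<lambda>k. hausdorff_compl_distance (\<Omega>s k) \<Omega>) \<longlonglongrightarrow> 0"
    and "(\<lambda>k. capacity \<Phi> (\<Omega>s k - \<Omega>) D) \<longlonglongrightarrow> 0"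
    and "\<And>k. weak_solution \<Phi> \<phi> (\<Omega>s k) f (us k)"
    and "weak_solution \<Phi> \<phi> \<Omega> f u"
  shows "\<exists>r. strict_mono r \<and>
    weakly_converges_sobolev0 \<Phi> D (\<lambda>k. zero_ext (\<Omega>s (r k)) (us (r k))) (zero_ext \<Omega> u)"
proof -
  have "1 \<le> pp" using assms(5) assms(6)[of 1] by simp
  then interpret young \<Phi> \<phi> pp
    using assms(3,4,6,7) by unfold_locales blast+
  have "weakly_converges_sobolev0 \<Phi> D (\<lambda>k. zero_ext (\<Omega>s k) (us k)) (zero_ext \<Omega> u)"
    by (rule weak_convergence[OF assms(1,2,8-15)])
  \<comment> \<open>The whole sequence converges, so the identity serves as the subsequence.\<close>
  then show ?thesis by (intro exI[of _ id]) (simp add: strict_mono_def)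
qed

end
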